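(* Let $m,k\ge 1$ be integers and $\alpha>0$ be such that $Q_\alpha = m+(\alpha+1)k\ge 3$. Let $R_0>0$, $\kappa>0$, and let $f\not\equiv 0$ be a solution to $$\mathscr B_\alpha f = -\kappa^2 f\quad\text{in } \Omega_0=\{x\in\mathbb R^{m+k} \mid \rho_\alpha(x)>R_0\}.$$ Then there exist $R_1>R_0$ sufficiently large and a constant $M=M(m,k,f)>0$ such that for every $R>R_1$ one has $$\int_{R<\rho_\alpha(x)<2R}|f|^2\,dx\ \ge\ M R.$$
   Context: Let $N=m+k$ and write points of $\mathbb R^N$ as $x=(z,\sigma)$ with $z\in\mathbb R^m$, $\sigma\in\mathbb R^k$; $dx=dz\,d\sigma$ is Lebesgue measure. For $\alpha>0$, the Baouendi-Grushin operator is $\mathscr B_\alpha=\Delta_z+\frac{|z|^{2\alpha}}{4}\Delta_\sigma$. The pseudo-gauge is $\rho_\alpha(z,\sigma)=\left(|z|^{2(\alpha+1)}+4(\alpha+1)^2|\sigma|^2\right)^{\frac{1}{2(\alpha+1)}}$, and the homogeneous dimension is $Q_\alpha=m+(\alpha+1)k$. Let $X_i=\partial_{z_i}$ for $i=1,\dots,m$ and $X_{m+j}=\frac{|z|^\alpha}{2}\partial_{\sigma_j}$ for $j=1,\dots,k$, so that $\mathscr B_\alpha=\sum_{i=1}^N X_i^2$. For an open set $\Omega\subset\mathbb R^N$, $\Gamma^1(\Omega)$ is the set of $f\in C(\Omega)$ such that $X_jf\in C(\Omega)$ for all $j$ (derivatives in the distributional sense), and $\Gamma^2(\Omega)$ is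 the set of $f\in C(\Omega)$ such that $f, X_jf\in\Gamma^1(\Omega)$ for all $j$. Solutions in an open set $\Omega$ are real-valued and belong to $\Gamma^2(\Omega)$. *)

theory Defs
  imports "HOL-Analysis.Analysis"
begin

text \<open>
  Points of \<open>\<real>\<^sup>m \<times> \<real>\<^sup>k\<close> are pairs \<open>(z, \<sigma>) :: (real^'m) \<times> (real^'k)\<close> with \<open>m = CARD('m)\<close> and
  \<open>k = CARD('k)\<close>. The vector fields \<open>X\<^sub>1, \<dots>, X\<^sub>N\<close> are indexed by the disjoint sum \<open>'m + 'k\<close>:
  \<open>Inl i\<close> stands for \<open>X\<^sub>i\<close> and \<open>Inr j\<close> for \<open>X\<^bsub>m+j\<^esub>\<close>.
\<close>

definition pseudo_gauge :: "real \<Rightarrow> (real^'m) \<times> (real^'k) \<Rightarrow> real" where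
  "pseudo_gauge \<alpha> x =
     (norm (fst x) powr (2 * (\<alpha> + 1)) + 4 * (\<alpha> + 1)\<^sup>2 * (norm (snd x))\<^sup>2) powr (1 / (2 * (\<alpha> + 1)))"

definition dir_deriv :: "'a::real_normed_vector \<Rightarrow> ('a \<Rightarrow> real) \<Rightarrow> 'a \<Rightarrow> real" where
  "dir_deriv v \<phi> x = deriv (\<lambda>t. \<phi> (x + t *\<^sub>R v)) 0"

text \<open>
  \<open>n\<close>-fold continuous differentiability on the whole space. Continuity of the derivatives of order
  less than \<open>n\<close> is implied by their Frechet differentiability.
\<close>

primrec C_diff :: "nat \<Rightarrow> ('a::euclidean_space \<Rightarrow> real) \<Rightarrow> bool" where
  "C_diff 0 \<phi> \<longleftrightarrow> continuous_on UNIV \<phi>"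
| "C_diff (Suc n) \<phi> \<longleftrightarrow>
     (\<forall>x. \<phi> differentiable (at x)) \<and> (\<forall>b\<in>Basis. C_diff n (dir_deriv b \<phi>))"

definition test_functions :: "'a::euclidean_space set \<Rightarrow> ('a \<Rightarrow> real) set" where
  "test_functions \<Omega> =
     {\<phi>. (\<forall>n. C_diff n \<phi>) \<and> compact (closure {x. \<phi> x \<noteq> 0}) \<and> closure {x. \<phi> x \<noteq> 0} \<subseteq> \<Omega>}"

fun X_field :: "real \<Rightarrow> 'm + 'k \<Rightarrow> ((real^'m) \<times> (real^'k) \<Rightarrow> real) \<Rightarrow> (real^'m) \<times> (real^'k) \<Rightarrow> real"
  where
  "X_field \<alpha> (Inl i) \<phi> x = dir_deriv (axis i 1, 0) \<phi> x"
| "X_field \<alpha> (Inr j) \<phi> x = norm (fst x) powr \<alpha> / 2 * dir_deriv (0, axis j 1) \<phi> x"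

text \<open>
  \<open>has_X_deriv \<alpha> \<Omega> i f g\<close>: the distribution \<open>X\<^sub>i f\<close> on \<open>\<Omega>\<close> is the continuous function \<open>g\<close>. The
  coefficient of \<open>X\<^sub>i\<close> does not depend on the variable being differentiated, so the formal
  adjoint of \<open>X\<^sub>i\<close> is \<open>-X\<^sub>i\<close>.
\<close>

definition has_X_deriv ::
  "real \<Rightarrow> ((real^'m) \<times> (real^'k)) set \<Rightarrow> 'm + 'k \<Rightarrow>
    ((real^'m) \<times> (real^'k) \<Rightarrow> real) \<Rightarrow> ((real^'m) \<times> (real^'k) \<Rightarrow> real) \<Rightarrow> bool" where
  "has_X_deriv \<alpha> \<Omega> i f g \<longleftrightarrow>
     continuous_on \<Omega> g \<and>
     (\<forall>\<phi>\<in>test_functions \<Omega>.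
        (LINT x:\<Omega>|lborel. f x * X_field \<alpha> i \<phi> x) = - (LINT x:\<Omega>|lborel. g x * \<phi> x))"

definition Gamma1 :: "real \<Rightarrow> ((real^'m) \<times> (real^'k)) set \<Rightarrow> ((real^'m) \<times> (real^'k) \<Rightarrow> real) set"
  where
  "Gamma1 \<alpha> \<Omega> = {f. continuous_on \<Omega> f \<and> (\<forall>i. \<exists>g. has_X_deriv \<alpha> \<Omega> i f g)}"

definition Gamma2 :: "real \<Rightarrow> ((real^'m) \<times> (real^'k)) set \<Rightarrow> ((real^'m) \<times> (real^'k) \<Rightarrow> real) set"
  where
  "Gamma2 \<alpha> \<Omega> = {f \<in> Gamma1 \<alpha> \<Omega>. \<forall>i. \<exists>g\<in>Gamma1 \<alpha> \<Omega>. has_X_deriv \<alpha> \<Omega> i f g}"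

text \<open>
  \<open>has_grushin \<alpha> \<Omega> f F\<close>: the Baouendi-Grushin operator \<open>\<Sum>\<^sub>i X\<^sub>i (X\<^sub>i f)\<close> applied to \<open>f\<close> is \<open>F\<close>
  on \<open>\<Omega>\<close>. On open \<open>\<Omega>\<close> the functions \<open>g i\<close> and \<open>h i\<close> are uniquely determined by \<open>f\<close>, since
  continuous functions defining the same distribution coincide.
\<close>

definition has_grushin ::
  "real \<Rightarrow> ((real^'m) \<times> (real^'k)) set \<Rightarrow>
    ((real^'m) \<times> (real^'k) \<Rightarrow> real) \<Rightarrow> ((real^'m) \<times> (real^'k) \<Rightarrow> real) \<Rightarrow> bool" where
  "has_grushin \<alpha> \<Omega> f F \<longleftrightarrow>
     (\<exists>g h. (\<forall>i. has_X_deriv \<alpha> \<Omega> i f (g i) \<and> has_X_deriv \<alpha> \<Omega> i (g i) (h i)) \<and>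
            (\<forall>x\<in>\<Omega>. (\<Sum>i\<in>UNIV. h i x) = F x))"

text \<open>
  For classically twice differentiable functions the sum of squares of the vector fields is
  \<open>\<Delta>\<^sub>z + |z|\<^bsup>2\<alpha>\<^esup>/4 \<Delta>\<^sub>\<sigma>\<close>.
\<close>

lemma sum_X_field_squares:
  fixes \<phi> :: "(real^'m) \<times> (real^'k) \<Rightarrow> real"
  assumes "C_diff 2 \<phi>"
  shows "(\<Sum>i\<in>UNIV. X_field \<alpha> i (X_field \<alpha> i \<phi>) x) =
     (\<Sum>i\<in>UNIV. dir_deriv (axis i 1, 0) (dir_deriv (axis i 1, 0) \<phi>) x) +
     norm (fst x) powr (2 * \<alpha>) / 4 *
       (\<Sum>j\<in>UNIV. dir_deriv (0, axis j 1) (dir_deriv (0, axis j 1) \<phi>) x)"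
proof -
  have *: "X_field \<alpha> (Inr j) (X_field \<alpha> (Inr j) \<phi>) x =
      norm (fst x) powr (2 * \<alpha>) / 4 * dir_deriv (0, axis j 1) (dir_deriv (0, axis j 1) \<phi>) x" for j
  proof -
    let ?v = "(0, axis j 1) :: (real^'m) \<times> (real^'k)"
    let ?\<psi> = "dir_deriv ?v \<phi>"
    have "?v \<in> Basis"
      by (auto simp: Basis_prod_def Basis_vec_def)
    with assms have "\<forall>y. ?\<psi> differentiable (at y)"
      by (auto simp: numeral_2_eq_2)
    then obtain D where D: "(?\<psi> has_derivative D) (at x)"
      unfolding differentiable_def by blast
    have "((\<lambda>t. x + t *\<^sub>R ?v) has_derivative (\<lambda>t. t *\<^sub>R ?v)) (at 0)"
      by (auto intro!: derivative_eq_intros)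
    moreover have "(?\<psi> has_derivative D) (at (x + 0 *\<^sub>R ?v))"
      using D by (simp only: scaleR_zero_left add_0_right)
    ultimately have "((\<lambda>t. ?\<psi> (x + t *\<^sub>R ?v)) has_derivative (\<lambda>t. D (t *\<^sub>R ?v))) (at 0)"
      by (rule has_derivative_compose)
    moreover have "(\<lambda>t. D (t *\<^sub>R ?v)) = (*) (D ?v)"
      using linear_scale[OF has_derivative_linear[OF D]] by (simp add: fun_eq_iff mult.commute del: scaleR_Pair)
    ultimately have d: "((\<lambda>t. ?\<psi> (x + t *\<^sub>R ?v)) has_field_derivative D ?v) (at 0)"
      by (simp add: has_field_derivative_def)
    have "((\<lambda>t. norm (fst x) powr \<alpha> / 2 * ?\<psi> (x + t *\<^sub>R ?v)) has_field_derivative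
        norm (fst x) powr \<alpha> / 2 * D ?v) (at 0)"
      using DERIV_cmult[OF d] .
    then have "deriv (\<lambda>t. norm (fst x) powr \<alpha> / 2 * ?\<psi> (x + t *\<^sub>R ?v)) 0 =
        norm (fst x) powr \<alpha> / 2 * dir_deriv ?v ?\<psi> x"
      using DERIV_imp_deriv[OF d] unfolding dir_deriv_def[of ?v ?\<psi>] by (simp add: DERIV_imp_deriv)
    then have "dir_deriv ?v (X_field \<alpha> (Inr j) \<phi>) x =
        norm (fst x) powr \<alpha> / 2 * dir_deriv ?v ?\<psi> x"
      unfolding dir_deriv_def[of ?v "X_field \<alpha> (Inr j) \<phi>"] by simp
    moreover have "norm (fst x) powr (2 * \<alpha>) = norm (fst x) powr \<alpha> * norm (fst x) powr \<alpha>"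
      by (simp flip: powr_add)
    ultimately show ?thesis
      by simp
  qed
  have "X_field \<alpha> (Inl i) \<phi> = dir_deriv (axis i 1, 0) \<phi>" for i
    by (simp add: fun_eq_iff)
  then show ?thesis
    by (simp add: UNIV_sum sum.Plus[unfolded Plus_def] * sum_distrib_left del: X_field.simps(2))
qed

end

theory Submission
  imports Defs
begin

text \<open>
  Let \<open>\<rho>\<close> be the gauge, \<open>Z\<close> the generator of its dilations, \<open>\<omega> = |z|\<^bsup>2\<alpha>\<^esup> / \<rho>\<^bsup>2\<alpha>+2\<^esup>\<close> and
  \<open>\<tau> = (Q - 1) / 2\<close>. The average \<open>u\<close> of \<open>f\<close> in the \<open>\<sigma>\<close> variables solves the same equation. For a bump
  \<open>\<zeta>\<close>, integrate against the weight \<open>\<zeta> (ln \<rho> - t) \<rho>\<close> the functions \<open>\<omega> (Z u)\<^sup>2\<close>, \<open>\<omega> u Z u\<close>, \<open>\<omega> u\<^sup>2\<close>,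
  \<open>\<kappa>\<^sup>2 u\<^sup>2\<close>, \<open>|X u|\<^sup>2\<close> to get functions \<open>A, B, Y, M, G\<close> of \<open>t\<close>. The dilation, energy and Pohozaev identities
  read \<open>Y' = 2 B + 2 \<tau> Y\<close>, \<open>G = M - B + B'\<close> and \<open>\<tau> G - G'/2 - A + A' = ((2 \<tau> + 2) M - M') / 2\<close>.
  They imply that \<open>F = 2 A + 2 \<tau> B + \<tau> Y + M - G\<close> satisfies
  \<open>(e\<^bsup>-2t\<^esup> F)' = 2 e\<^bsup>-2t\<^esup> (G - A + (\<tau>\<^sup>2 - \<tau>) Y)\<close>, which is nonnegative because \<open>A \<le> G\<close> and, by \<open>Q \<ge> 3\<close>,
  \<open>\<tau> \<ge> 1\<close>. If the asserted bound fails, then \<open>f\<close> is so small on a sequence of annuli that \<open>F \<le> 0\<close>.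

  Passing from \<open>u\<close> to \<open>\<rho>\<^sup>m u\<close> replaces \<open>F\<close> by \<open>F\<^sub>m = e\<^bsup>2mt\<^esup> (F + m Y' + (m + 2 m\<^sup>2) Y)\<close>, which is nondecreasing.
  Since \<open>Y \<le> C e\<^bsup>-2t\<^esup> M\<close>, every bound \<open>F\<^sub>m \<le> 0\<close> yields enough decay of \<open>Y\<close> to give \<open>F\<^bsub>m+1\<^esub> \<le> 0\<close>. Dividing
  \<open>F\<^sub>m \<le> 0\<close> by \<open>m\<^sup>2\<close> and letting \<open>m\<close> grow forces \<open>Y = 0\<close>. This holds for every averaging kernel and every \<open>t\<close>
  beyond a threshold that tends to \<open>ln R\<^sub>0\<close>, hence \<open>f = 0\<close> without any appeal to unique continuation.
\<close>

section \<open>Test functions\<close>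

text \<open>Membership in \<open>Gamma2\<close> controls only the fields X_i, which degenerate on z
  = 0, whereas Z contains full \<sigma> derivatives. The Pohozaev multiplier Z f is therefore not
  controlled near z = 0, and averaging in \<sigma> supplies the missing derivatives. The average is
  still not known to be C^2, so the identities are proved for jointly mollified functions and only
  their integrated form is carried to the limit. The coefficient |z|^(2 \<alpha>) need not be
  differentiable across z = 0. Every integration by parts runs along a line or a dilation orbit,
  where the coefficient is constant or homogeneous. Smearing over ln \<rho> puts each t derivative
  on the bump, so A, B, Y, M, G are differentiable without further regularity of u. With the factor
  \<rho> in the weight, mass o(R) on annuli becomes o(exp (2 t)), the rate needed for exp (-2 t) F.
  No decay of gradients is available or needed: A is at most G, G equals M - B + B', and B, B' are
  expressed by smears of \<omega> u^2.\<close>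

lemma has_real_derivative_line:
  fixes \<phi> :: "'a::real_normed_vector \<Rightarrow> real"
  assumes "(\<phi> has_derivative D) (at (x + s *\<^sub>R v))"
  shows "((\<lambda>t. \<phi> (x + t *\<^sub>R v)) has_real_derivative D v) (at s)"
proof -
  have "((\<lambda>t. x + t *\<^sub>R v) has_derivative (\<lambda>t. t *\<^sub>R v)) (at s)"
    by (auto intro!: derivative_eq_intros)
  from has_derivative_compose[OF this assms]
  have "((\<lambda>t. \<phi> (x + t *\<^sub>R v)) has_derivative (\<lambda>t. D (t *\<^sub>R v))) (at s)" .
  moreover have "(\<lambda>t. D (t *\<^sub>R v)) = (*) (D v)"
    using linear_scale[OF has_derivative_linear[OF assms]] by (simp add: fun_eq_iff mult.commute)
  ultimately show ?thesis by (simp add: has_field_derivative_def)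
qed

lemma dir_deriv_eq:
  assumes "(\<phi> has_derivative D) (at x)"
  shows "dir_deriv v \<phi> x = D v"
  unfolding dir_deriv_def
  by (rule DERIV_imp_deriv, rule has_real_derivative_line) (use assms in simp)

lemma has_derivative_dir_deriv:
  fixes \<phi> :: "'a::real_normed_vector \<Rightarrow> real"
  assumes "\<phi> differentiable (at x)"
  shows "(\<phi> has_derivative (\<lambda>v. dir_deriv v \<phi> x)) (at x)"
proof -
  obtain D where D: "(\<phi> has_derivative D) (at x)"
    using assms by (auto simp: differentiable_def)
  moreover from D have "D = (\<lambda>v. dir_deriv v \<phi> x)"
    by (simp add: dir_deriv_eq fun_eq_iff)
  ultimately show ?thesis by simp
qed

lemma dir_deriv_Basis_sum:
  fixes \<phi> :: "'a::euclidean_space \<Rightarrow> real"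
  assumes "\<phi> differentiable (at x)"
  shows "dir_deriv v \<phi> x = (\<Sum>b\<in>Basis. (v \<bullet> b) * dir_deriv b \<phi> x)"
proof -
  interpret D: bounded_linear "\<lambda>v. dir_deriv v \<phi> x"
    using has_derivative_dir_deriv[OF assms] by (rule has_derivative_bounded_linear)
  have "dir_deriv (\<Sum>b\<in>Basis. (v \<bullet> b) *\<^sub>R b) \<phi> x = (\<Sum>b\<in>Basis. (v \<bullet> b) * dir_deriv b \<phi> x)"
    by (simp add: D.sum D.scaleR)
  then show ?thesis by (simp add: euclidean_representation)
qed

lemma C_diff_Suc_imp: "C_diff (Suc n) \<phi> \<Longrightarrow> C_diff n \<phi>"
proof (induction n arbitrary: \<phi>)
  case 0
  then show ?case
    by (auto simp: continuous_on_eq_continuous_at intro!: differentiable_imp_continuous_within)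
next
  case (Suc n)
  then show ?case by (metis C_diff.simps(2))
qed

lemma C_diff_const: "C_diff n (\<lambda>x. c)"
proof (induction n arbitrary: c)
  case (Suc n)
  have "dir_deriv b (\<lambda>x::'a. c) = (\<lambda>x. 0)" for b
    by (rule ext, rule dir_deriv_eq) simp
  then show ?case using Suc by simp
qed simp

lemma C_diff_add:
  assumes "C_diff n f" "C_diff n g"
  shows "C_diff n (\<lambda>x. f x + g x)"
  using assms
proof (induction n arbitrary: f g)
  case 0
  then show ?case by (auto intro: continuous_intros)
next
  case (Suc n)
  have d: "f differentiable (at x)" "g differentiable (at x)" for x
    using Suc.prems by auto
  have "dir_deriv b (\<lambda>x. f x + g x) = (\<lambda>x. dir_deriv b f x + dir_deriv b g x)" for b
    by (rule ext, rule dir_deriv_eq)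
       (auto intro!: has_derivative_add has_derivative_dir_deriv d)
  then show ?case using Suc by (auto intro!: differentiable_add)
qed

lemma C_diff_mult:
  assumes "C_diff n f" "C_diff n g"
  shows "C_diff n (\<lambda>x. f x * g x)"
  using assms
proof (induction n arbitrary: f g)
  case 0
  then show ?case by (auto intro: continuous_intros)
next
  case (Suc n)
  have d: "f differentiable (at x)" "g differentiable (at x)" for x
    using Suc.prems by auto
  have "dir_deriv b (\<lambda>x. f x * g x) = (\<lambda>x. f x * dir_deriv b g x + dir_deriv b f x * g x)" for b
    by (rule ext, rule dir_deriv_eq)
       (intro has_derivative_mult has_derivative_dir_deriv d)
  then show ?case
    using Suc C_diff_Suc_imp[OF Suc.prems(1)] C_diff_Suc_imp[OF Suc.prems(2)]
    by (auto intro!: differentiable_mult C_diff_add)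
qed

lemma C_diff_sum: "(\<And>i. i \<in> I \<Longrightarrow> C_diff n (f i)) \<Longrightarrow> C_diff n (\<lambda>x. \<Sum>i\<in>I. f i x)"
  by (induction I rule: infinite_finite_induct) (auto intro: C_diff_const C_diff_add)

lemma C_diff_prod: "(\<And>i. i \<in> I \<Longrightarrow> C_diff n (f i)) \<Longrightarrow> C_diff n (\<lambda>x. \<Prod>i\<in>I. f i x)"
  by (induction I rule: infinite_finite_induct) (auto intro: C_diff_const C_diff_mult)

lemma differentiable_affine:
  assumes "bounded_linear T" and "\<phi> differentiable (at (c + T x))"
  shows "((\<lambda>x. \<phi> (c + T x)) has_derivative (\<lambda>v. dir_deriv (T v) \<phi> (c + T x))) (at x)"
proof -
  have "((\<lambda>x. c + T x) has_derivative T) (at x)"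
    using bounded_linear_imp_has_derivative[OF assms(1), of "at x"]
    by (auto intro!: derivative_eq_intros)
  from has_derivative_compose[OF this has_derivative_dir_deriv[OF assms(2)]] show ?thesis .
qed

lemma C_diff_affine:
  fixes \<phi> :: "'a::euclidean_space \<Rightarrow> real" and T :: "'b::euclidean_space \<Rightarrow> 'a"
  assumes T: "bounded_linear T" and "C_diff n \<phi>"
  shows "C_diff n (\<lambda>x. \<phi> (c + T x))"
  using assms(2)
proof (induction n arbitrary: \<phi>)
  case 0
  have "continuous_on UNIV (\<lambda>x. c + T x)"
    using bounded_linear.continuous_on[OF T] by (auto intro!: continuous_intros)
  with 0 show ?case by (auto intro: continuous_on_compose2)
next
  case (Suc n)
  have d: "\<phi> differentiable (at x)" for x
    using Suc.prems by auto
  have *: "dir_deriv b (\<lambda>x. \<phi> (c + T x)) = (\<lambda>x. \<Sum>a\<in>Basis. (T b \<bullet> a) * dir_deriv a \<phi> (c + T x))" for b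
    by (rule ext, subst dir_deriv_eq[OF differentiable_affine[OF T d]], rule dir_deriv_Basis_sum, rule d)
  have "C_diff n (\<lambda>x. \<Sum>a\<in>Basis. (T b \<bullet> a) * dir_deriv a \<phi> (c + T x))" for b
    using Suc by (intro C_diff_sum C_diff_mult C_diff_const) auto
  moreover have "(\<lambda>x. \<phi> (c + T x)) differentiable (at x)" for x
    using differentiable_affine[OF T d] by (auto simp: differentiable_def)
  ultimately show ?case using * by auto
qed

lemma C_diff_bounded_linear:
  fixes T :: "'a::euclidean_space \<Rightarrow> real"
  assumes T: "bounded_linear T"
  shows "C_diff n T"
proof (cases n)
  case 0
  then show ?thesis using linear_continuous_on[OF T] by simp
next
  case (Suc k)
  have *: "(T has_derivative T) (at x)" for x
    by (rule bounded_linear_imp_has_derivative[OF T])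
  then have "dir_deriv b T = (\<lambda>x. T b)" for b
    by (simp add: fun_eq_iff dir_deriv_eq[OF *])
  with * Suc C_diff_const show ?thesis by (auto simp: differentiable_def)
qed

lemma C_diff_real_polynomial:
  fixes p :: "'a::euclidean_space \<Rightarrow> real"
  assumes "real_polynomial_function p"
  shows "C_diff n p"
  using assms by induction (auto intro: C_diff_bounded_linear C_diff_const C_diff_add C_diff_mult)

lemma C_diff_dir_deriv:
  assumes "\<And>n. C_diff n \<phi>"
  shows "C_diff n (dir_deriv v \<phi>)"
proof -
  have "\<phi> differentiable (at x)" for x
    using assms[of 1] by simp
  then have "dir_deriv v \<phi> = (\<lambda>x. \<Sum>b\<in>Basis. (v \<bullet> b) * dir_deriv b \<phi> x)"
    by (simp add: fun_eq_iff dir_deriv_Basis_sum)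
  moreover have "C_diff n (dir_deriv b \<phi>)" if "b \<in> Basis" for b
    using assms[of "Suc n"] that by simp
  ultimately show ?thesis
    by (auto intro!: C_diff_sum C_diff_mult C_diff_const)
qed

lemma C_diff_continuous: "C_diff n \<phi> \<Longrightarrow> continuous_on UNIV \<phi>"
  by (induction n) (auto dest: C_diff_Suc_imp simp del: C_diff.simps(2))

section \<open>The flat function exp (-1/t) and smooth bumps\<close>

definition flat :: "real poly \<Rightarrow> real \<Rightarrow> real" where
  "flat q t = (if t > 0 then poly q (1 / t) * exp (- (1 / t)) else 0)"

lemma poly_exp_tendsto_0: "((\<lambda>s::real. poly q s * exp (- s)) \<longlongrightarrow> 0) at_top"
proof -
  have "((\<lambda>s::real. \<Sum>i\<le>degree q. coeff q i * (s ^ i / exp s)) \<longlongrightarrow> (\<Sum>i\<le>degree q. coeff q i * 0)) at_top"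
    by (intro tendsto_sum tendsto_mult tendsto_const tendsto_power_div_exp_0)
  then show ?thesis
    by (simp add: poly_altdef sum_distrib_right exp_minus divide_inverse mult.assoc)
qed

lemma flat_tendsto_0: "(flat q \<longlongrightarrow> 0) (at 0)"
proof -
  have "((\<lambda>t::real. poly q (inverse t) * exp (- inverse t)) \<longlongrightarrow> 0) (at_right 0)"
    by (rule filterlim_compose[OF poly_exp_tendsto_0 filterlim_inverse_at_top_right])
  then have "(flat q \<longlongrightarrow> 0) (at_right 0)"
    by (rule Lim_transform_eventually)
       (auto simp: flat_def eventually_at_filter inverse_eq_divide)
  moreover have "(flat q \<longlongrightarrow> 0) (at_left 0)"
    by (rule Lim_transform_eventually[OF tendsto_const])
       (auto simp: flat_def eventually_at_filter)
  ultimately show ?thesis by (simp add: filterlim_split_at)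
qed

text \<open>The chain rule yields (q - q')(1/t) / t^2 times the exponential, and 1/t^2 is absorbed
  into the polynomial. The class \<open>flat q\<close> is thus closed under differentiation, and
  smoothness of all its members follows by one induction.\<close>

lemma flat_has_derivative:
  "(flat q has_real_derivative flat ([:0, 0, 1:] * (q - pderiv q)) t) (at t)"
proof -
  consider "t > 0" | "t < 0" | "t = 0" by linarith
  then show ?thesis
  proof cases
    case 1
    have "((\<lambda>t. poly q (1 / t) * exp (- (1 / t))) has_real_derivative
        poly ([:0, 0, 1:] * (q - pderiv q)) (1 / t) * exp (- (1 / t))) (at t)"
      using 1 by (auto intro!: derivative_eq_intros DERIV_chain'[OF _ poly_DERIV]
          simp: field_simps power2_eq_square)
    then show ?thesis
      using 1 by (auto simp: flat_def intro: DERIV_cong_ev[THEN iffD1, rotated 3]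
          intro!: eventually_mono[OF eventually_nhds_in_open[of "{0<..}"]])
  next
    case 2
    have "((\<lambda>t. 0::real) has_real_derivative 0) (at t)" by simp
    then have "(flat q has_real_derivative 0) (at t)"
      by (rule DERIV_cong_ev[THEN iffD1, rotated 3])
         (use 2 in \<open>auto simp: flat_def intro!: eventually_mono[OF eventually_nhds_in_open[of "{..<0}"]]\<close>)
    then show ?thesis using 2 by (simp add: flat_def)
  next
    case 3
    have "((\<lambda>h. flat (pCons 0 q) h) \<longlongrightarrow> 0) (at 0)" by (rule flat_tendsto_0)
    \<comment> \<open>\<open>pCons 0 q\<close> multiplies q by its variable, that is by 1/h, so the
      difference quotient at 0 is again a flat function and tends to 0.\<close>
    moreover have "flat (pCons 0 q) h = (flat q (0 + h) - flat q 0) / h" for h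
      by (simp add: flat_def)
    ultimately have "(flat q has_real_derivative 0) (at 0)" by (simp add: DERIV_def)
    then show ?thesis using 3 by (simp add: flat_def)
  qed
qed

lemma C_diff_flat: "C_diff n (flat q)"
proof (induction n arbitrary: q)
  case 0
  show ?case
    using DERIV_continuous[OF flat_has_derivative] by (auto simp: continuous_on_eq_continuous_at)
next
  case (Suc n)
  have "dir_deriv 1 (flat q) = flat ([:0, 0, 1:] * (q - pderiv q))"
    using dir_deriv_eq[OF flat_has_derivative[unfolded has_field_derivative_def]]
    by (simp add: fun_eq_iff)
  moreover have "flat q differentiable (at t)" for t
    using flat_has_derivative real_differentiable_def by blast
  ultimately show ?case using Suc by simp
qed

text \<open>A product over coordinates, since linear forms compose smoothly with \<open>flat\<close>
  whereas the norm would need care at 0. The set of positivity is therefore an open cube, not a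
  ball.\<close>

definition bump :: "real \<Rightarrow> 'a::euclidean_space \<Rightarrow> real" where
  "bump d x = (\<Prod>b\<in>Basis. flat 1 (1 + (x \<bullet> b) / d) * flat 1 (1 - (x \<bullet> b) / d))"

lemma flat_1: "flat 1 t \<ge> 0" "flat 1 t > 0 \<longleftrightarrow> t > 0" "flat 1 t = 0 \<longleftrightarrow> t \<le> 0"
  by (auto simp: flat_def)

lemma C_diff_bump: "C_diff n (bump d :: 'a::euclidean_space \<Rightarrow> real)"
proof -
  have "bounded_linear (\<lambda>x::'a. (x \<bullet> b) / d)" "bounded_linear (\<lambda>x::'a. - ((x \<bullet> b) / d))" for b
    by (simp_all add: bounded_linear_divide[THEN bounded_linear_compose] bounded_linear_inner_left
        bounded_linear_minus)
  from C_diff_affine[OF this(1) C_diff_flat, of _ 1] C_diff_affine[OF this(2) C_diff_flat, of _ 1]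
  show ?thesis
    unfolding bump_def[abs_def] by (auto intro!: C_diff_prod C_diff_mult)
qed

lemma bump_nonneg: "bump d x \<ge> 0"
  unfolding bump_def by (intro prod_nonneg mult_nonneg_nonneg ballI flat_1)

lemma bump_pos:
  assumes "d > 0"
  shows "bump d x > 0 \<longleftrightarrow> (\<forall>b\<in>Basis. \<bar>x \<bullet> b\<bar> < d)"
proof
  assume *: "\<forall>b\<in>Basis. \<bar>x \<bullet> b\<bar> < d"
  have "1 + (x \<bullet> b) / d > 0 \<and> 1 - (x \<bullet> b) / d > 0" if "b \<in> Basis" for b
    using *[rule_format, OF that] assms by (auto simp: field_simps)
  then show "bump d x > 0"
    unfolding bump_def by (intro prod_pos mult_pos_pos) (auto simp: flat_1)
next
  assume *: "bump d x > 0"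
  show "\<forall>b\<in>Basis. \<bar>x \<bullet> b\<bar> < d"
  proof
    fix b :: 'a assume b: "b \<in> Basis"
    have "flat 1 (1 + (x \<bullet> b) / d) * flat 1 (1 - (x \<bullet> b) / d) \<noteq> 0"
      using * b prod_zero[of Basis, OF finite_Basis] unfolding bump_def
      by (metis (no_types, lifting) less_irrefl)
    then have "1 + (x \<bullet> b) / d > 0 \<and> 1 - (x \<bullet> b) / d > 0" by (simp add: flat_1)
    then show "\<bar>x \<bullet> b\<bar> < d" using assms by (auto simp: field_simps)
  qed
qed

lemma bump_eq_0:
  fixes x :: "'a::euclidean_space" and d :: real
  assumes "d > 0" "norm x \<ge> d * DIM('a)"
  shows "bump d x = 0"
proof (rule ccontr)
  assume "bump d x \<noteq> 0"
  then have "\<forall>b\<in>Basis. \<bar>x \<bullet> b\<bar> < d"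
    using bump_nonneg[of d x] bump_pos[OF assms(1), of x] by simp
  then have "(\<Sum>b\<in>Basis. \<bar>x \<bullet> b\<bar>) < (\<Sum>b\<in>(Basis::'a set). d)"
    by (intro sum_strict_mono) auto
  then show False using norm_le_l1[of x] assms(2) by (simp add: mult.commute)
qed

section \<open>Integration against compactly supported functions\<close>

definition compact_supp :: "('a::euclidean_space \<Rightarrow> real) \<Rightarrow> bool" where
  "compact_supp w \<longleftrightarrow> continuous_on UNIV w \<and> (\<exists>r. \<forall>x. norm x > r \<longrightarrow> w x = 0)"

lemma compact_suppI: "continuous_on UNIV w \<Longrightarrow> (\<And>x. norm x > r \<Longrightarrow> w x = 0) \<Longrightarrow> compact_supp w"
  by (auto simp: compact_supp_def)

lemma integrable_compact_support:
  fixes w :: "'a::euclidean_space \<Rightarrow> real"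
  assumes "continuous_on UNIV w" and "\<And>x. norm x > r \<Longrightarrow> w x = 0"
  shows "integrable lborel w"
proof -
  have "integrable lborel (\<lambda>x. indicator (cball 0 r) x *\<^sub>R w x)"
    by (rule borel_integrable_compact) (auto intro: continuous_on_subset assms)
  also have "(\<lambda>x. indicator (cball 0 r) x *\<^sub>R w x) = w"
    using assms(2) by (auto simp: indicator_def fun_eq_iff not_le)
  finally show ?thesis .
qed

lemma compact_supp_integrable: "compact_supp w \<Longrightarrow> integrable lborel w"
  by (auto simp: compact_supp_def intro: integrable_compact_support)

text \<open>Moves to a Henstock-Kurzweil integral over a fixed box, to which the Leibniz rule with
  parameter applies.\<close>

lemma lborel_integral_eq_cbox:
  fixes w :: "'a::euclidean_space \<Rightarrow> real"
  assumes "continuous_on UNIV w" and "\<And>x. norm x > r \<Longrightarrow> w x = 0"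
  shows "(LINT x|lborel. w x) = integral (cbox (- (r *\<^sub>R One)) (r *\<^sub>R One)) w"
proof -
  have "(w has_integral (LINT x|lborel. w x)) UNIV"
    by (rule has_integral_integral_lborel, rule integrable_compact_support) (use assms in auto)
  moreover have "w = (\<lambda>x. if x \<in> cbox (- (r *\<^sub>R One)) (r *\<^sub>R One) then w x else 0)"
  proof
    fix x :: 'a
    have "x \<in> cbox (- (r *\<^sub>R One)) (r *\<^sub>R One)" if "norm x \<le> r"
      using Basis_le_norm[of _ x] that by (force simp: mem_box abs_le_iff)
    then show "w x = (if x \<in> cbox (- (r *\<^sub>R One)) (r *\<^sub>R One) then w x else 0)"
      using assms(2)[of x] by (auto simp: not_le[symmetric])
  qed
  ultimately have "((\<lambda>x. if x \<in> cbox (- (r *\<^sub>R One)) (r *\<^sub>R One) then w x else 0)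
      has_integral (LINT x|lborel. w x)) UNIV"
    by simp
  then have "(w has_integral (LINT x|lborel. w x)) (cbox (- (r *\<^sub>R One)) (r *\<^sub>R One))"
    by (simp only: has_integral_restrict_UNIV)
  then show ?thesis by (simp add: integral_unique)
qed

text \<open>A support radius common to all parameters takes the place of a dominating
  function.\<close>

lemma leibniz_compact_support:
  fixes w w' :: "real \<Rightarrow> 'a::euclidean_space \<Rightarrow> real"
  assumes deriv: "\<And>s x. s \<in> {a<..<b} \<Longrightarrow> ((\<lambda>s. w s x) has_real_derivative w' s x) (at s)"
    and cont: "\<And>s. s \<in> {a<..<b} \<Longrightarrow> continuous_on UNIV (w s)"
    and cont': "continuous_on ({a<..<b} \<times> UNIV) (\<lambda>(s, x). w' s x)"
    and supp: "\<And>s x. s \<in> {a<..<b} \<Longrightarrow> norm x > r \<Longrightarrow> w s x = 0"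
    and s0: "s0 \<in> {a<..<b}"
  shows "((\<lambda>s. LINT x|lborel. w s x) has_real_derivative (LINT x|lborel. w' s0 x)) (at s0)"
proof -
  let ?C = "cbox (- (r *\<^sub>R One)) (r *\<^sub>R One) :: 'a set"
  \<comment> \<open>\<open>w'\<close> inherits the support: for fixed x outside the ball it is the
    derivative of the zero function of s.\<close>
  have supp': "w' s x = 0" if "s \<in> {a<..<b}" "norm x > r" for s x
  proof -
    have "((\<lambda>s. 0::real) has_real_derivative w' s x) (at s)"
      by (rule DERIV_cong_ev[THEN iffD1, OF refl _ refl, OF _ deriv[OF that(1), of x]])
         (use that supp in \<open>auto intro!: eventually_mono[OF eventually_nhds_in_open[of "{a<..<b}"]]\<close>)
    then show ?thesis using DERIV_unique DERIV_const by blast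
  qed
  have "((\<lambda>s. integral ?C (w s)) has_real_derivative integral ?C (w' s0)) (at s0 within {a<..<b})"
  proof (rule leibniz_rule_field_derivative[OF _ _ _ s0])
    fix s x assume "s \<in> {a<..<b}"
    then show "((\<lambda>s. w s x) has_real_derivative w' s x) (at s within {a<..<b})"
      using deriv has_field_derivative_at_within by blast
  next
    fix s assume "s \<in> {a<..<b}"
    then show "w s integrable_on ?C"
      using cont by (auto intro: integrable_continuous continuous_on_subset)
  qed (use cont' in \<open>auto intro: continuous_on_subset\<close>)
  then have d: "((\<lambda>s. integral ?C (w s)) has_real_derivative integral ?C (w' s0)) (at s0)"
    using s0 by (simp add: at_within_open[of s0 "{a<..<b}"])
  have "continuous_on UNIV (\<lambda>x. w' s0 x)"
    using continuous_on_compose2[OF cont', of UNIV "\<lambda>x. (s0, x)"] s0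
    by (simp add: continuous_on_Pair image_subset_iff)
  then have e: "integral ?C (w' s0) = (LINT x|lborel. w' s0 x)"
    by (intro lborel_integral_eq_cbox[symmetric] supp' s0)
  have "\<forall>\<^sub>F s in nhds s0. integral ?C (w s) = (LINT x|lborel. w s x)"
    using s0 cont supp
    by (auto intro!: eventually_mono[OF eventually_nhds_in_open[of "{a<..<b}"]] lborel_integral_eq_cbox[symmetric])
  from DERIV_cong_ev[OF refl this e] d show ?thesis by simp
qed

lemma lborel_integral_affine:
  fixes w :: "'a::euclidean_space \<Rightarrow> real"
  assumes "w \<in> borel_measurable borel" "c \<noteq> 0"
  shows "(LINT x|lborel. w x) = \<bar>c\<bar> ^ DIM('a) * (LINT x|lborel. w (t + c *\<^sub>R x))"
proof -
  have "(LINT x|lborel. w x) =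
      (LINT x|density (distr lborel borel (\<lambda>x. t + c *\<^sub>R x)) (\<lambda>_. ennreal (\<bar>c\<bar> ^ DIM('a))). w x)"
    using lborel_affine[OF assms(2), of t] by (simp add: ennreal_power)
  also have "\<dots> = \<bar>c\<bar> ^ DIM('a) * (LINT x|lborel. w (t + c *\<^sub>R x))"
    using assms by (subst integral_density) (auto simp: integral_distr)
  finally show ?thesis .
qed

lemma lborel_integral_translate:
  fixes w :: "'a::euclidean_space \<Rightarrow> real"
  assumes "continuous_on UNIV w"
  shows "(LINT x|lborel. w (x + t)) = (LINT x|lborel. w x)"
  using lborel_integral_affine[OF borel_measurable_continuous_onI[OF assms], of 1 t]
  by (simp add: add.commute)

lemma lborel_integral_reflect:
  fixes w :: "'a::euclidean_space \<Rightarrow> real"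
  assumes "continuous_on UNIV w"
  shows "(LINT x|lborel. w (t - x)) = (LINT x|lborel. w x)"
  using lborel_integral_affine[OF borel_measurable_continuous_onI[OF assms], of "-1" t]
  by simp

text \<open>The integral of a translate does not depend on the shift, so its derivative, which is
  the integral of \<open>w'\<close>, vanishes. Only differentiability along \<open>v\<close> enters.
  Powers of |z|, constant along the \<sigma> directions, may therefore be rough in z.\<close>

lemma integral_derivative_line_0:
  fixes w w' :: "'a::euclidean_space \<Rightarrow> real"
  assumes w: "compact_supp w" and w': "continuous_on UNIV w'"
    and d: "\<And>x. ((\<lambda>s. w (x + s *\<^sub>R v)) has_real_derivative w' x) (at 0)"
  shows "(LINT x|lborel. w' x) = 0"
proof -
  obtain r where c: "continuous_on UNIV w" and r: "\<And>x. norm x > r \<Longrightarrow> w x = 0"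
    using w by (auto simp: compact_supp_def)
  have "((\<lambda>s. LINT x|lborel. w (x + s *\<^sub>R v)) has_real_derivative
      (LINT x|lborel. w' (x + 0 *\<^sub>R v))) (at 0)"
  proof (rule leibniz_compact_support[where a="-1" and b=1 and r="r + norm v"])
    fix s and x :: 'a
    have "((\<lambda>t. w ((x + s *\<^sub>R v) + (t - s) *\<^sub>R v)) has_real_derivative w' (x + s *\<^sub>R v)) (at s)"
      using DERIV_shift[of "\<lambda>t. w ((x + s *\<^sub>R v) + t *\<^sub>R v)" _ s "-s"] d[of "x + s *\<^sub>R v"]
      by simp
    then show "((\<lambda>s. w (x + s *\<^sub>R v)) has_real_derivative w' (x + s *\<^sub>R v)) (at s)"
      by (simp add: algebra_simps)
  next
    fix s and x :: 'a assume s: "s \<in> {-1<..<1::real}" and x: "norm x > r + norm v"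
    have "norm x \<le> norm (x + s *\<^sub>R v) + norm (s *\<^sub>R v)"
      using norm_triangle_ineq4[of "x + s *\<^sub>R v" "s *\<^sub>R v"] by simp
    moreover have "norm (s *\<^sub>R v) \<le> 1 * norm v"
      unfolding norm_scaleR using s by (intro mult_right_mono) auto
    ultimately show "w (x + s *\<^sub>R v) = 0" using x by (intro r) auto
  qed (use w' c in \<open>auto intro!: continuous_intros continuous_on_compose2[of UNIV w] continuous_on_compose2[of UNIV w']
        simp: case_prod_unfold\<close>)
  moreover have "(\<lambda>s. LINT x|lborel. w (x + s *\<^sub>R v)) = (\<lambda>s. LINT x|lborel. w x)"
    using lborel_integral_translate[OF c] by simp
  ultimately have "((\<lambda>s::real. LINT x|lborel. w x) has_real_derivative (LINT x|lborel. w' (x + 0 *\<^sub>R v))) (at 0)"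
    by simp
  then show ?thesis using DERIV_unique[OF _ DERIV_const] by fastforce
qed

section \<open>Coordinate frame and anisotropic dilations\<close>

definition frame :: "'m + 'k \<Rightarrow> (real^'m) \<times> (real^'k)" where
  "frame i = (case i of Inl a \<Rightarrow> (axis a 1, 0) | Inr b \<Rightarrow> (0, axis b 1))"

definition dil_exponent :: "real \<Rightarrow> 'm + 'k \<Rightarrow> real" where
  "dil_exponent \<alpha> i = (case i of Inl a \<Rightarrow> 1 | Inr b \<Rightarrow> \<alpha> + 1)"

lemma frame_simps [simp]: "frame (Inl a) = (axis a 1, 0)" "frame (Inr b) = (0, axis b 1)"
  and dil_exponent_simps [simp]: "dil_exponent \<alpha> (Inl a) = 1" "dil_exponent \<alpha> (Inr b) = \<alpha> + 1"
  by (auto simp: frame_def dil_exponent_def)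

lemma bij_frame: "bij_betw (frame :: 'm + 'k \<Rightarrow> (real^'m) \<times> (real^'k)) UNIV Basis"
proof -
  have "inj (frame :: 'm + 'k \<Rightarrow> (real^'m) \<times> (real^'k))"
  proof (rule injI)
    fix i j :: "'m + 'k" assume "frame i = frame j"
    then show "i = j" by (cases i; cases j) (auto simp: axis_eq_axis axis_eq_0_iff)
  qed
  moreover have "range (frame :: 'm + 'k \<Rightarrow> (real^'m) \<times> (real^'k)) = (Basis :: ((real^'m) \<times> (real^'k)) set)"
  proof (rule set_eqI)
    fix x :: "(real^'m) \<times> (real^'k)"
    have "x \<in> range (frame :: 'm + 'k \<Rightarrow> _) \<longleftrightarrow> (\<exists>a::'m. x = frame (Inl a)) \<or> (\<exists>b::'k. x = frame (Inr b))"
      by (metis rangeE rangeI sum.exhaust)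
    also have "\<dots> \<longleftrightarrow> x \<in> Basis"
      by (auto simp: Basis_prod_def Basis_vec_def)
    finally show "x \<in> range (frame :: 'm + 'k \<Rightarrow> _) \<longleftrightarrow> x \<in> Basis" .
  qed
  ultimately show ?thesis by (simp add: bij_betw_def)
qed

lemma frame_Basis [simp]: "frame i \<in> Basis"
  using bij_frame by (auto simp: bij_betw_def)

lemma sum_Basis_frame: "(\<Sum>b\<in>(Basis :: ((real^'m) \<times> (real^'k)) set). h b) = (\<Sum>i\<in>UNIV. h (frame (i :: 'm + 'k)))"
  by (rule sum.reindex_bij_betw[OF bij_frame, symmetric])

lemma prod_Basis_frame: "(\<Prod>b\<in>(Basis :: ((real^'m) \<times> (real^'k)) set). h b) = (\<Prod>i\<in>UNIV. h (frame (i :: 'm + 'k)))"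
  by (rule prod.reindex_bij_betw[OF bij_frame, symmetric])

lemma inner_frame: "x \<bullet> y = (\<Sum>i\<in>UNIV. (x \<bullet> frame i) * (y \<bullet> frame i))"
  by (subst euclidean_inner) (rule sum_Basis_frame)

lemma frame_representation: "x = (\<Sum>i\<in>UNIV. (x \<bullet> frame i) *\<^sub>R frame i)"
  by (subst euclidean_representation[symmetric]) (rule sum_Basis_frame)

text \<open>The parameter is the logarithm of the usual dilation factor, so that dilations act on ln
  \<rho> as translations (\<open>log_gauge_dilation\<close>).\<close>

definition dilation :: "real \<Rightarrow> real \<Rightarrow> (real^'m) \<times> (real^'k) \<Rightarrow> (real^'m) \<times> (real^'k)" where
  "dilation \<alpha> s x = (exp s *\<^sub>R fst x, exp ((\<alpha> + 1) * s) *\<^sub>R snd x)"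

definition euler_field :: "real \<Rightarrow> (real^'m) \<times> (real^'k) \<Rightarrow> (real^'m) \<times> (real^'k)" where
  "euler_field \<alpha> x = (fst x, (\<alpha> + 1) *\<^sub>R snd x)"

lemma dilation_inner_frame: "dilation \<alpha> s x \<bullet> frame i = exp (dil_exponent \<alpha> i * s) * (x \<bullet> frame i)"
  by (cases i) (auto simp: dilation_def inner_prod_def)

lemma dilation_dilation: "dilation \<alpha> s (dilation \<alpha> t x) = dilation \<alpha> (s + t) x"
  by (simp add: dilation_def exp_add distrib_left)

lemma dilation_0 [simp]: "dilation \<alpha> 0 x = x"
  by (simp add: dilation_def)

lemma sum_dil_exponent: "(\<Sum>i\<in>(UNIV :: ('m::finite + 'k::finite) set). dil_exponent \<alpha> i) = real CARD('m) + (\<alpha> +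
    1) * real CARD('k)"
  by (simp add: UNIV_sum sum.Plus[unfolded Plus_def] mult.commute)

lemma lborel_integral_dilation:
  fixes w :: "(real^'m) \<times> (real^'k) \<Rightarrow> real"
  assumes w: "w \<in> borel_measurable borel"
    and Q: "Q = real CARD('m) + (\<alpha> + 1) * real CARD('k)"
  shows "(LINT x|lborel. w (dilation \<alpha> s x)) = exp (- Q * s) * (LINT x|lborel. w x)"
proof -
  define c :: "(real^'m) \<times> (real^'k) \<Rightarrow> real"
    where "c j = exp (dil_exponent \<alpha> (inv (frame :: 'm + 'k \<Rightarrow> _) j) * s)" for j
  have "inj (frame :: 'm + 'k \<Rightarrow> (real^'m) \<times> (real^'k))"
    by (rule bij_betw_imp_inj_on[OF bij_frame])
  then have c_frame: "c (frame i) = exp (dil_exponent \<alpha> i * s)" for i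
    by (simp add: c_def)
  have "(\<Sum>j\<in>Basis. (c j * (x \<bullet> j)) *\<^sub>R j) = dilation \<alpha> s x" for x
    by (subst (2) frame_representation) (simp add: sum_Basis_frame c_frame dilation_inner_frame)
  then have T: "(\<lambda>x. 0 + (\<Sum>j\<in>Basis. (c j * (x \<bullet> j)) *\<^sub>R j)) = dilation \<alpha> s"
    by auto
  have "(\<Prod>j\<in>Basis. \<bar>c j\<bar>) = exp (Q * s)"
    by (simp add: prod_Basis_frame c_frame exp_sum[symmetric] sum_distrib_right[symmetric] sum_dil_exponent Q)
  then have "(lborel :: ((real^'m) \<times> (real^'k)) measure) = density (distr lborel borel (dilation \<alpha> s)) (\<lambda>_.
      ennreal (exp (Q * s)))"
    using lborel_affine_euclidean[of c 0, unfolded T] by (simp add: c_def)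
  then have "(LINT x|lborel. w x) = (LINT x|density (distr lborel borel (dilation \<alpha> s)) (\<lambda>_. ennreal (exp (Q *
      s))). w x)"
    by simp
  also have "\<dots> = exp (Q * s) * (LINT x|lborel. w (dilation \<alpha> s x))"
  proof -
    have "dilation \<alpha> s \<in> borel_measurable borel"
      unfolding dilation_def[abs_def] by (intro borel_measurable_continuous_onI continuous_intros)
    then have "(dilation \<alpha> s :: (real^'m) \<times> (real^'k) \<Rightarrow> _) \<in> borel_measurable lborel"
      by simp
    with w show ?thesis by (subst integral_density) (auto simp: integral_distr)
  qed
  finally show ?thesis by (simp add: exp_minus)
qed

text \<open>Differentiates at s = 0 the change of variables \<open>lborel_integral_dilation\<close>,
  whose Jacobian contributes -Q. Differentiability is required along dilation orbits alone, which
  suits homogeneous weights that are not differentiable across z = 0.\<close>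

lemma integral_derivative_dilation:
  fixes w w' :: "(real^'m) \<times> (real^'k) \<Rightarrow> real"
  assumes w: "compact_supp w" and w': "continuous_on UNIV w'" and "\<alpha> > 0"
    and Q: "Q = real CARD('m) + (\<alpha> + 1) * real CARD('k)"
    and d: "\<And>x. ((\<lambda>s. w (dilation \<alpha> s x)) has_real_derivative w' x) (at 0)"
  shows "(LINT x|lborel. w' x) = - Q * (LINT x|lborel. w x)"
proof -
  obtain r where c: "continuous_on UNIV w" and r: "\<And>x. norm x > r \<Longrightarrow> w x = 0"
    using w by (auto simp: compact_supp_def)
  have cd: "continuous_on S (\<lambda>x. dilation \<alpha> (f x) (g x))" if "continuous_on S f" "continuous_on S g"
    for S :: "'z::t2_space set" and f g
    unfolding dilation_def by (intro continuous_intros that)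
  have "((\<lambda>s. LINT x|lborel. w (dilation \<alpha> s x)) has_real_derivative
      (LINT x|lborel. w' (dilation \<alpha> 0 x))) (at 0)"
  proof (rule leibniz_compact_support[where a="-1" and b=1 and r="exp (\<alpha> + 1) * r"])
    fix s and x :: "(real^'m) \<times> (real^'k)"
    have "((\<lambda>t. w (dilation \<alpha> (t - s) (dilation \<alpha> s x))) has_real_derivative w' (dilation \<alpha> s x)) (at s)"
      using DERIV_shift[of "\<lambda>t. w (dilation \<alpha> t (dilation \<alpha> s x))" _ s "-s"] d[of "dilation \<alpha> s x"]
      by simp
    then show "((\<lambda>s. w (dilation \<alpha> s x)) has_real_derivative w' (dilation \<alpha> s x)) (at s)"
      by (simp add: dilation_dilation)
  next
    fix s and x :: "(real^'m) \<times> (real^'k)" assume s: "s \<in> {-1<..<1::real}" and x: "norm x > exp (\<alpha> + 1) * r"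
    \<comment> \<open>For |s| < 1 no coordinate shrinks by more than the factor
      \<open>exp (- (\<alpha> + 1))\<close>, which yields one support radius for all dilated copies
      of \<open>w\<close>.\<close>
    have le: "exp (- (\<alpha> + 1)) * norm x \<le> norm (dilation \<alpha> s x)"
    proof -
      have "(norm (exp (- (\<alpha> + 1)) *\<^sub>R x))\<^sup>2 \<le> (norm (dilation \<alpha> s x))\<^sup>2"
        unfolding power2_norm_eq_inner inner_frame[of "exp (- (\<alpha> + 1)) *\<^sub>R x" "exp (- (\<alpha> + 1)) *\<^sub>R x"]
          inner_frame[of "dilation \<alpha> s x" "dilation \<alpha> s x"]
      proof (rule sum_mono)
        fix i :: "'m + 'k"
        have "(\<alpha> + 1) * (-1) \<le> (\<alpha> + 1) * s"
          by (rule mult_left_mono) (use s \<open>\<alpha> > 0\<close> in auto)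
        then have "dil_exponent \<alpha> i * s \<ge> - (\<alpha> + 1)"
          using s \<open>\<alpha> > 0\<close> by (cases i) auto
        then have "(exp (- (\<alpha> + 1)))\<^sup>2 \<le> (exp (dil_exponent \<alpha> i * s))\<^sup>2"
          by (intro power_mono) auto
        then have "(exp (- (\<alpha> + 1)))\<^sup>2 * (x \<bullet> frame i)\<^sup>2 \<le> (exp (dil_exponent \<alpha> i * s))\<^sup>2 * (x \<bullet> frame i)\<^sup>2"
          by (rule mult_right_mono) auto
        then show "exp (- (\<alpha> + 1)) *\<^sub>R x \<bullet> frame i * (exp (- (\<alpha> + 1)) *\<^sub>R x \<bullet> frame i) \<le>
            dilation \<alpha> s x \<bullet> frame i * (dilation \<alpha> s x \<bullet> frame i)"
          by (simp add: dilation_inner_frame power2_eq_square ac_simps)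
      qed
      then show ?thesis using power2_le_imp_le by fastforce
    qed
    have "r < norm x / exp (\<alpha> + 1)"
      using x by (simp add: field_simps)
    also have "\<dots> = exp (- (\<alpha> + 1)) * norm x"
      by (simp only: exp_minus divide_inverse) (simp add: mult.commute)
    finally show "w (dilation \<alpha> s x) = 0" using le by (intro r) simp
  qed (use w' c in \<open>auto intro!: continuous_intros cd continuous_on_compose2[of UNIV w]
      continuous_on_compose2[of UNIV w']
        simp: case_prod_unfold\<close>)
  moreover have "(\<lambda>s. LINT x|lborel. w (dilation \<alpha> s x)) = (\<lambda>s. exp (- Q * s) * (LINT x|lborel. w x))"
    using lborel_integral_dilation[OF borel_measurable_continuous_onI[OF c] Q] by auto
  moreover have "((\<lambda>s. exp (- Q * s) * (LINT x|lborel. w x)) has_real_derivative - Q * (LINT x|lborel. w x)) (at 0)"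
    by (auto intro!: derivative_eq_intros)
  ultimately show ?thesis using DERIV_unique by fastforce
qed

text \<open>Symmetry of second derivatives, needed later for the Hessian. Differentiating under the
  integral shows that the increment of \<open>dir_deriv b \<phi>\<close> along a is the integral of
  \<open>dir_deriv b (dir_deriv a \<phi>)\<close>. The derivatives of both sides at s = 0 are then
  compared.\<close>

lemma dir_deriv_commute:
  fixes \<phi> :: "'a::euclidean_space \<Rightarrow> real"
  assumes "\<And>n. C_diff n \<phi>"
  shows "dir_deriv a (dir_deriv b \<phi>) x = dir_deriv b (dir_deriv a \<phi>) x"
proof -
  have C: "C_diff n (dir_deriv v \<phi>)" "C_diff n (dir_deriv u (dir_deriv v \<phi>))" for n u v
    using assms by (simp_all add: C_diff_dir_deriv)
  have D: "((\<lambda>t. \<phi> (y + t *\<^sub>R v)) has_real_derivative dir_deriv v \<phi> (y + s *\<^sub>R v)) (at s)"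
    and D': "((\<lambda>t. dir_deriv u \<phi> (y + t *\<^sub>R v)) has_real_derivative
        dir_deriv v (dir_deriv u \<phi>) (y + s *\<^sub>R v)) (at s)" for y s u v
  proof -
    have d: "\<phi> differentiable (at y)" "dir_deriv u \<phi> differentiable (at y)" for y u
      using assms[of 1] C(1)[of 1] by auto
    show "((\<lambda>t. \<phi> (y + t *\<^sub>R v)) has_real_derivative dir_deriv v \<phi> (y + s *\<^sub>R v)) (at s)" for y s v
      by (rule has_real_derivative_line[OF has_derivative_dir_deriv[OF d(1)]])
    show "((\<lambda>t. dir_deriv u \<phi> (y + t *\<^sub>R v)) has_real_derivative
        dir_deriv v (dir_deriv u \<phi>) (y + s *\<^sub>R v)) (at s)" for y s u v
      by (rule has_real_derivative_line[OF has_derivative_dir_deriv[OF d(2)]])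
  qed
  note cont = C_diff_continuous[OF C(1)] C_diff_continuous[OF C(2)] C_diff_continuous[OF assms]
  let ?I = "\<lambda>t s. integral (cbox 0 s) (\<lambda>r. dir_deriv a \<phi> (x + r *\<^sub>R a + t *\<^sub>R b))"
  have I: "?I t s = \<phi> (x + t *\<^sub>R b + s *\<^sub>R a) - \<phi> (x + t *\<^sub>R b)" if "s \<ge> 0" for t s :: real
  proof -
    have "((\<lambda>r. dir_deriv a \<phi> ((x + t *\<^sub>R b) + r *\<^sub>R a)) has_integral
        \<phi> ((x + t *\<^sub>R b) + s *\<^sub>R a) - \<phi> ((x + t *\<^sub>R b) + 0 *\<^sub>R a)) {0..s}"
      using that D by (intro fundamental_theorem_of_calculus)
        (auto simp: has_real_derivative_iff_has_vector_derivative intro: has_vector_derivative_at_within)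
    then show ?thesis by (simp add: integral_unique algebra_simps)
  qed
  have eq: "dir_deriv b \<phi> (x + s *\<^sub>R a) - dir_deriv b \<phi> x =
      integral {0..s} (\<lambda>r. dir_deriv b (dir_deriv a \<phi>) (x + r *\<^sub>R a))" if "s \<ge> 0" for s :: real
  proof -
    have "((\<lambda>t. ?I t s) has_real_derivative
        integral (cbox 0 s) (\<lambda>r. dir_deriv b (dir_deriv a \<phi>) (x + r *\<^sub>R a + 0 *\<^sub>R b))) (at 0 within UNIV)"
      by (rule leibniz_rule_field_derivative)
         (auto intro!: D' integrable_continuous_interval continuous_on_compose2[OF cont(1)]
            continuous_on_compose2[OF cont(2)] continuous_intros simp: case_prod_unfold)
    moreover have "((\<lambda>t. ?I t s) has_real_derivative dir_deriv b \<phi> ((x + s *\<^sub>R a) + 0 *\<^sub>R b) -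
        dir_deriv b \<phi> (x + 0 *\<^sub>R b)) (at 0)"
    proof -
      have "?I t s = \<phi> ((x + s *\<^sub>R a) + t *\<^sub>R b) - \<phi> (x + t *\<^sub>R b)" for t
        unfolding I[OF that] by (simp only: add.assoc add.commute[of "t *\<^sub>R b"])
      then show ?thesis
        by (simp only: DERIV_diff[OF D[of "x + s *\<^sub>R a" b 0] D[of x b 0]])
    qed
    ultimately show ?thesis using DERIV_unique[of "\<lambda>t. ?I t s"] by simp
  qed
  let ?J = "\<lambda>s. integral {0..s} (\<lambda>r. dir_deriv b (dir_deriv a \<phi>) (x + r *\<^sub>R a))"
  \<comment> \<open>The integral formula \<open>eq\<close> is available for s \<ge> 0 only, so the
    comparison is made with derivatives within {0..1}.\<close>
  have "(?J has_vector_derivative dir_deriv b (dir_deriv a \<phi>) (x + 0 *\<^sub>R a)) (at 0 within {0..1})"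
    by (rule integral_has_vector_derivative) (auto intro!: continuous_on_compose2[OF cont(2)] continuous_intros)
  moreover have "((\<lambda>s. dir_deriv b \<phi> (x + s *\<^sub>R a) - dir_deriv b \<phi> x) has_vector_derivative
      dir_deriv a (dir_deriv b \<phi>) (x + 0 *\<^sub>R a)) (at 0 within {0..1})"
    using DERIV_diff[OF D'[of b x a 0] DERIV_const]
    by (auto simp: has_real_derivative_iff_has_vector_derivative intro: has_vector_derivative_at_within)
  then have "(?J has_vector_derivative dir_deriv a (dir_deriv b \<phi>) (x + 0 *\<^sub>R a)) (at 0 within {0..1})"
    by (rule has_vector_derivative_transform[rotated 2]) (auto simp: eq)
  ultimately have "dir_deriv b (dir_deriv a \<phi>) (x + 0 *\<^sub>R a) = dir_deriv a (dir_deriv b \<phi>) (x + 0 *\<^sub>R a)"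
    by (intro vector_derivative_unique_within_closed_interval[of 0 1 0 ?J]) auto
  then show ?thesis by simp
qed

section \<open>The gauge and radial weights\<close>

text \<open>The power \<rho>^(2 (\<alpha> + 1)), which for \<alpha> > 0 is differentiable
  everywhere, including the origin and the set z = 0.\<close>

definition gauge_pow :: "real \<Rightarrow> (real^'m) \<times> (real^'k) \<Rightarrow> real" where
  "gauge_pow \<alpha> x = norm (fst x) powr (2 * (\<alpha> + 1)) + 4 * (\<alpha> + 1)\<^sup>2 * (norm (snd x))\<^sup>2"

definition log_gauge :: "real \<Rightarrow> (real^'m) \<times> (real^'k) \<Rightarrow> real" where
  "log_gauge \<alpha> x = ln (gauge_pow \<alpha> x) / (2 * (\<alpha> + 1))"

text \<open>Off the origin this is |X ln \<rho>|^2, and it vanishes there exactly where z =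
  0.\<close>

definition gauge_weight :: "real \<Rightarrow> (real^'m) \<times> (real^'k) \<Rightarrow> real" where
  "gauge_weight \<alpha> x = norm (fst x) powr (2 * \<alpha>) / gauge_pow \<alpha> x"

definition X_coeff_sq :: "real \<Rightarrow> 'm + 'k \<Rightarrow> (real^'m) \<times> (real^'k) \<Rightarrow> real" where
  "X_coeff_sq \<alpha> i x = (case i of Inl a \<Rightarrow> 1 | Inr b \<Rightarrow> norm (fst x) powr (2 * \<alpha>) / 4)"

text \<open>|X u|^2 at x, as a quadratic form in the full Euclidean gradient \<open>p\<close> of
  u.\<close>

definition X_energy :: "real \<Rightarrow> (real^'m) \<times> (real^'k) \<Rightarrow> (real^'m) \<times> (real^'k) \<Rightarrow> real" where
  "X_energy \<alpha> x p = (\<Sum>i\<in>UNIV. X_coeff_sq \<alpha> i x * (p \<bullet> frame i)\<^sup>2)"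

definition grad_log_gauge :: "real \<Rightarrow> (real^'m) \<times> (real^'k) \<Rightarrow> (real^'m) \<times> (real^'k)" where
  "grad_log_gauge \<alpha> x = ((norm (fst x) powr (2 * \<alpha>) / gauge_pow \<alpha> x) *\<^sub>R fst x, (4 * (\<alpha> + 1) / gauge_pow \<alpha> x)
      *\<^sub>R snd x)"

text \<open>
  The case distinction is needed because \<open>log_gauge \<alpha> 0\<close> is the junk value \<open>ln 0 / (2 * (\<alpha> + 1)) = 0\<close>.
\<close>

definition radial :: "real \<Rightarrow> (real \<Rightarrow> real) \<Rightarrow> (real^'m) \<times> (real^'k) \<Rightarrow> real" where
  "radial \<alpha> c x = (if x = 0 then 0 else c (log_gauge \<alpha> x))"

definition radial_integral :: "real \<Rightarrow> (real \<Rightarrow> real) \<Rightarrow> ((real^'m) \<times> (real^'k) \<Rightarrow> real) \<Rightarrow> real" where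
  "radial_integral \<alpha> c q = (LINT x|lborel. radial \<alpha> c x * q x)"

lemma X_coeff_sq_simps [simp]: "X_coeff_sq \<alpha> (Inl a) x = 1" "X_coeff_sq \<alpha> (Inr b) x = norm (fst x) powr (2 * \<alpha>) / 4"
  by (auto simp: X_coeff_sq_def)

lemma pseudo_gauge_gauge_pow: "pseudo_gauge \<alpha> x = gauge_pow \<alpha> x powr (1 / (2 * (\<alpha> + 1)))"
  by (simp add: pseudo_gauge_def gauge_pow_def)

lemma gauge_pow_nonneg: "gauge_pow \<alpha> x \<ge> 0"
  by (simp add: gauge_pow_def)

lemma gauge_pow_pos:
  assumes "\<alpha> > 0" "x \<noteq> 0" shows "gauge_pow \<alpha> x > 0"
proof (cases "fst x = 0")
  case True
  with assms(2) have "snd x \<noteq> 0" by (metis prod.collapse zero_prod_def)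
  then have "4 * (\<alpha> + 1)\<^sup>2 * (norm (snd x))\<^sup>2 > 0" using assms(1) by simp
  then show ?thesis by (simp add: gauge_pow_def True)
next
  case False
  then have "norm (fst x) powr (2 * (\<alpha> + 1)) > 0" by simp
  then show ?thesis unfolding gauge_pow_def by (intro add_pos_nonneg) auto
qed

lemma gauge_pow_neq_0: "\<alpha> > 0 \<Longrightarrow> x \<noteq> 0 \<Longrightarrow> gauge_pow \<alpha> x \<noteq> 0"
  using gauge_pow_pos[of \<alpha> x] by simp

lemma gauge_pow_0 [simp]: "gauge_pow \<alpha> 0 = 0"
  by (simp add: gauge_pow_def)

lemma pseudo_gauge_log_gauge: "\<alpha> > 0 \<Longrightarrow> x \<noteq> 0 \<Longrightarrow> pseudo_gauge \<alpha> x = exp (log_gauge \<alpha> x)"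
  using gauge_pow_pos[of \<alpha> x] by (simp add: pseudo_gauge_gauge_pow log_gauge_def powr_def)

lemma continuous_on_norm_fst_powr:
  "\<beta> > 0 \<Longrightarrow> continuous_on S (\<lambda>x. norm (fst x) powr \<beta>)"
  by (intro continuous_on_powr' continuous_intros) auto

lemma continuous_gauge_pow: "\<alpha> > 0 \<Longrightarrow> continuous_on S (gauge_pow \<alpha>)"
  unfolding gauge_pow_def by (intro continuous_intros continuous_on_norm_fst_powr) auto

lemma continuous_log_gauge: "\<alpha> > 0 \<Longrightarrow> continuous_on (- {0}) (log_gauge \<alpha>)"
  unfolding log_gauge_def by (intro continuous_intros continuous_gauge_pow) (auto simp: gauge_pow_neq_0)

lemma continuous_gauge_weight: "\<alpha> > 0 \<Longrightarrow> continuous_on (- {0}) (gauge_weight \<alpha>)"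
  unfolding gauge_weight_def 
  by (intro continuous_intros continuous_gauge_pow continuous_on_norm_fst_powr) (auto simp: gauge_pow_neq_0)

lemma continuous_grad_log_gauge: "\<alpha> > 0 \<Longrightarrow> continuous_on (- {0}) (grad_log_gauge \<alpha>)"
  unfolding grad_log_gauge_def 
  by (intro continuous_intros continuous_gauge_pow continuous_on_norm_fst_powr) (auto simp: gauge_pow_neq_0)

lemma continuous_X_coeff_sq: "\<alpha> > 0 \<Longrightarrow> continuous_on S (X_coeff_sq \<alpha> i)"
  by (cases i) (auto simp: X_coeff_sq_def intro!: continuous_intros continuous_on_norm_fst_powr)

lemma continuous_euler_field: "continuous_on S (euler_field \<alpha>)"
  unfolding euler_field_def by (intro continuous_intros)

lemma gauge_pow_dilation: "gauge_pow \<alpha> (dilation \<alpha> s x) = exp (2 * (\<alpha> + 1) * s) * gauge_pow \<alpha> x"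
proof -
  have "norm (fst (dilation \<alpha> s x)) powr (2 * (\<alpha> + 1)) = exp (2 * (\<alpha> + 1) * s) * norm (fst x) powr (2 * (\<alpha> + 1))"
    by (simp add: dilation_def powr_mult exp_powr_real mult.commute)
  moreover have "(exp ((\<alpha> + 1) * s))\<^sup>2 = exp (2 * (\<alpha> + 1) * s)"
    by (simp add: power2_eq_square exp_add[symmetric] algebra_simps)
  ultimately show ?thesis
    by (simp add: gauge_pow_def dilation_def power_mult_distrib distrib_left)
qed

lemma log_gauge_dilation:
  assumes "\<alpha> > 0" "x \<noteq> 0" shows "log_gauge \<alpha> (dilation \<alpha> s x) = log_gauge \<alpha> x + s"
  using gauge_pow_pos[OF assms] assms(1) by (simp add: log_gauge_def gauge_pow_dilation ln_mult field_simps)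

lemma gauge_weight_dilation: "gauge_weight \<alpha> (dilation \<alpha> s x) = exp (- 2 * s) * gauge_weight \<alpha> x"
proof -
  have "exp (2 * \<alpha> * s) / exp (2 * (\<alpha> + 1) * s) = exp (- 2 * s)"
    by (simp add: exp_diff[symmetric] algebra_simps)
  moreover have "norm (fst (dilation \<alpha> s x)) powr (2 * \<alpha>) = exp (2 * \<alpha> * s) * norm (fst x) powr (2 * \<alpha>)"
    by (simp add: dilation_def powr_mult exp_powr_real mult.commute)
  ultimately show ?thesis
    by (simp only: gauge_weight_def gauge_pow_dilation times_divide_times_eq[symmetric])
qed

lemma X_coeff_sq_dilation: "X_coeff_sq \<alpha> i (dilation \<alpha> s x) = exp (2 * (dil_exponent \<alpha> i - 1) * s) * X_coeff_sq \<alpha> i x"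
  by (cases i) (simp_all add: dilation_def powr_mult exp_powr_real mult.commute)

lemma X_coeff_sq_line: "X_coeff_sq \<alpha> i (x + t *\<^sub>R frame i) = X_coeff_sq \<alpha> i x"
  by (cases i) simp_all

text \<open>The reason for this gauge: the coefficient matrix of the operator maps the gradient of
  ln \<rho> to \<omega> Z. When an integration by parts differentiates a radial weight, the
  derivatives of u enter the new term only through Z u.\<close>

lemma X_coeff_sq_grad_log_gauge: "X_coeff_sq \<alpha> i x * (grad_log_gauge \<alpha> x \<bullet> frame i) =
    gauge_weight \<alpha> x * (euler_field \<alpha> x \<bullet> frame i)"
  by (cases i) (simp_all add: grad_log_gauge_def gauge_weight_def euler_field_def inner_prod_def del:
      distrib_left_numeral)

lemma dilation_eq_0_iff [simp]: "dilation \<alpha> s x = 0 \<longleftrightarrow> x = 0"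
  by (auto simp: dilation_def zero_prod_def prod_eq_iff)

lemma has_derivative_norm_powr:
  fixes z :: "'a::real_inner"
  assumes "\<beta> > 0"
  shows "((\<lambda>z. norm z powr (2 * (\<beta> + 1))) has_derivative (\<lambda>v. 2 * (\<beta> + 1) * norm z powr (2 * \<beta>) * (z \<bullet> v))) (at z)"
proof (cases "z = 0")
  case True
  \<comment> \<open>The exponent \<open>2 * (\<beta> + 1)\<close> exceeds 1, so after division by
    \<open>norm v\<close> a positive power remains and tends to 0.\<close>
  have "((\<lambda>v::'a. norm v powr (2 * \<beta> + 1)) \<longlongrightarrow> 0 powr (2 * \<beta> + 1)) (at 0)"
    by (intro tendsto_powr' tendsto_norm_zero tendsto_ident_at tendsto_const) (use assms in auto)
  moreover have "norm (norm v powr (2 * (\<beta> + 1))) / norm v = norm v powr (2 * \<beta> + 1)" for v :: 'a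
  proof (cases "v = 0")
    case False
    have "norm v powr (2 * (\<beta> + 1)) = norm v powr (2 * \<beta> + 1) * norm v powr 1"
      by (simp only: powr_add[symmetric]) (simp add: algebra_simps)
    with False show ?thesis by simp
  qed simp
  ultimately show ?thesis
    using True assms by (simp add: has_derivative_at)
next
  case False
  have *: "norm y powr (2 * \<gamma>) = (y \<bullet> y) powr \<gamma>" for y :: 'a and \<gamma>
    using powr_powr[of "norm y" 2 \<gamma>] by (simp add: power2_norm_eq_inner[symmetric] powr_numeral)
  have "((\<lambda>z. (z \<bullet> z) powr (\<beta> + 1)) has_derivative (\<lambda>v. (z \<bullet> z) powr (\<beta> + 1) *
      ((z \<bullet> v + v \<bullet> z) * (\<beta> + 1) / (z \<bullet> z)))) (at z)"
    using False by (auto intro!: derivative_eq_intros simp: fun_eq_iff)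
  moreover have "(z \<bullet> z) powr (\<beta> + 1) * ((z \<bullet> v + v \<bullet> z) * (\<beta> + 1) / (z \<bullet> z)) =
      2 * (\<beta> + 1) * (z \<bullet> z) powr \<beta> * (z \<bullet> v)" for v
    using False by (simp add: powr_add inner_commute field_simps)
  ultimately show ?thesis by (simp only: *)
qed

lemma has_derivative_gauge_pow:
  assumes "\<alpha> > 0"
  shows "(gauge_pow \<alpha> has_derivative (\<lambda>v. 2 * (\<alpha> + 1) * norm (fst x) powr (2 * \<alpha>) * (fst x \<bullet> fst v) +
      8 * (\<alpha> + 1)\<^sup>2 * (snd x \<bullet> snd v))) (at x)"
proof -
  have 1: "((\<lambda>x. norm (fst x) powr (2 * (\<alpha> + 1))) has_derivative
      (\<lambda>v. 2 * (\<alpha> + 1) * norm (fst x) powr (2 * \<alpha>) * (fst x \<bullet> fst v))) (at x)"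
    by (rule has_derivative_compose[OF has_derivative_fst[OF has_derivative_ident] has_derivative_norm_powr[OF assms]])
  have 2: "((\<lambda>x. 4 * (\<alpha> + 1)\<^sup>2 * (snd x \<bullet> snd x)) has_derivative (\<lambda>v. 8 * (\<alpha> + 1)\<^sup>2 * (snd x \<bullet> snd v))) (at x)"
    by (auto intro!: derivative_eq_intros simp: fun_eq_iff inner_commute)
  show ?thesis
    unfolding gauge_pow_def[abs_def] power2_norm_eq_inner by (rule has_derivative_add[OF 1 2])
qed

lemma has_derivative_log_gauge:
  assumes "\<alpha> > 0" "x \<noteq> 0"
  shows "(log_gauge \<alpha> has_derivative (\<lambda>v. grad_log_gauge \<alpha> x \<bullet> v)) (at x)"
proof -
  have "((\<lambda>x. ln (gauge_pow \<alpha> x) / (2 * (\<alpha> + 1))) has_derivative (\<lambda>v. (2 * (\<alpha> + 1) * norm (fst x) powr (2 * \<alpha>)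
      * (fst x \<bullet> fst v) +
      8 * (\<alpha> + 1)\<^sup>2 * (snd x \<bullet> snd v)) * inverse (gauge_pow \<alpha> x) / (2 * (\<alpha> + 1)))) (at x)"
    using gauge_pow_pos[OF assms] assms(1)
    by (auto intro!: derivative_eq_intros has_derivative_gauge_pow[THEN has_derivative_eq_rhs])
  moreover have "(2 * (\<alpha> + 1) * norm (fst x) powr (2 * \<alpha>) * (fst x \<bullet> fst v) +
      8 * (\<alpha> + 1)\<^sup>2 * (snd x \<bullet> snd v)) * inverse (gauge_pow \<alpha> x) / (2 * (\<alpha> + 1)) = grad_log_gauge \<alpha> x \<bullet> v" for v
  proof -
    have "(2 * a * w * X + 8 * a\<^sup>2 * Y) * inverse P / (2 * a) = w / P * X + 4 * a / P * Y"
      if "a \<noteq> 0" "P \<noteq> 0" for a w X Y P :: real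
      using that by (simp add: field_simps power2_eq_square)
    from this[of "\<alpha> + 1" "gauge_pow \<alpha> x"] show ?thesis
      using gauge_pow_pos[OF assms] assms(1) by (simp add: grad_log_gauge_def inner_prod_def)
  qed
  ultimately show ?thesis by (simp add: log_gauge_def[abs_def])
qed

section \<open>Radial weights: supports, integrals and derivatives\<close>

lemma compact_supp_bound: "compact_supp (c :: real \<Rightarrow> real) \<Longrightarrow> \<exists>l>0. \<forall>s. \<bar>s\<bar> \<ge> l \<longrightarrow> c s = 0"
proof -
  assume "compact_supp c"
  then obtain r where "\<And>s. \<bar>s\<bar> > r \<Longrightarrow> c s = 0" by (auto simp: compact_supp_def)
  then show ?thesis by (intro exI[of _ "\<bar>r\<bar> + 1"]) auto
qed

lemma eventually_log_gauge_less:
  assumes "\<alpha> > 0"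
  shows "\<forall>\<^sub>F x in nhds (0 :: (real^'m) \<times> (real^'k)). x \<noteq> 0 \<longrightarrow> log_gauge \<alpha> x < l"
proof -
  have "continuous_on UNIV (gauge_pow \<alpha> :: (real^'m) \<times> (real^'k) \<Rightarrow> real)"
    by (rule continuous_gauge_pow[OF assms])
  then have "((gauge_pow \<alpha> :: (real^'m) \<times> (real^'k) \<Rightarrow> real) \<longlongrightarrow> gauge_pow \<alpha> (0 :: (real^'m) \<times> (real^'k))) (nhds 0)"
    unfolding continuous_on_eq_continuous_at[OF open_UNIV] isCont_def
    by (simp only: tendsto_at_iff_tendsto_nhds) (drule bspec[OF _ UNIV_I], assumption)
  then have "\<forall>\<^sub>F x in nhds (0 :: (real^'m) \<times> (real^'k)). gauge_pow \<alpha> x < exp (2 * (\<alpha> + 1) * l)"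
    by (rule order_tendstoD(2)) simp
  then show ?thesis
  proof eventually_elim
    case (elim x)
    show ?case
    proof
      assume "x \<noteq> 0"
      then have "ln (gauge_pow \<alpha> x) < 2 * (\<alpha> + 1) * l"
        using elim ln_ge_iff[OF gauge_pow_pos[OF assms], of x "2 * (\<alpha> + 1) * l"] by linarith
      then show "log_gauge \<alpha> x < l"
        using assms by (simp add: log_gauge_def divide_less_eq mult.commute)
    qed
  qed
qed

text \<open>Since ln \<rho> tends to -infinity at the origin, compact support of \<open>c\<close> on
  the line also keeps the weight away from the origin.\<close>

lemma radial_eq_0_near_0:
  assumes "\<alpha> > 0" "compact_supp c"
  shows "\<forall>\<^sub>F x in nhds 0. radial \<alpha> c x = 0"
proof -
  obtain l where l: "\<And>s. \<bar>s\<bar> \<ge> l \<Longrightarrow> c s = 0" "l > 0" using compact_supp_bound[OF assms(2)] by blast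
  show ?thesis
    using eventually_log_gauge_less[OF assms(1), of "- l"]
    by eventually_elim (auto simp: radial_def intro!: l)
qed

lemma log_gauge_ge_norm:
  fixes x :: "(real^'m) \<times> (real^'k)"
  assumes "\<alpha> > 0"
  shows "\<exists>r. \<forall>x :: (real^'m) \<times> (real^'k). norm x > r \<longrightarrow> x \<noteq> 0 \<and> log_gauge \<alpha> x > l"
proof -
  let ?e = "exp (2 * (\<alpha> + 1) * l)"
  \<comment> \<open>If |x| exceeds r, then |z| > exp l or |\<sigma>| > exp ((\<alpha> + 1) l), and
    each alone forces \<rho> > exp l.\<close>
  define r where "r = exp l + sqrt ?e"
  have r0: "r > 0" by (simp add: r_def add_pos_nonneg)
  show ?thesis
  proof (intro exI[of _ r] allI impI)
    fix x :: "(real^'m) \<times> (real^'k)" assume x: "norm x > r"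
    then have "x \<noteq> 0" using r0 by auto
    have "norm x \<le> norm (fst x) + norm (snd x)"
      by (metis norm_Pair_le prod.collapse)
    with x consider "norm (fst x) > exp l" | "norm (snd x) > sqrt ?e"
      unfolding r_def by linarith
    then have "gauge_pow \<alpha> x > ?e"
    proof cases
      case 1
      have "?e = exp l powr (2 * (\<alpha> + 1))" by (simp add: exp_powr_real mult.commute)
      also have "\<dots> < norm (fst x) powr (2 * (\<alpha> + 1))"
        using 1 assms by (intro powr_less_mono2) auto
      also have "\<dots> \<le> gauge_pow \<alpha> x" by (simp add: gauge_pow_def)
      finally show ?thesis .
    next
      case 2
      then have "(sqrt ?e)\<^sup>2 < (norm (snd x))\<^sup>2" by (rule power_strict_mono) auto
      then have "?e < (norm (snd x))\<^sup>2" by simp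
      also have "\<dots> \<le> 4 * (\<alpha> + 1)\<^sup>2 * (norm (snd x))\<^sup>2"
      proof -
        have "1 \<le> (\<alpha> + 1)\<^sup>2" using assms by (simp add: one_le_power)
        then have "1 * (norm (snd x))\<^sup>2 \<le> 4 * (\<alpha> + 1)\<^sup>2 * (norm (snd x))\<^sup>2"
          by (intro mult_right_mono) auto
        then show ?thesis by simp
      qed
      also have "\<dots> \<le> gauge_pow \<alpha> x" by (simp add: gauge_pow_def)
      finally show ?thesis .
    qed
    then have "ln (gauge_pow \<alpha> x) > 2 * (\<alpha> + 1) * l"
      using exp_less_cancel_iff[of "2 * (\<alpha> + 1) * l" "ln (gauge_pow \<alpha> x)"] exp_ln[OF gauge_pow_pos[OF assms \<open>x
          \<noteq> 0\<close>]] by simp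
    with assms \<open>x \<noteq> 0\<close> show "x \<noteq> 0 \<and> log_gauge \<alpha> x > l"
      by (simp add: log_gauge_def less_divide_eq mult.commute)
  qed
qed

text \<open>The weight removes the singularity that \<open>q\<close> may have at the origin, so
  integrands such as \<omega> u^2 become continuous and compactly supported on the whole
  space.\<close>

lemma compact_supp_radial_mult:
  fixes q :: "(real^'m) \<times> (real^'k) \<Rightarrow> real"
  assumes "\<alpha> > 0" "compact_supp c" and q: "continuous_on (- {0}) q"
  shows "compact_supp (\<lambda>x. radial \<alpha> c x * q x)"
proof -
  obtain l where l: "\<And>s. \<bar>s\<bar> \<ge> l \<Longrightarrow> c s = 0" using compact_supp_bound[OF assms(2)] by blast
  obtain r where r: "\<And>x :: (real^'m) \<times> (real^'k). norm x > r \<Longrightarrow> x \<noteq> 0 \<and> log_gauge \<alpha> x > l"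
    using log_gauge_ge_norm[OF assms(1), of l] by blast
  have c: "continuous_on UNIV c" using assms(2) by (simp add: compact_supp_def)
  have "continuous_on (- {0}) (\<lambda>x. c (log_gauge \<alpha> x) * q x)"
    by (intro continuous_intros q continuous_on_compose2[OF c continuous_log_gauge[OF assms(1)]]) auto
  then have 1: "continuous_on (- {0}) (\<lambda>x. radial \<alpha> c x * q x)"
    by (rule continuous_on_eq) (auto simp: radial_def)
  have "isCont (\<lambda>x. radial \<alpha> c x * q x) x" for x
  proof (cases "x = 0")
    case True
    have "\<forall>\<^sub>F x in nhds 0. radial \<alpha> c x * q x = 0"
      using radial_eq_0_near_0[OF assms(1,2)] by eventually_elim simp
    then have "isCont (\<lambda>x. radial \<alpha> c x * q x) 0 \<longleftrightarrow> isCont (\<lambda>x. 0::real) (0 :: (real^'m) \<times> (real^'k))"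
      by (rule isCont_cong)
    then show ?thesis using True by simp
  next
    case False
    then show ?thesis using 1 continuous_on_eq_continuous_at[of "- {0}"] by blast
  qed
  then have "continuous_on UNIV (\<lambda>x. radial \<alpha> c x * q x)"
    by (simp add: continuous_on_eq_continuous_at)
  then show ?thesis
  proof (rule compact_suppI)
    fix x :: "(real^'m) \<times> (real^'k)" assume "norm x > r"
    from r[OF this] l[of "log_gauge \<alpha> x"] show "radial \<alpha> c x * q x = 0" by (auto simp: radial_def)
  qed
qed

lemma radial_integral_integrable:
  "\<alpha> > 0 \<Longrightarrow> compact_supp c \<Longrightarrow> continuous_on (- {0}) q \<Longrightarrow> integrable lborel (\<lambda>x. radial \<alpha> c x * q x)"
  by (intro compact_supp_integrable compact_supp_radial_mult)

lemma radial_integral_add: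
  assumes "\<alpha> > 0" "compact_supp c" "continuous_on (- {0}) q" "continuous_on (- {0}) q'"
  shows "radial_integral \<alpha> c (\<lambda>x. q x + q' x) = radial_integral \<alpha> c q + radial_integral \<alpha> c q'"
  unfolding radial_integral_def distrib_left
  by (intro Bochner_Integration.integral_add radial_integral_integrable assms)

lemma radial_integral_sum:
  assumes "\<alpha> > 0" "compact_supp c" "\<And>i. i \<in> I \<Longrightarrow> continuous_on (- {0}) (q i)"
  shows "radial_integral \<alpha> c (\<lambda>x. \<Sum>i\<in>I. q i x) = (\<Sum>i\<in>I. radial_integral \<alpha> c (q i))"
  unfolding radial_integral_def sum_distrib_left
  by (intro Bochner_Integration.integral_sum radial_integral_integrable assms)

lemma radial_integral_cmult: "radial_integral \<alpha> c (\<lambda>x. k * q x) = k * radial_integral \<alpha> c q"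
proof -
  have "radial_integral \<alpha> c (\<lambda>x. k * q x) = (LINT x|lborel. k * (radial \<alpha> c x * q x))"
    by (simp add: radial_integral_def ac_simps)
  then show ?thesis by (simp add: radial_integral_def)
qed

lemma radial_integral_cong: "(\<And>x. x \<noteq> 0 \<Longrightarrow> q x = q' x) \<Longrightarrow> radial_integral \<alpha> c q = radial_integral \<alpha> c q'"
  unfolding radial_integral_def by (intro Bochner_Integration.integral_cong) (auto simp: radial_def)

lemma DERIV_compact_supp:
  assumes "compact_supp c" "continuous_on UNIV c'" and d: "\<And>s. (c has_real_derivative c' s) (at s)"
  shows "compact_supp c'"
proof -
  obtain l where l: "\<And>s. \<bar>s\<bar> \<ge> l \<Longrightarrow> c s = 0" using compact_supp_bound[OF assms(1)] by blast
  show ?thesis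
  proof (rule compact_suppI[OF assms(2)])
    fix s :: real assume "norm s > l"
    then have "s \<in> {x. \<bar>x\<bar> > l}" by simp
    moreover have "open {x::real. \<bar>x\<bar> > l}" by (intro open_Collect_less continuous_intros)
    ultimately have "\<forall>\<^sub>F x in nhds s. c x = 0"
      using eventually_nhds_in_open by (force elim: eventually_mono intro: l)
    from DERIV_cong_ev[OF refl this refl] d[of s]
    have "((\<lambda>x. 0) has_real_derivative c' s) (at s)" by simp
    then show "c' s = 0" using DERIV_unique DERIV_const by blast
  qed
qed

lemma has_derivative_radial:
  assumes "\<alpha> > 0" "compact_supp c" "compact_supp c'" and d: "\<And>s. (c has_real_derivative c' s) (at s)"
  shows "(radial \<alpha> c has_derivative (\<lambda>v. radial \<alpha> c' x * (grad_log_gauge \<alpha> x \<bullet> v))) (at x)"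
proof (cases "x = 0")
  case True
  have "((\<lambda>x. 0::real) has_derivative (\<lambda>v. 0)) (at 0)" by simp
  then have "(radial \<alpha> c has_derivative (\<lambda>v. 0)) (at 0)"
  proof (rule has_derivative_transform_eventually)
    show "\<forall>\<^sub>F x in at 0. 0 = radial \<alpha> c x"
      using radial_eq_0_near_0[OF assms(1,2)] by (auto simp: eventually_at_filter elim: eventually_mono)
  qed (auto simp: radial_def)
  then show ?thesis using True by (simp add: radial_def)
next
  case False
  have "((\<lambda>x. c (log_gauge \<alpha> x)) has_derivative (\<lambda>v. c' (log_gauge \<alpha> x) * (grad_log_gauge \<alpha> x \<bullet> v))) (at x)"
    by (rule has_derivative_compose[OF has_derivative_log_gauge[OF assms(1) False] d[unfolded
        has_field_derivative_def]])
  then have "(radial \<alpha> c has_derivative (\<lambda>v. c' (log_gauge \<alpha> x) * (grad_log_gauge \<alpha> x \<bullet> v))) (at x)"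
    by (rule has_derivative_transform_within_open[where s = "- {0}"]) (use False in \<open>auto simp: radial_def\<close>)
  with False show ?thesis by (simp add: radial_def)
qed

lemma radial_dilation_derivative:
  assumes "\<alpha> > 0" and d: "\<And>s. (c has_real_derivative c' s) (at s)"
  shows "((\<lambda>s. radial \<alpha> c (dilation \<alpha> s x)) has_real_derivative radial \<alpha> c' x) (at 0)"
proof (cases "x = 0")
  case False
  then have "(\<lambda>s. radial \<alpha> c (dilation \<alpha> s x)) = (\<lambda>s. c (s + log_gauge \<alpha> x))"
    by (simp add: radial_def log_gauge_dilation[OF assms(1)] add.commute)
  then show ?thesis using d[of "0 + log_gauge \<alpha> x"] DERIV_shift[of c "c' (log_gauge \<alpha> x)" 0 "log_gauge \<alpha> x"] False
    by (simp add: radial_def)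
qed (simp add: radial_def)

lemma dilation_has_vector_derivative:
  "((\<lambda>s. dilation \<alpha> s x) has_derivative (\<lambda>t. t *\<^sub>R euler_field \<alpha> x)) (at 0)"
  unfolding dilation_def euler_field_def
  by (auto intro!: derivative_eq_intros simp: fun_eq_iff algebra_simps)

lemma has_real_derivative_dilation:
  assumes "(g has_derivative G) (at x)"
  shows "((\<lambda>s. g (dilation \<alpha> s x) :: real) has_real_derivative G (euler_field \<alpha> x)) (at 0)"
proof -
  have "(g has_derivative G) (at (dilation \<alpha> 0 x))" using assms by simp
  from has_derivative_compose[OF dilation_has_vector_derivative this]
  have "((\<lambda>s. g (dilation \<alpha> s x)) has_derivative (\<lambda>t. G (t *\<^sub>R euler_field \<alpha> x))) (at 0)" .
  moreover have "(\<lambda>t. G (t *\<^sub>R euler_field \<alpha> x)) = (*) (G (euler_field \<alpha> x))"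
    using linear_scale[OF has_derivative_linear[OF assms]] by (simp add: fun_eq_iff mult.commute)
  ultimately show ?thesis by (simp add: has_field_derivative_def)
qed

section \<open>Dilation and energy identities\<close>

lemma radial_integral_ibp_line:
  fixes q q' :: "(real^'m) \<times> (real^'k) \<Rightarrow> real"
  assumes "\<alpha> > 0" "compact_supp c" "compact_supp c'" and c: "\<And>s. (c has_real_derivative c' s) (at s)"
    and q: "continuous_on UNIV q" "continuous_on UNIV q'"
    and d: "\<And>x. ((\<lambda>t. q (x + t *\<^sub>R frame i)) has_real_derivative q' x) (at 0)"
  shows "radial_integral \<alpha> c' (\<lambda>x. (grad_log_gauge \<alpha> x \<bullet> frame i) * q x) + radial_integral \<alpha> c q' = 0"
proof -
  have co: "continuous_on (- {0}) q" "continuous_on (- {0}) q'"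
      "continuous_on (- {0}) (\<lambda>x. (grad_log_gauge \<alpha> x \<bullet> frame i) * q x)"
    using q by (auto intro!: continuous_intros continuous_grad_log_gauge[OF assms(1)] intro: continuous_on_subset)
  note Ccs = compact_supp_radial_mult[OF assms(1,3) co(3)] compact_supp_radial_mult[OF assms(1,2) co(2)]
  have "(LINT x|lborel. radial \<alpha> c' x * ((grad_log_gauge \<alpha> x \<bullet> frame i) * q x) + radial \<alpha> c x * q' x) = 0"
  proof (rule integral_derivative_line_0)
    show "compact_supp (\<lambda>x. radial \<alpha> c x * q x)" by (rule compact_supp_radial_mult[OF assms(1,2) co(1)])
    show "continuous_on UNIV (\<lambda>x. radial \<alpha> c' x * ((grad_log_gauge \<alpha> x \<bullet> frame i) * q x) + radial \<alpha> c x * q' x)"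
      using Ccs by (auto simp: compact_supp_def intro!: continuous_intros)
    fix x :: "(real^'m) \<times> (real^'k)"
    have "((\<lambda>t. radial \<alpha> c (x + t *\<^sub>R frame i)) has_real_derivative radial \<alpha> c' x * (grad_log_gauge \<alpha> x \<bullet>
        frame i)) (at 0)"
      by (rule has_real_derivative_line) (use has_derivative_radial[OF assms(1-3) c, of x] in simp)
    from DERIV_mult[OF this d[of x]]
    show "((\<lambda>t. radial \<alpha> c (x + t *\<^sub>R frame i) * q (x + t *\<^sub>R frame i)) has_real_derivative
        radial \<alpha> c' x * ((grad_log_gauge \<alpha> x \<bullet> frame i) * q x) + radial \<alpha> c x * q' x) (at 0)"
      by (simp add: ac_simps)
  qed
  then show ?thesis
    unfolding radial_integral_def by (simp add: compact_supp_integrable Ccs)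
qed

lemma radial_integral_ibp_dilation:
  fixes q q' :: "(real^'m) \<times> (real^'k) \<Rightarrow> real"
  assumes "\<alpha> > 0" "compact_supp c" "compact_supp c'" and c: "\<And>s. (c has_real_derivative c' s) (at s)"
    and Q: "Q = real CARD('m) + (\<alpha> + 1) * real CARD('k)"
    and q: "continuous_on (- {0}) q" "continuous_on (- {0}) q'"
    and d: "\<And>x. ((\<lambda>s. q (dilation \<alpha> s x)) has_real_derivative q' x) (at 0)"
  shows "radial_integral \<alpha> c' q + radial_integral \<alpha> c q' = - Q * radial_integral \<alpha> c q"
proof -
  note Ccs = compact_supp_radial_mult[OF assms(1,3) q(1)] compact_supp_radial_mult[OF assms(1,2) q(2)]
  have "(LINT x|lborel. radial \<alpha> c' x * q x + radial \<alpha> c x * q' x) = - Q * (LINT x|lborel. radial \<alpha> c x * q x)"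
  proof (rule integral_derivative_dilation[OF _ _ assms(1) Q])
    show "compact_supp (\<lambda>x. radial \<alpha> c x * q x)" by (rule compact_supp_radial_mult[OF assms(1,2) q(1)])
    show "continuous_on UNIV (\<lambda>x. radial \<alpha> c' x * q x + radial \<alpha> c x * q' x)"
      using Ccs by (auto simp: compact_supp_def intro!: continuous_intros)
    fix x :: "(real^'m) \<times> (real^'k)"
    from DERIV_mult[OF radial_dilation_derivative[OF assms(1) c, of x] d[of x]]
    show "((\<lambda>s. radial \<alpha> c (dilation \<alpha> s x) * q (dilation \<alpha> s x)) has_real_derivative
        radial \<alpha> c' x * q x + radial \<alpha> c x * q' x) (at 0)"
      by (simp add: ac_simps)
  qed
  then show ?thesis
    unfolding radial_integral_def by (simp add: compact_supp_integrable Ccs)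
qed

text \<open>The Baouendi-Grushin operator applied to u, when \<open>D x\<close> is the Hessian of u:
  no coefficient depends on the variable that is differentiated twice.\<close>

definition grushin_trace :: "real \<Rightarrow> ((real^'m) \<times> (real^'k) \<Rightarrow> (real^'m) \<times> (real^'k) \<Rightarrow> (real^'m) \<times> (real^'k)) \<Rightarrow>
    (real^'m) \<times> (real^'k) \<Rightarrow> real" where
  "grushin_trace \<alpha> D x = (\<Sum>i\<in>UNIV. X_coeff_sq \<alpha> i x * (D x (frame i) \<bullet> frame i))"

lemma continuous_X_energy:
  assumes "\<alpha> > 0" "continuous_on S p"
  shows "continuous_on S (\<lambda>x. X_energy \<alpha> x (p x))"
  unfolding X_energy_def by (intro continuous_intros continuous_X_coeff_sq assms)

lemma sum_X_coeff_sq_grad_log_gauge: "(\<Sum>i\<in>UNIV. X_coeff_sq \<alpha> i x * ((grad_log_gauge \<alpha> x \<bullet> frame i) * (p \<bullet>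
    frame i))) = gauge_weight \<alpha> x * (euler_field \<alpha> x \<bullet> p)"
proof -
  have "(\<Sum>i\<in>UNIV. X_coeff_sq \<alpha> i x * ((grad_log_gauge \<alpha> x \<bullet> frame i) * (p \<bullet> frame i))) =
      (\<Sum>i\<in>UNIV. gauge_weight \<alpha> x * ((euler_field \<alpha> x \<bullet> frame i) * (p \<bullet> frame i)))"
    by (intro sum.cong refl) (simp only: mult.assoc[symmetric] X_coeff_sq_grad_log_gauge)
  also have "\<dots> = gauge_weight \<alpha> x * (euler_field \<alpha> x \<bullet> p)"
    by (simp add: sum_distrib_left[symmetric] inner_frame[of "euler_field \<alpha> x" p])
  finally show ?thesis .
qed

section \<open>Dilation, energy and Pohozaev identities for C^2 functions\<close>

context
  fixes \<alpha> Q :: real and c c' :: "real \<Rightarrow> real"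
    and u :: "(real^'m) \<times> (real^'k) \<Rightarrow> real"
    and p :: "(real^'m) \<times> (real^'k) \<Rightarrow> (real^'m) \<times> (real^'k)"
    and D :: "(real^'m) \<times> (real^'k) \<Rightarrow> (real^'m) \<times> (real^'k) \<Rightarrow> (real^'m) \<times> (real^'k)"
  assumes \<alpha>: "\<alpha> > 0"
    and Q: "Q = real CARD('m) + (\<alpha> + 1) * real CARD('k)"
    and c: "compact_supp c" "compact_supp c'" "\<And>s. (c has_real_derivative c' s) (at s)"
    and u: "\<And>x. (u has_derivative (\<lambda>v. p x \<bullet> v)) (at x)"
    and p: "\<And>x. (p has_derivative D x) (at x)"
    and D: "\<And>i. continuous_on UNIV (\<lambda>x. D x (frame i))"
    and sym: "\<And>x v w. D x v \<bullet> w = D x w \<bullet> v"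
begin

private lemma cont_u: "continuous_on S u"
  using u by (meson continuous_at_imp_continuous_on has_derivative_continuous)

private lemma cont_p: "continuous_on S p"
  using p by (meson continuous_at_imp_continuous_on has_derivative_continuous)

private lemma cont_D: "continuous_on S (\<lambda>x. D x (frame i))"
  using D continuous_on_subset by blast

private lemma D_euler_field: "D x (euler_field \<alpha> x) = (\<Sum>i\<in>UNIV. (euler_field \<alpha> x \<bullet> frame i) *\<^sub>R D x (frame i))"
proof -
  interpret bounded_linear "D x" using p by (rule has_derivative_bounded_linear)
  have "D x (euler_field \<alpha> x) = D x (\<Sum>i\<in>UNIV. (euler_field \<alpha> x \<bullet> frame i) *\<^sub>R frame i)"
    using frame_representation[of "euler_field \<alpha> x"] by simp
  then show ?thesis by (simp add: sum scaleR)
qed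

private lemma cont_DZ: "continuous_on S (\<lambda>x. D x (euler_field \<alpha> x))"
  unfolding D_euler_field by (intro continuous_intros cont_D continuous_euler_field)

private lemma cont_grushin_trace: "continuous_on S (grushin_trace \<alpha> D)"
  unfolding grushin_trace_def by (intro continuous_intros cont_D continuous_X_coeff_sq \<alpha>)

private lemma p_inner_derivative: "((\<lambda>y. p y \<bullet> b) has_derivative (\<lambda>v. D x v \<bullet> b)) (at x)"
  by (rule has_derivative_inner_left[OF p])

private lemma p_line: "((\<lambda>t. p (x + t *\<^sub>R v) \<bullet> b) has_real_derivative D x v \<bullet> b) (at 0)"
  by (rule has_real_derivative_line) (use p_inner_derivative in simp)

private lemma p_dilation: "((\<lambda>s. p (dilation \<alpha> s x) \<bullet> b) has_real_derivative D x (euler_field \<alpha> x) \<bullet> b) (at 0)"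
  by (rule has_real_derivative_dilation[OF p_inner_derivative])

private lemma u_line: "((\<lambda>t. u (x + t *\<^sub>R v)) has_real_derivative p x \<bullet> v) (at 0)"
  by (rule has_real_derivative_line) (use u in simp)

private lemma u_dilation: "((\<lambda>s. u (dilation \<alpha> s x)) has_real_derivative p x \<bullet> euler_field \<alpha> x) (at 0)"
  by (rule has_real_derivative_dilation[OF u])

text \<open>Integration along dilations of \<omega> u^2; the homogeneity of degree -2 of \<omega>
  turns the factor Q of the Jacobian into Q - 2.\<close>

lemma weighted_dilation_identity:
  "radial_integral \<alpha> c (\<lambda>x. gauge_weight \<alpha> x * (2 * (u x * (euler_field \<alpha> x \<bullet> p x)))) =
     - (Q - 2) * radial_integral \<alpha> c (\<lambda>x. gauge_weight \<alpha> x * (u x)\<^sup>2) - radial_integral \<alpha> c' (\<lambda>x. gauge_weight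
         \<alpha> x * (u x)\<^sup>2)"
proof -
  let ?q = "\<lambda>x. gauge_weight \<alpha> x * (u x)\<^sup>2"
  let ?q' = "\<lambda>x. (- 2) * (gauge_weight \<alpha> x * (u x)\<^sup>2) + gauge_weight \<alpha> x * (2 * (u x * (euler_field \<alpha> x \<bullet> p x)))"
  have co: "continuous_on (- {0}) (gauge_weight \<alpha>)" "continuous_on (- {0}) (\<lambda>x. euler_field \<alpha> x)"
    using continuous_gauge_weight[OF \<alpha>] continuous_euler_field by auto
  have "radial_integral \<alpha> c' ?q + radial_integral \<alpha> c ?q' = - Q * radial_integral \<alpha> c ?q"
  proof (rule radial_integral_ibp_dilation[OF \<alpha> c Q])
    fix x :: "(real^'m) \<times> (real^'k)"
    have "((\<lambda>s. exp (- 2 * s) * gauge_weight \<alpha> x * (u (dilation \<alpha> s x))\<^sup>2) has_real_derivative ?q' x) (at 0)"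
      by (auto intro!: derivative_eq_intros u_dilation simp: algebra_simps inner_commute power2_eq_square)
    then show "((\<lambda>s. ?q (dilation \<alpha> s x)) has_real_derivative ?q' x) (at 0)"
      by (simp add: gauge_weight_dilation)
  qed (intro continuous_intros co cont_u cont_p)+
  moreover have "radial_integral \<alpha> c ?q' = - 2 * radial_integral \<alpha> c ?q + radial_integral \<alpha> c (\<lambda>x.
      gauge_weight \<alpha> x * (2 * (u x * (euler_field \<alpha> x \<bullet> p x))))"
    by (subst radial_integral_add[OF \<alpha> c(1)]) (intro continuous_intros co cont_u cont_p | simp only:
        radial_integral_cmult)+
  ultimately show ?thesis by (simp add: algebra_simps)
qed

lemma dilation_identity:
  "radial_integral \<alpha> c (\<lambda>x. 2 * (u x * (euler_field \<alpha> x \<bullet> p x))) = - Q * radial_integral \<alpha> c (\<lambda>x. (u x)\<^sup>2) -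
      radial_integral \<alpha> c' (\<lambda>x. (u x)\<^sup>2)"
proof -
  have "radial_integral \<alpha> c' (\<lambda>x. (u x)\<^sup>2) + radial_integral \<alpha> c (\<lambda>x. 2 * (u x * (euler_field \<alpha> x \<bullet> p x))) = -
      Q * radial_integral \<alpha> c (\<lambda>x. (u x)\<^sup>2)"
  proof (rule radial_integral_ibp_dilation[OF \<alpha> c Q])
    fix x :: "(real^'m) \<times> (real^'k)"
    show "((\<lambda>s. (u (dilation \<alpha> s x))\<^sup>2) has_real_derivative 2 * (u x * (euler_field \<alpha> x \<bullet> p x))) (at 0)"
      by (auto intro!: derivative_eq_intros u_dilation simp: inner_commute)
  qed (intro continuous_intros continuous_euler_field cont_u cont_p)+
  then show ?thesis by simp
qed

text \<open>Multiplier u. The operator stays in the form \<open>grushin_trace\<close>, because the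
  mollified functions to which this is applied satisfy the equation only in the limit.\<close>

lemma energy_identity:
  "radial_integral \<alpha> c (\<lambda>x. u x * grushin_trace \<alpha> D x) =
     - radial_integral \<alpha> c (\<lambda>x. X_energy \<alpha> x (p x)) - radial_integral \<alpha> c' (\<lambda>x. gauge_weight \<alpha> x * (u x *
         (euler_field \<alpha> x \<bullet> p x)))"
proof -
  let ?q = "\<lambda>i x. X_coeff_sq \<alpha> i x * ((p x \<bullet> frame i) * u x)"
  let ?q' = "\<lambda>i x. X_coeff_sq \<alpha> i x * ((D x (frame i) \<bullet> frame i) * u x) + X_coeff_sq \<alpha> i x * (p x \<bullet> frame i)\<^sup>2"
  let ?g = "\<lambda>i x. (grad_log_gauge \<alpha> x \<bullet> frame i) * ?q i x"
  note co = continuous_gauge_weight[OF \<alpha>] continuous_euler_field continuous_X_coeff_sq[OF \<alpha>] cont_u cont_p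
      cont_D continuous_grad_log_gauge[OF \<alpha>]
  have "radial_integral \<alpha> c' (?g i) + radial_integral \<alpha> c (?q' i) = 0" for i
  proof (rule radial_integral_ibp_line[OF \<alpha> c])
    fix x :: "(real^'m) \<times> (real^'k)"
    have "((\<lambda>t. X_coeff_sq \<alpha> i x * ((p (x + t *\<^sub>R frame i) \<bullet> frame i) * u (x +
        t *\<^sub>R frame i))) has_real_derivative ?q' i x) (at 0)"
      by (auto intro!: derivative_eq_intros u_line p_line simp: algebra_simps power2_eq_square)
    then show "((\<lambda>t. ?q i (x + t *\<^sub>R frame i)) has_real_derivative ?q' i x) (at 0)"
      by (simp add: X_coeff_sq_line)
  qed (intro continuous_intros co)+
  then have "(\<Sum>i\<in>UNIV. radial_integral \<alpha> c' (?g i)) + (\<Sum>i\<in>UNIV. radial_integral \<alpha> c (?q' i)) = 0"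
    unfolding sum.distrib[symmetric] by simp
  moreover have "(\<Sum>i\<in>UNIV. radial_integral \<alpha> c' (?g i)) = radial_integral \<alpha> c' (\<lambda>x. \<Sum>i\<in>UNIV. ?g i x)"
    by (rule radial_integral_sum[OF \<alpha> c(2), symmetric]) (intro continuous_intros co)
  moreover have "(\<Sum>i\<in>UNIV. radial_integral \<alpha> c (?q' i)) = radial_integral \<alpha> c (\<lambda>x. \<Sum>i\<in>UNIV. ?q' i x)"
    by (rule radial_integral_sum[OF \<alpha> c(1), symmetric]) (intro continuous_intros co)
  moreover have "(\<Sum>i\<in>UNIV. ?g i x) = gauge_weight \<alpha> x * (u x * (euler_field \<alpha> x \<bullet> p x))" for x
  proof -
    have "(\<Sum>i\<in>UNIV. ?g i x) = u x * (\<Sum>i\<in>UNIV. X_coeff_sq \<alpha> i x * ((grad_log_gauge \<alpha> x \<bullet> frame i) * (p x \<bullet> frame i)))"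
      unfolding sum_distrib_left by (intro sum.cong refl) (simp add: ac_simps)
    then show ?thesis unfolding sum_X_coeff_sq_grad_log_gauge by (simp only: ac_simps)
  qed
  moreover have "(\<Sum>i\<in>UNIV. ?q' i x) = u x * grushin_trace \<alpha> D x + X_energy \<alpha> x (p x)" for x
    unfolding sum.distrib grushin_trace_def X_energy_def sum_distrib_left
    by (intro arg_cong2[where f="(+)"] sum.cong refl) (simp_all add: ac_simps)
  moreover have "radial_integral \<alpha> c (\<lambda>x. u x * grushin_trace \<alpha> D x + X_energy \<alpha> x (p x)) =
      radial_integral \<alpha> c (\<lambda>x. u x * grushin_trace \<alpha> D x) + radial_integral \<alpha> c (\<lambda>x. X_energy \<alpha> x (p x))"
    by (rule radial_integral_add[OF \<alpha> c(1)]) (intro continuous_intros cont_grushin_trace continuous_X_energy \<alpha> co)+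
  ultimately show ?thesis by simp
qed

text \<open>Multiplier Z u. Integration by parts along each frame direction leaves
  \<open>?r\<close>, whose sum equals |X u|^2 + Z(|X u|^2) / 2 because each X_i has degree 1 under
  dilations. A second integration by parts, now along dilations, removes the derivative of |X u|^2,
  so the right-hand side contains first derivatives of u only.\<close>

lemma pohozaev_identity:
  "radial_integral \<alpha> c (\<lambda>x. (euler_field \<alpha> x \<bullet> p x) * grushin_trace \<alpha> D x) =
     (Q - 2) / 2 * radial_integral \<alpha> c (\<lambda>x. X_energy \<alpha> x (p x)) + 1 / 2 * radial_integral \<alpha> c' (\<lambda>x. X_energy \<alpha> x (p x))
     - radial_integral \<alpha> c' (\<lambda>x. gauge_weight \<alpha> x * (euler_field \<alpha> x \<bullet> p x)\<^sup>2)"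
proof -
  let ?Zu = "\<lambda>x. euler_field \<alpha> x \<bullet> p x"
  let ?q = "\<lambda>i x. X_coeff_sq \<alpha> i x * ((p x \<bullet> frame i) * ?Zu x)"
  let ?r = "\<lambda>i x. X_coeff_sq \<alpha> i x * (dil_exponent \<alpha> i * (p x \<bullet> frame i)\<^sup>2 + (p x \<bullet> frame i) * (D x
      (euler_field \<alpha> x) \<bullet> frame i))"
  let ?q' = "\<lambda>i x. X_coeff_sq \<alpha> i x * ((D x (frame i) \<bullet> frame i) * ?Zu x) + ?r i x"
  let ?g = "\<lambda>i x. (grad_log_gauge \<alpha> x \<bullet> frame i) * ?q i x"
  note co = continuous_gauge_weight[OF \<alpha>] continuous_euler_field continuous_X_coeff_sq[OF \<alpha>] cont_u cont_p
      cont_D cont_DZ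
    continuous_grad_log_gauge[OF \<alpha>] cont_grushin_trace continuous_X_energy[OF \<alpha>]
  have "radial_integral \<alpha> c' (?g i) + radial_integral \<alpha> c (?q' i) = 0" for i
  proof (rule radial_integral_ibp_line[OF \<alpha> c])
    fix x :: "(real^'m) \<times> (real^'k)"
    have Zl: "euler_field \<alpha> (x + t *\<^sub>R frame i) = euler_field \<alpha> x + (t * dil_exponent \<alpha> i) *\<^sub>R frame i" for t
      by (cases i) (auto simp: euler_field_def scaleR_add_right)
    have Z1: "((\<lambda>t. euler_field \<alpha> (x + t *\<^sub>R frame i) \<bullet> p (x + t *\<^sub>R frame i)) has_real_derivative
        dil_exponent \<alpha> i * (p x \<bullet> frame i) + D x (euler_field \<alpha> x) \<bullet> frame i) (at 0)"
    proof -
      have "((\<lambda>t. p (x + t *\<^sub>R frame i) \<bullet> euler_field \<alpha> x + t * dil_exponent \<alpha> i * (p (x +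
          t *\<^sub>R frame i) \<bullet> frame i)) has_real_derivative
          D x (frame i) \<bullet> euler_field \<alpha> x + (0 * dil_exponent \<alpha> i * (D x (frame i) \<bullet> frame i) +
              dil_exponent \<alpha> i * (p x \<bullet> frame i))) (at 0)"
        by (auto intro!: derivative_eq_intros p_line)
      moreover have "euler_field \<alpha> (x + t *\<^sub>R frame i) \<bullet> p (x + t *\<^sub>R frame i) =
          p (x + t *\<^sub>R frame i) \<bullet> euler_field \<alpha> x + t * dil_exponent \<alpha> i * (p (x + t *\<^sub>R frame i) \<bullet> frame i)" for t
        unfolding Zl by (subst inner_commute) (simp add: inner_add_right)
      \<comment> \<open>Symmetry of the Hessian enters here: the second derivative along
        \<open>frame i\<close> paired with Z becomes the derivative of p along Z.\<close>
      ultimately show ?thesis using sym[of x "frame i" "euler_field \<alpha> x"] by (simp add: add.commute)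
    qed
    have "((\<lambda>t. X_coeff_sq \<alpha> i x * ((p (x + t *\<^sub>R frame i) \<bullet> frame i) * (euler_field \<alpha> (x +
        t *\<^sub>R frame i) \<bullet> p (x + t *\<^sub>R frame i))))
        has_real_derivative ?q' i x) (at 0)"
      by (rule DERIV_cong[OF DERIV_cmult[OF DERIV_mult[OF p_line Z1]]])
         (simp add: algebra_simps power2_eq_square)
    then show "((\<lambda>t. ?q i (x + t *\<^sub>R frame i)) has_real_derivative ?q' i x) (at 0)"
      by (simp add: X_coeff_sq_line)
  qed (intro continuous_intros co)+
  then have "(\<Sum>i\<in>UNIV. radial_integral \<alpha> c' (?g i)) + (\<Sum>i\<in>UNIV. radial_integral \<alpha> c (?q' i)) = 0"
    unfolding sum.distrib[symmetric] by simp
  moreover have "(\<Sum>i\<in>UNIV. radial_integral \<alpha> c' (?g i)) = radial_integral \<alpha> c' (\<lambda>x. \<Sum>i\<in>UNIV. ?g i x)"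
    by (rule radial_integral_sum[OF \<alpha> c(2), symmetric]) (intro continuous_intros co)
  moreover have "(\<Sum>i\<in>UNIV. radial_integral \<alpha> c (?q' i)) = radial_integral \<alpha> c (\<lambda>x. \<Sum>i\<in>UNIV. ?q' i x)"
    by (rule radial_integral_sum[OF \<alpha> c(1), symmetric]) (intro continuous_intros co)
  moreover have "(\<Sum>i\<in>UNIV. ?g i x) = gauge_weight \<alpha> x * (?Zu x)\<^sup>2" for x
  proof -
    have "(\<Sum>i\<in>UNIV. ?g i x) = ?Zu x * (\<Sum>i\<in>UNIV. X_coeff_sq \<alpha> i x * ((grad_log_gauge \<alpha> x \<bullet> frame i) * (p x \<bullet> frame i)))"
      unfolding sum_distrib_left by (intro sum.cong refl) (simp add: ac_simps)
    then show ?thesis unfolding sum_X_coeff_sq_grad_log_gauge power2_eq_square by (simp only: ac_simps)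
  qed
  moreover have "(\<Sum>i\<in>UNIV. ?q' i x) = ?Zu x * grushin_trace \<alpha> D x + (\<Sum>i\<in>UNIV. ?r i x)" for x
    unfolding sum.distrib grushin_trace_def sum_distrib_left
    by (intro arg_cong2[where f="(+)"] sum.cong refl) (simp_all add: ac_simps)
  moreover have "radial_integral \<alpha> c (\<lambda>x. ?Zu x * grushin_trace \<alpha> D x + (\<Sum>i\<in>UNIV. ?r i x)) =
      radial_integral \<alpha> c (\<lambda>x. ?Zu x * grushin_trace \<alpha> D x) + radial_integral \<alpha> c (\<lambda>x. \<Sum>i\<in>UNIV. ?r i x)"
    by (rule radial_integral_add[OF \<alpha> c(1)]) (intro continuous_intros co)+
  ultimately have 1: "radial_integral \<alpha> c' (\<lambda>x. gauge_weight \<alpha> x * (?Zu x)\<^sup>2) + radial_integral \<alpha> c (\<lambda>x. ?Zu x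
      * grushin_trace \<alpha> D x) +
      radial_integral \<alpha> c (\<lambda>x. \<Sum>i\<in>UNIV. ?r i x) = 0"
    by simp
  \<comment> \<open>\<open>?s\<close> is the derivative of |X u|^2 along dilations; the squared
    coefficients are homogeneous of degree \<open>2 * (dil_exponent \<alpha> i - 1)\<close>.\<close>
  let ?s = "\<lambda>x. 2 * (\<Sum>i\<in>UNIV. ?r i x) + (-2) * X_energy \<alpha> x (p x)"
  have "radial_integral \<alpha> c' (\<lambda>x. X_energy \<alpha> x (p x)) + radial_integral \<alpha> c ?s = - Q * radial_integral \<alpha> c
      (\<lambda>x. X_energy \<alpha> x (p x))"
  proof (rule radial_integral_ibp_dilation[OF \<alpha> c Q])
    fix x :: "(real^'m) \<times> (real^'k)"
    have "((\<lambda>s. \<Sum>i\<in>UNIV. exp (2 * (dil_exponent \<alpha> i - 1) * s) * X_coeff_sq \<alpha> i x * (p (dilation \<alpha> s x) \<bullet> frame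
        i)\<^sup>2) has_real_derivative
       (\<Sum>i\<in>UNIV. 2 * (dil_exponent \<alpha> i - 1) * X_coeff_sq \<alpha> i x * (p x \<bullet> frame i)\<^sup>2 +
         X_coeff_sq \<alpha> i x * (2 * (p x \<bullet> frame i) * (D x (euler_field \<alpha> x) \<bullet> frame i)))) (at 0)"
      by (auto intro!: derivative_eq_intros p_dilation sum.cong simp: algebra_simps)
    moreover have "(\<Sum>i\<in>UNIV. 2 * (dil_exponent \<alpha> i - 1) * X_coeff_sq \<alpha> i x * (p x \<bullet> frame i)\<^sup>2 +
         X_coeff_sq \<alpha> i x * (2 * (p x \<bullet> frame i) * (D x (euler_field \<alpha> x) \<bullet> frame i))) = ?s x"
      unfolding X_energy_def sum_distrib_left sum.distrib[symmetric]
      by (intro sum.cong refl) (simp add: algebra_simps)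
    ultimately show "((\<lambda>s. X_energy \<alpha> (dilation \<alpha> s x) (p (dilation \<alpha> s x))) has_real_derivative ?s x) (at 0)"
      unfolding X_energy_def X_coeff_sq_dilation by simp
  qed (intro continuous_intros co)+
  moreover have "radial_integral \<alpha> c ?s = 2 * radial_integral \<alpha> c (\<lambda>x. \<Sum>i\<in>UNIV. ?r i x) +
      (-2) * radial_integral \<alpha> c (\<lambda>x. X_energy \<alpha> x (p x))"
    by (subst radial_integral_add[OF \<alpha> c(1)]) (intro continuous_intros co | simp only: radial_integral_cmult)+
  ultimately show ?thesis using 1 by (simp add: field_simps)
qed

end

section \<open>The one-dimensional argument\<close>

lemma DERIV_nonneg_mono:
  fixes f :: "real \<Rightarrow> real"
  assumes "a \<le> b" "\<And>x. a \<le> x \<Longrightarrow> (f has_real_derivative f' x) (at x)" "\<And>x. a \<le> x \<Longrightarrow> f' x \<ge> 0"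
  shows "f a \<le> f b"
proof (rule DERIV_nonneg_imp_nondecreasing[OF assms(1)])
  fix x assume "a \<le> x"
  then show "\<exists>y. (f has_real_derivative y) (at x) \<and> 0 \<le> y"
    using assms(2,3)[of x] by (intro exI[of _ "f' x"] conjI) auto
qed

context
  fixes A B Y M G A' B' M' G' :: "real \<Rightarrow> real" and \<tau> C t0 :: real
  assumes dA: "\<And>t. t > t0 \<Longrightarrow> (A has_real_derivative A' t) (at t)"
    and dB: "\<And>t. t > t0 \<Longrightarrow> (B has_real_derivative B' t) (at t)"
    and dM: "\<And>t. t > t0 \<Longrightarrow> (M has_real_derivative M' t) (at t)"
    and dG: "\<And>t. t > t0 \<Longrightarrow> (G has_real_derivative G' t) (at t)"
    and dY: "\<And>t. t > t0 \<Longrightarrow> (Y has_real_derivative 2 * B t + 2 * \<tau> * Y t) (at t)"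
    and K2: "\<And>t. t > t0 \<Longrightarrow> G t = M t - B t + B' t"
    and K1: "\<And>t. t > t0 \<Longrightarrow> \<tau> * G t - G' t / 2 - A t + A' t - ((2 * \<tau> + 2) * M t - M' t) / 2 = 0"
    and M_nonneg: "\<And>t. t > t0 \<Longrightarrow> M t \<ge> 0"
    and Y_nonneg: "\<And>t. t > t0 \<Longrightarrow> Y t \<ge> 0"
    and AG: "\<And>t. t > t0 \<Longrightarrow> A t \<le> G t"
    and square: "\<And>s t. t > t0 \<Longrightarrow> A t + 2 * s * B t + s\<^sup>2 * Y t \<ge> 0"
    and YM: "\<And>t. t > t0 \<Longrightarrow> Y t \<le> C * exp (- 2 * t) * M t"
    and C: "C > 0"
    and \<tau>: "\<tau> \<ge> 1"
    and small: "\<And>e T. e > 0 \<Longrightarrow> \<exists>t>T. M t + \<bar>Y t\<bar> + \<bar>B t\<bar> + \<bar>B' t\<bar> \<le> e * exp (2 * t)"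
begin

private definition virial :: "real \<Rightarrow> real \<Rightarrow> real" where
  "virial m t = exp (2 * m * t) * ((2 * A t + 2 * \<tau> * B t + \<tau> * Y t + M t - G t) +
     m * (2 * B t + 2 * \<tau> * Y t) + (m + 2 * m\<^sup>2) * Y t)"

text \<open>Eliminating \<open>A'\<close> by \<open>K1\<close> and \<open>B'\<close> by
  \<open>K2\<close> completes a square: in the application the bracket is the smear of \<omega> (Z u
  + (\<tau> + m) u)^2, which is why \<open>virial m\<close> is monotone for every m \<ge> 0.\<close>

private lemma virial_derivative:
  assumes t: "t > t0"
  shows "(virial m has_real_derivative
     exp (2 * m * t) * ((2 + 4 * m) * (A t + 2 * (\<tau> + m) * B t + (\<tau> + m)\<^sup>2 * Y t) + 2 * M t)) (at t)"
proof -
  let ?Y' = "2 * B t + 2 * \<tau> * Y t"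
  let ?X = "(2 * A t + 2 * \<tau> * B t + \<tau> * Y t + M t - G t) + m * ?Y' + (m + 2 * m\<^sup>2) * Y t"
  let ?X' = "(2 * A' t + 2 * \<tau> * B' t + \<tau> * ?Y' + M' t - G' t) + m * (2 * B' t + 2 * \<tau> * ?Y') + (m + 2 * m\<^sup>2) * ?Y'"
  have "(virial m has_real_derivative exp (2 * m * t) * (2 * m) * ?X + exp (2 * m * t) * ?X') (at t)"
    unfolding virial_def
    by (rule DERIV_cong) (auto intro!: derivative_eq_intros dA[OF t] dB[OF t] dM[OF t] dG[OF t] dY[OF t] simp:
        algebra_simps)
  moreover have "2 * m * ?X + ?X' = (2 + 4 * m) * (A t + 2 * (\<tau> + m) * B t + (\<tau> + m)\<^sup>2 * Y t) + 2 * M t"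
  proof -
    have B': "B' t = G t - M t + B t" using K2[OF t] by simp
    have A': "A' t = (G' t - M' t - 2 * \<tau> * G t + 2 * A t + (2 * \<tau> + 2) * M t) / 2"
      using K1[OF t] by (simp add: field_simps)
    show ?thesis unfolding A' B' by (simp add: field_simps power2_eq_square)
  qed
  moreover have "e * a * x + e * y = e * (a * x + y)" for e a x y :: real
    by (simp add: algebra_simps)
  ultimately show ?thesis by (simp only:)
qed

private lemma virial_mono:
  assumes "t0 < s" "s \<le> t" "m \<ge> 0"
  shows "virial m s \<le> virial m t"
proof (rule DERIV_nonneg_mono[OF assms(2) virial_derivative])
  fix x assume "s \<le> x"
  with assms have x: "x > t0" by simp
  then show "x > t0" .
  show "0 \<le> exp (2 * m * x) * ((2 + 4 * m) * (A x + 2 * (\<tau> + m) * B x + (\<tau> + m)\<^sup>2 * Y x) + 2 * M x)"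
  proof -
    have "(2 + 4 * m) * (A x + 2 * (\<tau> + m) * B x + (\<tau> + m)\<^sup>2 * Y x) \<ge> 0"
      using square[OF x, of "\<tau> + m"] assms(3) by (intro mult_nonneg_nonneg) auto
    then show ?thesis using M_nonneg[OF x] by simp
  qed
qed

private lemma virial_0_nonpos:
  assumes t: "t > t0"
  shows "virial 0 t \<le> 0"
proof (rule ccontr)
  assume "\<not> virial 0 t \<le> 0"
  then have pos: "virial 0 t > 0" by simp
  have F0: "virial 0 s = 2 * A s + 2 * \<tau> * B s + \<tau> * Y s + M s - G s" for s
    by (simp add: virial_def)
  have mono: "exp (- 2 * t) * virial 0 t \<le> exp (- 2 * s) * virial 0 s" if "t \<le> s" for s
  proof (rule DERIV_nonneg_mono[OF that])
    fix x assume "t \<le> x"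
    then have x: "x > t0" using t by simp
    show "((\<lambda>x. exp (- 2 * x) * virial 0 x) has_real_derivative
        exp (- 2 * x) * (2 * (G x - A x + (\<tau>\<^sup>2 - \<tau>) * Y x))) (at x)"
    proof -
      have "((\<lambda>x. exp (- 2 * x)) has_real_derivative exp (- 2 * x) * (- 2)) (at x)"
        by (auto intro!: derivative_eq_intros)
      from DERIV_mult[OF this virial_derivative[OF x, of 0]] show ?thesis
        by (rule DERIV_cong) (simp add: F0 algebra_simps power2_eq_square)
    qed
    have "\<tau> * 1 \<le> \<tau> * \<tau>" using \<tau> by (intro mult_left_mono) auto
    then have "(\<tau>\<^sup>2 - \<tau>) * Y x \<ge> 0" using Y_nonneg[OF x] by (intro mult_nonneg_nonneg) (auto simp: power2_eq_square)
    then show "exp (- 2 * x) * (2 * (G x - A x + (\<tau>\<^sup>2 - \<tau>) * Y x)) \<ge> 0"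
      using AG[OF x] by (intro mult_nonneg_nonneg) auto
  qed
  \<comment> \<open>2 \<tau> + 2 dominates every coefficient in the estimate of
    \<open>virial 0 s\<close> below; \<open>e\<close> is set so that \<open>K * e\<close> is half of
    the supposedly positive value at t.\<close>
  define K where "K = 2 * \<tau> + 2"
  have K: "K > 0" using \<tau> by (simp add: K_def)
  define e where "e = exp (- 2 * t) * virial 0 t / (2 * K)"
  have "e > 0" using pos K by (simp add: e_def)
  then obtain s where s: "s > t" "M s + \<bar>Y s\<bar> + \<bar>B s\<bar> + \<bar>B' s\<bar> \<le> e * exp (2 * s)"
    using small by blast
  then have s0: "s > t0" using t by simp
  \<comment> \<open>Neither A nor G is known to be small. \<open>AG\<close> gives 2 A - G \<le> G,
    and \<open>K2\<close> expresses G through quantities covered by \<open>small\<close>.\<close>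
  have "virial 0 s \<le> 2 * M s + (2 * \<tau> - 1) * B s + B' s + \<tau> * Y s"
    using AG[OF s0] K2[OF s0] unfolding F0 by (simp add: algebra_simps)
  also have "\<dots> \<le> K * M s + K * \<bar>B s\<bar> + K * \<bar>B' s\<bar> + K * \<bar>Y s\<bar>"
  proof (intro add_mono)
    show "2 * M s \<le> K * M s" "B' s \<le> K * \<bar>B' s\<bar>" "\<tau> * Y s \<le> K * \<bar>Y s\<bar>"
      using \<tau> M_nonneg[OF s0] Y_nonneg[OF s0] mult_mono[of 1 K "\<bar>B' s\<bar>" "\<bar>B' s\<bar>"]
      by (auto intro!: mult_right_mono simp: K_def)
    have "(2 * \<tau> - 1) * B s \<le> (2 * \<tau> - 1) * \<bar>B s\<bar>" using \<tau> by (intro mult_left_mono) auto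
    also have "\<dots> \<le> K * \<bar>B s\<bar>" by (intro mult_right_mono) (auto simp: K_def)
    finally show "(2 * \<tau> - 1) * B s \<le> K * \<bar>B s\<bar>" .
  qed
  also have "\<dots> = K * (M s + \<bar>Y s\<bar> + \<bar>B s\<bar> + \<bar>B' s\<bar>)" by (simp add: algebra_simps)
  also have "\<dots> \<le> K * (e * exp (2 * s))" using s(2) K by (intro mult_left_mono) auto
  finally have "exp (- 2 * s) * virial 0 s \<le> exp (- 2 * s) * (K * (e * exp (2 * s)))"
    by (intro mult_left_mono) auto
  also have "\<dots> = K * e" by (simp add: exp_minus)
  also have "\<dots> < exp (- 2 * t) * virial 0 t" using pos K by (simp add: e_def)
  finally show False using mono[of s] s(1) by simp
qed

text \<open>Suppose that F_(k+1) is at least c > 0 from t on. With V = exp (2 (k + 1) s) Y, the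
  recursion \<open>FS\<close> and F_k \<le> 0 give c \<le> V' + (2 k + 1) V, while V is dominated by
  the derivative of F_k. So V grows at least linearly, hence F_k increases at a fixed rate in the
  end, against F_k \<le> 0.\<close>

private lemma virial_nonpos: "t > t0 \<Longrightarrow> virial (real n) t \<le> 0"
proof (induction n arbitrary: t)
  case 0
  then show ?case using virial_0_nonpos by simp
next
  case (Suc n)
  show ?case
  proof (rule ccontr)
    assume "\<not> virial (real (Suc n)) t \<le> 0"
    define c where "c = virial (real (Suc n)) t"
    define k where "k = real n"
    have c: "c > 0" using \<open>\<not> _\<close> by (simp add: c_def)
    have k: "k \<ge> 0" "real (Suc n) = k + 1" by (simp_all add: k_def)
    have IH: "virial k s \<le> 0" if "s > t0" for s using Suc.IH[OF that] by (simp add: k_def)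
    have FS: "virial (k + 1) s = exp (2 * s) * virial k s + exp (2 * (k + 1) * s) * (2 * B s + 2 * \<tau> * Y s +
        (4 * k + 3) * Y s)" for s
    proof -
      have "exp (2 * (k + 1) * s) = exp (2 * s) * exp (2 * k * s)"
        by (simp add: exp_add[symmetric] algebra_simps)
      moreover have "(e * f) * (X + (k + 1) * y' + ((k + 1) + 2 * (k + 1)\<^sup>2) * y) =
          e * (f * (X + k * y' + (k + 2 * k\<^sup>2) * y)) + (e * f) * (y' + (4 * k + 3) * y)" for e f X y' y
        by (simp add: algebra_simps power2_eq_square)
      ultimately show ?thesis unfolding virial_def by (simp only:)
    qed
    define V where "V s = exp (2 * (k + 1) * s) * Y s" for s
    have V0: "V s \<ge> 0" if "s > t0" for s using Y_nonneg[OF that] by (simp add: V_def)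
    define F' where "F' s = exp (2 * k * s) * ((2 + 4 * k) * (A s + 2 * (\<tau> + k) * B s + (\<tau> + k)\<^sup>2 * Y s) +
        2 * M s)" for s
    have dF: "(virial k has_real_derivative F' s) (at s)" if "s > t0" for s
      using virial_derivative[OF that] by (simp add: F'_def)
    have F'V: "V s \<le> (C / 2) * F' s" if s: "s > t0" for s
    proof -
      have "exp (2 * k * s) * (2 * M s) \<le> F' s"
        unfolding F'_def using square[OF s, of "\<tau> + k"] k by (intro mult_left_mono) auto
      then have "(C / 2) * (exp (2 * k * s) * (2 * M s)) \<le> (C / 2) * F' s"
        using C by (intro mult_left_mono) auto
      moreover have "V s \<le> exp (2 * (k + 1) * s) * (C * exp (- 2 * s) * M s)"
        unfolding V_def using YM[OF s] by (intro mult_left_mono) auto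
      moreover have "exp (2 * (k + 1) * s) * exp (- 2 * s) = exp (2 * k * s)"
        by (simp add: exp_add[symmetric] algebra_simps)
      then have "exp (2 * (k + 1) * s) * (C * exp (- 2 * s) * M s) = (C / 2) * (exp (2 * k * s) * (2 * M s))"
        by (simp add: ac_simps)
      ultimately show ?thesis by linarith
    qed
    \<comment> \<open>The integrated form of that inequality. The middle term is nonpositive by
      \<open>IH\<close>, so monotonicity of \<open>H\<close> bounds \<open>V s\<close> from below by
      \<open>c * s + H t\<close>.\<close>
    define H where "H s = V s + (2 * k + 1) * (C / 2) * virial k s - c * s" for s
    have Hm: "H t \<le> H s" if "t \<le> s" for s
    proof (rule DERIV_nonneg_mono[OF that])
      fix x assume "t \<le> x"
      then have x: "x > t0" using Suc.prems by simp
      let ?V' = "exp (2 * (k + 1) * x) * (2 * B x + 2 * \<tau> * Y x + (2 * k + 2) * Y x)"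
      show "(H has_real_derivative ?V' + (2 * k + 1) * (C / 2) * F' x - c) (at x)"
        unfolding H_def V_def
        by (rule DERIV_cong) (auto intro!: derivative_eq_intros dF[OF x] dY[OF x] simp: algebra_simps)
      have "c \<le> virial (k + 1) x"
        using virial_mono[of t x "k + 1"] Suc.prems \<open>t \<le> x\<close> k(1) unfolding c_def k(2) by simp
      also have "\<dots> \<le> exp (2 * (k + 1) * x) * (2 * B x + 2 * \<tau> * Y x + (4 * k + 3) * Y x)"
        unfolding FS using IH[OF x] by (simp add: mult_nonneg_nonpos)
      also have "\<dots> = ?V' + (2 * k + 1) * V x"
        by (simp add: V_def algebra_simps)
      also have "(2 * k + 1) * V x \<le> (2 * k + 1) * ((C / 2) * F' x)"
        using F'V[OF x] k by (intro mult_left_mono) auto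
      finally show "0 \<le> ?V' + (2 * k + 1) * (C / 2) * F' x - c" by simp
    qed
    define T where "T = max t ((1 - H t) / c)"
    have T: "t \<le> T" "T > t0" using Suc.prems by (auto simp: T_def)
    have V1: "V s \<ge> 1" if "T \<le> s" for s
    proof -
      have s: "t \<le> s" "s > t0" "(1 - H t) / c \<le> s" using that T by (auto simp: T_def)
      have "1 - H t \<le> c * s" using s(3) c by (simp add: divide_le_eq mult.commute)
      moreover have "(2 * k + 1) * (C / 2) * virial k s \<le> 0"
        using IH[OF s(2)] k C by (intro mult_nonneg_nonpos) auto
      ultimately show ?thesis using Hm[OF s(1)] by (simp add: H_def[of s])
    qed
    \<comment> \<open>From T on F_k has slope at least 2 / C, so it has climbed from its value at T
      to 1 at the latest at S.\<close>
    define S where "S = T + (C / 2) * (1 - virial k T)"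
    have "T \<le> S" using IH[OF T(2)] C by (simp add: S_def)
    then have "virial k T - (2 / C) * T \<le> virial k S - (2 / C) * S"
    proof (rule DERIV_nonneg_mono)
      fix x assume x: "T \<le> x"
      then have x0: "x > t0" using T by simp
      show "((\<lambda>x. virial k x - (2 / C) * x) has_real_derivative F' x - (2 / C)) (at x)"
        using C by (auto intro!: derivative_eq_intros dF[OF x0])
      have "1 \<le> (C / 2) * F' x" using V1[OF x] F'V[OF x0] by simp
      then show "0 \<le> F' x - 2 / C" using C by (simp add: field_simps)
    qed
    moreover have "(2 / C) * S = (2 / C) * T + (1 - virial k T)"
      using C by (auto simp: S_def field_simps)
    ultimately have "virial k S \<ge> 1" by simp
    moreover have "S > t0" using \<open>T \<le> S\<close> T by simp
    ultimately show False using IH[of S] by simp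
  qed
qed

lemma rellich_ode:
  assumes t: "t > t0"
  shows "Y t = 0"
proof (rule ccontr)
  assume "Y t \<noteq> 0"
  then have Y: "Y t > 0" using Y_nonneg[OF t] by simp
  let ?F = "2 * A t + 2 * \<tau> * B t + \<tau> * Y t + M t - G t"
  let ?Y' = "2 * B t + 2 * \<tau> * Y t"
  \<comment> \<open>For this n the term 2 n^2 Y outweighs all other terms of F_n.\<close>
  obtain n where n: "real n > (\<bar>?F\<bar> + \<bar>?Y'\<bar>) / Y t" using reals_Archimedean2 by blast
  have "(\<bar>?F\<bar> + \<bar>?Y'\<bar>) / Y t \<ge> 0" using Y by simp
  then have n1: "real n \<ge> 1" using n by (cases n) auto
  have "?F + real n * ?Y' + (real n + 2 * (real n)\<^sup>2) * Y t \<le> 0"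
    using virial_nonpos[OF t, of n] by (simp add: virial_def mult_le_0_iff)
  moreover have "- \<bar>?F\<bar> \<le> ?F" by (rule abs_ge_minus_self[THEN minus_le_iff[THEN iffD1]])
  moreover have "real n * (- \<bar>?Y'\<bar>) \<le> real n * ?Y'" by (intro mult_left_mono) auto
  moreover have "real n * Y t \<ge> 0" using Y by simp
  ultimately have "2 * (real n)\<^sup>2 * Y t \<le> \<bar>?F\<bar> + real n * \<bar>?Y'\<bar>"
    by (simp add: distrib_right)
  also have "\<dots> \<le> real n * (\<bar>?F\<bar> + \<bar>?Y'\<bar>)"
    using mult_right_mono[OF n1, of "\<bar>?F\<bar>"] by (simp add: distrib_left)
  also have "\<dots> \<le> real n * (real n * Y t)"
    using n Y by (intro mult_left_mono) (auto simp: divide_less_eq)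
  finally have "(real n)\<^sup>2 * Y t \<le> 0" by (simp add: power2_eq_square)
  then show False using Y n1 by (simp add: mult_le_0_iff)
qed

end

section \<open>Smearing over gauge spheres\<close>

text \<open>From |z| \<le> \<rho>. The bound \<omega> \<le> \<rho>^(-2) is the source of the factor
  exp (-2 t) in the comparison of Y with M.\<close>

lemma gauge_weight_le:
  assumes "\<alpha> > 0" "x \<noteq> 0"
  shows "0 \<le> gauge_weight \<alpha> x" "gauge_weight \<alpha> x \<le> exp (- 2 * log_gauge \<alpha> x)"
proof -
  have P: "gauge_pow \<alpha> x > 0" by (rule gauge_pow_pos[OF assms])
  show "0 \<le> gauge_weight \<alpha> x" using P by (simp add: gauge_weight_def)
  have "norm (fst x) powr (2 * \<alpha>) = (norm (fst x) powr (2 * (\<alpha> + 1))) powr (\<alpha> / (\<alpha> + 1))"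
  proof -
    have "2 * (\<alpha> + 1) * (\<alpha> / (\<alpha> + 1)) = 2 * \<alpha>" using assms(1) by (simp add: field_simps)
    then show ?thesis by (simp only: powr_powr)
  qed
  also have "\<dots> \<le> gauge_pow \<alpha> x powr (\<alpha> / (\<alpha> + 1))"
    using assms(1) by (intro powr_mono2) (auto simp: gauge_pow_def)
  finally have "gauge_weight \<alpha> x \<le> gauge_pow \<alpha> x powr (\<alpha> / (\<alpha> + 1)) / gauge_pow \<alpha> x"
    unfolding gauge_weight_def using P by (intro divide_right_mono) auto
  also have "\<dots> = gauge_pow \<alpha> x powr (\<alpha> / (\<alpha> + 1) - 1)"
    using P by (simp add: powr_diff)
  also have "\<alpha> / (\<alpha> + 1) - 1 = - (1 / (\<alpha> + 1))"
    using assms(1) by (simp add: field_simps)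
  also have "gauge_pow \<alpha> x powr (- (1 / (\<alpha> + 1))) = exp (- 2 * log_gauge \<alpha> x)"
    using P assms(1) by (simp add: powr_def log_gauge_def) (simp add: field_simps)
  finally show "gauge_weight \<alpha> x \<le> exp (- 2 * log_gauge \<alpha> x)" .
qed

lemma norm_vec_power2: "(norm (v :: real^'n))\<^sup>2 = (\<Sum>a\<in>UNIV. (v \<bullet> axis a 1)\<^sup>2)"
  unfolding power2_norm_eq_inner by (subst inner_vec_def) (simp add: inner_axis power2_eq_square)

lemma X_energy_eq: "X_energy \<alpha> x p = (norm (fst p))\<^sup>2 + norm (fst x) powr (2 * \<alpha>) / 4 * (norm (snd p))\<^sup>2"
proof -
  have "X_energy \<alpha> x p = (\<Sum>a\<in>UNIV. (fst p \<bullet> axis a 1)\<^sup>2) + norm (fst x) powr (2 * \<alpha>) / 4 * (\<Sum>b\<in>UNIV. (snd p \<bullet>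
      axis b 1)\<^sup>2)"
    by (simp add: X_energy_def UNIV_sum sum.Plus[unfolded Plus_def] sum_distrib_left inner_prod_def)
  then show ?thesis by (simp only: norm_vec_power2)
qed

text \<open>Cauchy-Schwarz: \<omega> Z u is the inner product of X ln \<rho> and X u, and |X ln
  \<rho>|^2 = \<omega>. After integration this is A \<le> G.\<close>

lemma gauge_weight_euler_field_le_X_energy:
  assumes "\<alpha> > 0" "x \<noteq> 0"
  shows "gauge_weight \<alpha> x * (euler_field \<alpha> x \<bullet> p)\<^sup>2 \<le> X_energy \<alpha> x p"
proof -
  let ?w = "norm (fst x) powr \<alpha>"
  have P: "gauge_pow \<alpha> x > 0" by (rule gauge_pow_pos[OF assms])
  have w2: "norm (fst x) powr (2 * \<alpha>) = ?w\<^sup>2"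
    by (simp add: power2_eq_square powr_add[symmetric])
  have w3: "norm (fst x) powr (2 * (\<alpha> + 1)) = (?w * norm (fst x))\<^sup>2"
  proof (cases "fst x = 0")
    case False
    then have "norm (fst x) powr (2 * (\<alpha> + 1)) = norm (fst x) powr (2 * \<alpha>) * norm (fst x) powr 2"
      by (simp only: powr_add[symmetric]) (simp add: distrib_left)
    with False show ?thesis by (simp add: w2 power_mult_distrib powr_numeral)
  qed simp
  have cs: "(a * c + b * d)\<^sup>2 \<le> (a\<^sup>2 + b\<^sup>2) * (c\<^sup>2 + d\<^sup>2)" for a b c d :: real
  proof -
    have "(a\<^sup>2 + b\<^sup>2) * (c\<^sup>2 + d\<^sup>2) - (a * c + b * d)\<^sup>2 = (a * d - b * c)\<^sup>2"
      by (simp add: power2_eq_square algebra_simps)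
    then show ?thesis by (metis diff_ge_0_iff_ge zero_le_power2)
  qed
  have "\<bar>euler_field \<alpha> x \<bullet> p\<bar> \<le> norm (fst x) * norm (fst p) + (\<alpha> + 1) * (norm (snd x) * norm (snd p))"
  proof -
    have "euler_field \<alpha> x \<bullet> p = fst x \<bullet> fst p + (\<alpha> + 1) * (snd x \<bullet> snd p)"
      by (simp add: euler_field_def inner_prod_def)
    also have "\<bar>\<dots>\<bar> \<le> \<bar>fst x \<bullet> fst p\<bar> + (\<alpha> + 1) * \<bar>snd x \<bullet> snd p\<bar>"
      using abs_triangle_ineq[of "fst x \<bullet> fst p" "(\<alpha> + 1) * (snd x \<bullet> snd p)"] assms(1) by (simp add: abs_mult)
    also have "\<dots> \<le> norm (fst x) * norm (fst p) + (\<alpha> + 1) * (norm (snd x) * norm (snd p))"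
      using assms(1) by (intro add_mono mult_left_mono Cauchy_Schwarz_ineq2) auto
    finally show ?thesis .
  qed
  then have "?w * \<bar>euler_field \<alpha> x \<bullet> p\<bar> \<le> ?w * (norm (fst x) * norm (fst p) + (\<alpha> + 1) * (norm (snd x) * norm (snd p)))"
    by (rule mult_left_mono) simp
  \<comment> \<open>Grouped so that the squares of the first factors add up to
    \<open>gauge_pow\<close> and those of the second factors to \<open>X_energy\<close>.\<close>
  also have "\<dots> = (?w * norm (fst x)) * norm (fst p) + (2 * (\<alpha> + 1) * norm (snd x)) * (?w / 2 * norm (snd p))"
    by (simp add: field_simps)
  finally have "(?w * \<bar>euler_field \<alpha> x \<bullet> p\<bar>)\<^sup>2 \<le>
      ((?w * norm (fst x)) * norm (fst p) + (2 * (\<alpha> + 1) * norm (snd x)) * (?w / 2 * norm (snd p)))\<^sup>2"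
    by (rule power_mono) simp
  also have "\<dots> \<le> ((?w * norm (fst x))\<^sup>2 + (2 * (\<alpha> + 1) * norm (snd x))\<^sup>2) * ((norm (fst p))\<^sup>2 +
      (?w / 2 * norm (snd p))\<^sup>2)"
    by (rule cs)
  also have "(?w * norm (fst x))\<^sup>2 + (2 * (\<alpha> + 1) * norm (snd x))\<^sup>2 = gauge_pow \<alpha> x"
    by (simp only: gauge_pow_def w3 power_mult_distrib) simp
  also have "(norm (fst p))\<^sup>2 + (?w / 2 * norm (snd p))\<^sup>2 = X_energy \<alpha> x p"
    by (simp add: X_energy_eq w2 power_mult_distrib power_divide)
  finally have "?w\<^sup>2 * (euler_field \<alpha> x \<bullet> p)\<^sup>2 \<le> gauge_pow \<alpha> x * X_energy \<alpha> x p"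
    by (simp add: power_mult_distrib)
  then show ?thesis
    unfolding gauge_weight_def w2 using P by (simp add: divide_le_eq mult.commute)
qed

lemma radial_integral_mono:
  assumes "\<alpha> > 0" "compact_supp c" "compact_supp c'" "continuous_on (- {0}) q" "continuous_on (- {0}) q'"
    and "\<And>x. x \<noteq> 0 \<Longrightarrow> c (log_gauge \<alpha> x) * q x \<le> c' (log_gauge \<alpha> x) * q' x"
  shows "radial_integral \<alpha> c q \<le> radial_integral \<alpha> c' q'"
  unfolding radial_integral_def
proof (rule integral_mono)
  show "integrable lborel (\<lambda>x. radial \<alpha> c x * q x)" "integrable lborel (\<lambda>x. radial \<alpha> c' x * q' x)"
    by (rule radial_integral_integrable; fact)+
  show "radial \<alpha> c x * q x \<le> radial \<alpha> c' x * q' x" for x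
    using assms(6)[of x] by (simp add: radial_def)
qed

lemma radial_integral_nonneg:
  assumes "\<And>x. x \<noteq> 0 \<Longrightarrow> c (log_gauge \<alpha> x) * q x \<ge> 0"
  shows "radial_integral \<alpha> c q \<ge> 0"
  unfolding radial_integral_def using assms by (intro integral_nonneg_AE AE_I2) (simp add: radial_def)

lemma radial_integral_add_weight:
  assumes "\<alpha> > 0" "compact_supp c" "compact_supp d" "continuous_on (- {0}) q"
  shows "radial_integral \<alpha> (\<lambda>s. c s + d s) q = radial_integral \<alpha> c q + radial_integral \<alpha> d q"
proof -
  have "radial \<alpha> (\<lambda>s. c s + d s) x * q x = radial \<alpha> c x * q x + radial \<alpha> d x * q x" for x
    by (simp add: radial_def distrib_right)
  then show ?thesis
    unfolding radial_integral_def by (simp add: radial_integral_integrable assms)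
qed

definition smear :: "real \<Rightarrow> (real \<Rightarrow> real) \<Rightarrow> ((real^'m) \<times> (real^'k) \<Rightarrow> real) \<Rightarrow> real \<Rightarrow> real" where
  "smear \<alpha> \<zeta> q t = radial_integral \<alpha> (\<lambda>s. \<zeta> (s - t) * exp s) q"

lemma compact_supp_shift:
  assumes "compact_supp \<zeta>" shows "compact_supp (\<lambda>s. \<zeta> (s - t) * exp s :: real)"
proof -
  obtain l where l: "\<And>s. \<bar>s\<bar> \<ge> l \<Longrightarrow> \<zeta> s = 0" using compact_supp_bound[OF assms] by blast
  have "continuous_on UNIV \<zeta>" using assms by (simp add: compact_supp_def)
  then have "continuous_on UNIV (\<lambda>s. \<zeta> (s - t) * exp s)"
    by (intro continuous_on_mult continuous_on_exp continuous_on_compose2[of UNIV \<zeta> UNIV "\<lambda>s. s - t"]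
        continuous_on_diff continuous_on_id continuous_on_const) auto
  then show ?thesis
  proof (rule compact_suppI)
    fix s :: real assume "norm s > l + \<bar>t\<bar>"
    then have "\<bar>s - t\<bar> \<ge> l" by simp
    then show "\<zeta> (s - t) * exp s = 0" using l by simp
  qed
qed

lemma DERIV_shift_weight:
  assumes "\<And>s. (\<zeta> has_real_derivative \<zeta>' s) (at s)"
  shows "((\<lambda>s. \<zeta> (s - t) * exp s) has_real_derivative \<zeta>' (s - t) * exp s + \<zeta> (s - t) * exp s) (at s)"
proof -
  have "((\<lambda>s. \<zeta> (s - t)) has_real_derivative \<zeta>' (s - t)) (at s)"
    using DERIV_shift[of \<zeta> "\<zeta>' (s - t)" s "- t"] assms[of "s - t"] by simp
  from DERIV_mult[OF this DERIV_exp] show ?thesis by (rule DERIV_cong) simp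
qed

text \<open>Only \<zeta> depends on t, so q needs no derivative; the sign comes from the argument s
  - t.\<close>

lemma smear_derivative:
  fixes q :: "(real^'m) \<times> (real^'k) \<Rightarrow> real"
  assumes "\<alpha> > 0" "compact_supp \<zeta>" "compact_supp \<zeta>'" and d: "\<And>s. (\<zeta> has_real_derivative \<zeta>' s) (at s)"
    and q: "continuous_on (- {0}) q"
  shows "(smear \<alpha> \<zeta> q has_real_derivative - smear \<alpha> \<zeta>' q t) (at t)"
proof -
  obtain l where l: "\<And>s. \<bar>s\<bar> \<ge> l \<Longrightarrow> \<zeta> s = 0" using compact_supp_bound[OF assms(2)] by blast
  obtain l' where l': "\<And>s. \<bar>s\<bar> \<ge> l' \<Longrightarrow> \<zeta>' s = 0" using compact_supp_bound[OF assms(3)] by blast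
  obtain r where r: "\<And>x :: (real^'m) \<times> (real^'k). norm x > r \<Longrightarrow> x \<noteq> 0 \<and> log_gauge \<alpha> x > l + t + 1"
    using log_gauge_ge_norm[OF assms(1), of "l + t + 1"] by blast
  let ?I = "{t - 1<..<t + 1}"
  have "((\<lambda>t. LINT x|lborel. radial \<alpha> (\<lambda>s. \<zeta> (s - t) * exp s) x * q x) has_real_derivative
      (LINT x|lborel. radial \<alpha> (\<lambda>s. - \<zeta>' (s - t) * exp s) x * q x)) (at t)"
  proof (rule leibniz_compact_support[where a="t - 1" and b="t + 1" and r=r])
    fix v and x :: "(real^'m) \<times> (real^'k)"
    have "((\<lambda>v. \<zeta> (log_gauge \<alpha> x - v)) has_real_derivative \<zeta>' (log_gauge \<alpha> x - v) * (0 - 1)) (at v)"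
      by (rule DERIV_chain'[OF _ d]) (auto intro!: derivative_eq_intros)
    then show "((\<lambda>v. radial \<alpha> (\<lambda>s. \<zeta> (s - v) * exp s) x * q x) has_real_derivative
        radial \<alpha> (\<lambda>s. - \<zeta>' (s - v) * exp s) x * q x) (at v)"
      by (cases "x = 0") (auto simp: radial_def intro!: derivative_eq_intros)
  next
    fix v show "continuous_on UNIV (\<lambda>x. radial \<alpha> (\<lambda>s. \<zeta> (s - v) * exp s) x * q x)"
      using compact_supp_radial_mult[OF assms(1) compact_supp_shift[OF assms(2)] q] by (simp add: compact_supp_def)
  next
    fix v and x :: "(real^'m) \<times> (real^'k)" assume "v \<in> ?I" "norm x > r"
    with r[of x] have "\<bar>log_gauge \<alpha> x - v\<bar> \<ge> l" by auto
    then show "radial \<alpha> (\<lambda>s. \<zeta> (s - v) * exp s) x * q x = 0"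
      using l by (simp add: radial_def)
  next
    let ?f = "\<lambda>(v, x). radial \<alpha> (\<lambda>s. - \<zeta>' (s - v) * exp s) x * q x"
    \<comment> \<open>Joint continuity needs care at the origin, where q may be singular. On N the
      integrand vanishes for every v in the interval, so continuity is glued from N and the
      complement of the origin.\<close>
    obtain N :: "((real^'m) \<times> (real^'k)) set" where N: "open N" "0 \<in> N"
        "\<And>x. x \<in> N \<Longrightarrow> x \<noteq> 0 \<Longrightarrow> log_gauge \<alpha> x < t - 1 - l'"
      using eventually_log_gauge_less[OF assms(1), of "t - 1 - l'"] by (auto simp: eventually_nhds)
    have "continuous_on (?I \<times> - {0}) (\<lambda>(v, x). - \<zeta>' (log_gauge \<alpha> x - v) * exp (log_gauge \<alpha> x) * q x)"
    proof -
      have z: "continuous_on UNIV \<zeta>'" using assms(3) by (simp add: compact_supp_def)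
      show ?thesis
        unfolding case_prod_unfold
        by (intro continuous_intros continuous_on_compose2[OF z] continuous_on_compose2[OF q]
            continuous_on_compose2[OF continuous_log_gauge[OF assms(1)]]) auto
    qed
    then have 1: "continuous_on (?I \<times> - {0}) ?f"
    proof (rule continuous_on_eq)
      fix y assume "y \<in> ?I \<times> - {0 :: (real^'m) \<times> (real^'k)}"
      then have "snd y \<noteq> 0" by (metis ComplD SigmaE insertI1 snd_conv)
      then show "(case y of (v, x) \<Rightarrow> - \<zeta>' (log_gauge \<alpha> x - v) * exp (log_gauge \<alpha> x) * q x) = ?f y"
        by (simp add: radial_def case_prod_unfold)
    qed
    have "continuous_on (?I \<times> N) (\<lambda>x. 0::real)" by simp
    then have 2: "continuous_on (?I \<times> N) ?f"
    proof (rule continuous_on_eq, clarify)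
      fix v and a :: "real^'m" and b :: "real^'k" assume "v \<in> ?I" "(a, b) \<in> N"
      then show "0 = radial \<alpha> (\<lambda>s. - \<zeta>' (s - v) * exp s) (a, b) * q (a, b)"
        using N(3)[of "(a, b)"] l'[of "log_gauge \<alpha> (a, b) - v"] by (auto simp: radial_def)
    qed
    have "continuous_on (?I \<times> - {0} \<union> ?I \<times> N) ?f"
      by (rule continuous_on_open_Un[OF _ _ 1 2]) (auto intro!: open_Times N)
    moreover have "?I \<times> - {0} \<union> ?I \<times> N = ?I \<times> UNIV" using N(2) by auto
    ultimately show "continuous_on (?I \<times> UNIV) ?f" by simp
  qed auto
  moreover have "(LINT x|lborel. radial \<alpha> (\<lambda>s. - \<zeta>' (s - t) * exp s) x * q x) = - smear \<alpha> \<zeta>' q t"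
  proof -
    have "radial \<alpha> (\<lambda>s. - \<zeta>' (s - t) * exp s) x * q x = - (radial \<alpha> (\<lambda>s. \<zeta>' (s - t) * exp s) x * q x)" for x
      by (simp add: radial_def)
    then show ?thesis by (simp add: smear_def radial_integral_def)
  qed
  ultimately show ?thesis
    unfolding smear_def[abs_def] radial_integral_def by simp
qed

text \<open>The identities with the equation already inserted, kept as a property of the pair
  \<open>(u, p)\<close> in which p is not asked to be a gradient: the averaged function is only
  known as a limit of smooth ones. The weights vanish up to \<open>l0\<close>, because the equation
  holds only outside a gauge ball.\<close>

definition radial_identities ::
  "real \<Rightarrow> real \<Rightarrow> real \<Rightarrow> real \<Rightarrow> ((real^'m) \<times> (real^'k) \<Rightarrow> real) \<Rightarrow> ((real^'m) \<times> (real^'k) \<Rightarrow> (real^'m) \<times> (real^'k)) \<Rightarrow> bool"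
  where
  "radial_identities \<alpha> Q \<kappa> l0 u p \<longleftrightarrow>
    (\<forall>c c'. compact_supp c \<longrightarrow> compact_supp c' \<longrightarrow> (\<forall>s. (c has_real_derivative c' s) (at s)) \<longrightarrow> (\<forall>s\<le>l0. c s = 0) \<longrightarrow>
      2 * radial_integral \<alpha> c (\<lambda>x. gauge_weight \<alpha> x * (u x * (euler_field \<alpha> x \<bullet> p x))) =
        - (Q - 2) * radial_integral \<alpha> c (\<lambda>x. gauge_weight \<alpha> x * (u x)\<^sup>2) - radial_integral \<alpha> c' (\<lambda>x.
            gauge_weight \<alpha> x * (u x)\<^sup>2) \<and>
      2 * radial_integral \<alpha> c (\<lambda>x. u x * (euler_field \<alpha> x \<bullet> p x)) =
        - Q * radial_integral \<alpha> c (\<lambda>x. (u x)\<^sup>2) - radial_integral \<alpha> c' (\<lambda>x. (u x)\<^sup>2) \<and>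
      - \<kappa>\<^sup>2 * radial_integral \<alpha> c (\<lambda>x. (u x)\<^sup>2) =
        - radial_integral \<alpha> c (\<lambda>x. X_energy \<alpha> x (p x)) - radial_integral \<alpha> c' (\<lambda>x. gauge_weight \<alpha> x * (u x *
            (euler_field \<alpha> x \<bullet> p x))) \<and>
      - \<kappa>\<^sup>2 * radial_integral \<alpha> c (\<lambda>x. u x * (euler_field \<alpha> x \<bullet> p x)) =
        (Q - 2) / 2 * radial_integral \<alpha> c (\<lambda>x. X_energy \<alpha> x (p x)) + 1 / 2 * radial_integral \<alpha> c' (\<lambda>x.
            X_energy \<alpha> x (p x))
        - radial_integral \<alpha> c' (\<lambda>x. gauge_weight \<alpha> x * (euler_field \<alpha> x \<bullet> p x)\<^sup>2))"

text \<open>The derivative of \<zeta> (s - t) exp s is the weight built from \<zeta>' plus the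
  weight itself, which moves Q - 2 and Q to Q - 1 and Q + 1.\<close>

lemma smear_identities:
  fixes u :: "(real^'m) \<times> (real^'k) \<Rightarrow> real" and p :: "(real^'m) \<times> (real^'k) \<Rightarrow> (real^'m) \<times> (real^'k)"
  assumes \<alpha>: "\<alpha> > 0" and u: "continuous_on UNIV u" and p: "continuous_on UNIV p"
    and J: "radial_identities \<alpha> Q \<kappa> l0 u p"
    and \<zeta>: "compact_supp \<zeta>" "compact_supp \<zeta>'" "\<And>s. (\<zeta> has_real_derivative \<zeta>' s) (at s)" "\<And>s. s \<le> l0 - t \<Longrightarrow> \<zeta> s = 0"
  defines "qA \<equiv> \<lambda>x. gauge_weight \<alpha> x * (euler_field \<alpha> x \<bullet> p x)\<^sup>2"
    and "qB \<equiv> \<lambda>x. gauge_weight \<alpha> x * (u x * (euler_field \<alpha> x \<bullet> p x))"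
    and "qY \<equiv> \<lambda>x. gauge_weight \<alpha> x * (u x)\<^sup>2" and "qU \<equiv> \<lambda>x. (u x)\<^sup>2" and "qG \<equiv> \<lambda>x. X_energy \<alpha> x (p x)"
  shows "2 * smear \<alpha> \<zeta> qB t = - (Q - 1) * smear \<alpha> \<zeta> qY t - smear \<alpha> \<zeta>' qY t"
    and "smear \<alpha> \<zeta> qG t = \<kappa>\<^sup>2 * smear \<alpha> \<zeta> qU t - smear \<alpha> \<zeta> qB t - smear \<alpha> \<zeta>' qB t"
    and "(Q - 1) / 2 * smear \<alpha> \<zeta> qG t + smear \<alpha> \<zeta>' qG t / 2 - smear \<alpha> \<zeta> qA t - smear \<alpha> \<zeta>' qA t
        - ((Q + 1) * (\<kappa>\<^sup>2 * smear \<alpha> \<zeta> qU t) + \<kappa>\<^sup>2 * smear \<alpha> \<zeta>' qU t) / 2 = 0"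
proof -
  let ?c = "\<lambda>s. \<zeta> (s - t) * exp s" and ?c' = "\<lambda>s. \<zeta>' (s - t) * exp s + \<zeta> (s - t) * exp s"
  have z: "s \<le> l0 \<Longrightarrow> ?c s = 0" for s using \<zeta>(4)[of "s - t"] by simp
  have c: "compact_supp ?c" "compact_supp (\<lambda>s. \<zeta>' (s - t) * exp s)" by (rule compact_supp_shift; fact)+
  have d: "(?c has_real_derivative ?c' s) (at s)" for s by (rule DERIV_shift_weight[OF \<zeta>(3)])
  have "continuous_on UNIV ?c'" using c by (auto simp: compact_supp_def intro!: continuous_on_add)
  then have c': "compact_supp ?c'" by (rule DERIV_compact_supp[OF c(1) _ d])
  note J = J[unfolded radial_identities_def, rule_format, OF c(1) c' d z, THEN conjunct1]
    J[unfolded radial_identities_def, rule_format, OF c(1) c' d z, THEN conjunct2, THEN conjunct1]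
    J[unfolded radial_identities_def, rule_format, OF c(1) c' d z, THEN conjunct2, THEN conjunct2, THEN conjunct1]
    J[unfolded radial_identities_def, rule_format, OF c(1) c' d z, THEN conjunct2, THEN conjunct2, THEN conjunct2]
  have co: "continuous_on (- {0}) u" "continuous_on (- {0}) p"
    using u p continuous_on_subset by blast+
  have cont: "continuous_on (- {0}) qA" "continuous_on (- {0}) qB" "continuous_on (- {0}) qY"
      "continuous_on (- {0}) qU" "continuous_on (- {0}) qG"
    unfolding qA_def qB_def qY_def qU_def qG_def
    by (intro continuous_intros continuous_gauge_weight[OF \<alpha>] continuous_euler_field continuous_X_energy[OF \<alpha>] co)+
  have r: "radial_integral \<alpha> ?c q = smear \<alpha> \<zeta> q t" for q :: "(real^'m) \<times> (real^'k) \<Rightarrow> real" by (simp add: smear_def)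
  have r': "radial_integral \<alpha> ?c' q = smear \<alpha> \<zeta>' q t + smear \<alpha> \<zeta> q t" if "continuous_on (- {0}) q"
      for q :: "(real^'m) \<times> (real^'k) \<Rightarrow> real"
    unfolding smear_def by (rule radial_integral_add_weight[OF \<alpha> c(2,1) that])
  note rs = r r'[OF cont(1)] r'[OF cont(2)] r'[OF cont(3)] r'[OF cont(4)] r'[OF cont(5)]
  note folds = qA_def[symmetric] qB_def[symmetric] qY_def[symmetric] qU_def[symmetric] qG_def[symmetric]
  show "2 * smear \<alpha> \<zeta> qB t = - (Q - 1) * smear \<alpha> \<zeta> qY t - smear \<alpha> \<zeta>' qY t"
    using J(1) unfolding folds rs by (simp add: algebra_simps)
  show "smear \<alpha> \<zeta> qG t = \<kappa>\<^sup>2 * smear \<alpha> \<zeta> qU t - smear \<alpha> \<zeta> qB t - smear \<alpha> \<zeta>' qB t"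
    using J(3) unfolding folds rs by (simp add: algebra_simps)
  \<comment> \<open>The smear of u Z u without the factor \<omega> has no place among A, B, Y, M, G;
    the unweighted dilation identity expresses it through u^2.\<close>
  let ?z = "smear \<alpha> \<zeta> (\<lambda>x. u x * (euler_field \<alpha> x \<bullet> p x)) t"
  have "2 * ?z = - Q * smear \<alpha> \<zeta> qU t - (smear \<alpha> \<zeta>' qU t + smear \<alpha> \<zeta> qU t)"
    using J(2) unfolding folds rs .
  then have "\<kappa>\<^sup>2 * (2 * ?z) = \<kappa>\<^sup>2 * (- Q * smear \<alpha> \<zeta> qU t - (smear \<alpha> \<zeta>' qU t + smear \<alpha> \<zeta> qU t))"
    by simp
  moreover have "- \<kappa>\<^sup>2 * ?z = (Q - 2) / 2 * smear \<alpha> \<zeta> qG t + 1 / 2 * (smear \<alpha> \<zeta>' qG t + smear \<alpha> \<zeta> qG t)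
      - (smear \<alpha> \<zeta>' qA t + smear \<alpha> \<zeta> qA t)"
    using J(4) unfolding folds rs .
  ultimately show "(Q - 1) / 2 * smear \<alpha> \<zeta> qG t + smear \<alpha> \<zeta>' qG t / 2 - smear \<alpha> \<zeta> qA t - smear \<alpha> \<zeta>' qA t
        - ((Q + 1) * (\<kappa>\<^sup>2 * smear \<alpha> \<zeta> qU t) + \<kappa>\<^sup>2 * smear \<alpha> \<zeta>' qU t) / 2 = 0"
    by (simp add: field_simps)
qed

section \<open>Bumps on the line and bounds for the smears\<close>

lemma bump_real_pos: "w > 0 \<Longrightarrow> bump w (s :: real) > 0 \<longleftrightarrow> \<bar>s\<bar> < w"
  using bump_pos[of w s] by simp

lemma bump_real_eq_0: "w > 0 \<Longrightarrow> \<bar>s :: real\<bar> \<ge> w \<Longrightarrow> bump w s = 0"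
  using bump_real_pos[of w s] bump_nonneg[of w s] by simp

lemma compact_supp_bump: "w > 0 \<Longrightarrow> compact_supp (bump w :: 'a::euclidean_space \<Rightarrow> real)"
  by (rule compact_suppI[of _ "w * DIM('a)"]) (auto intro: C_diff_continuous[OF C_diff_bump] bump_eq_0)

lemma compact_supp_bump_shift:
  fixes t :: real
  assumes "w > 0"
  shows "compact_supp (\<lambda>s. bump w (s - t))"
proof (rule compact_suppI)
  show "continuous_on UNIV (\<lambda>s. bump w (s - t))"
    by (rule continuous_on_compose2[OF C_diff_continuous[OF C_diff_bump]]) (auto intro!: continuous_intros)
  fix s :: real assume "norm s > w + \<bar>t\<bar>"
  then show "bump w (s - t) = 0" by (intro bump_real_eq_0 assms) simp
qed

lemma smooth_real_derivative:
  fixes \<zeta> :: "real \<Rightarrow> real"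
  assumes "\<And>n. C_diff n \<zeta>"
  shows "(\<zeta> has_real_derivative dir_deriv 1 \<zeta> s) (at s)"
proof -
  have "\<zeta> differentiable (at s)" using assms[of 1] by simp
  then have "(\<zeta> has_derivative (\<lambda>v. dir_deriv v \<zeta> s)) (at (0 + s *\<^sub>R 1))"
    by (simp add: has_derivative_dir_deriv)
  from has_real_derivative_line[OF this] show ?thesis by simp
qed

lemma derivative_eq_0_outside:
  fixes \<zeta> \<zeta>' :: "real \<Rightarrow> real"
  assumes "\<And>s. (\<zeta> has_real_derivative \<zeta>' s) (at s)" "\<And>s. \<bar>s\<bar> > w \<Longrightarrow> \<zeta> s = 0" "\<bar>s\<bar> > w"
  shows "\<zeta>' s = 0"
proof -
  have "open {x::real. \<bar>x\<bar> > w}" by (intro open_Collect_less continuous_intros)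
  then have "\<forall>\<^sub>F x in nhds s. \<zeta> x = 0"
    using eventually_nhds_in_open[of "{x. \<bar>x\<bar> > w}" s] assms(2,3) by (auto elim: eventually_mono)
  from DERIV_cong_ev[OF refl this refl] assms(1)[of s]
  have "((\<lambda>x. 0) has_real_derivative \<zeta>' s) (at s)" by simp
  then show ?thesis using DERIV_unique DERIV_const by blast
qed

text \<open>The wider bump has a positive lower bound on [-w, w] by compactness. In this way one
  window controls the smears with \<zeta> and with its first two derivatives.\<close>

lemma bump_dominates:
  fixes \<eta> :: "real \<Rightarrow> real"
  assumes "w > 0" "continuous_on UNIV \<eta>" "\<And>s. \<bar>s\<bar> > w \<Longrightarrow> \<eta> s = 0"
  shows "\<exists>K>0. \<forall>s. \<bar>\<eta> s\<bar> \<le> K * bump (2 * w) s"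
proof -
  let ?h = "\<lambda>s. \<bar>\<eta> s\<bar> / bump (2 * w) s"
  have pos: "bump (2 * w) s > 0" if "s \<in> {-w..w}" for s
    using bump_real_pos[of "2 * w" s] assms(1) that by auto
  have "continuous_on {-w..w} ?h"
    using pos by (intro continuous_intros continuous_on_subset[OF assms(2)]
        continuous_on_subset[OF C_diff_continuous[OF C_diff_bump]]) (auto simp: less_imp_neq[symmetric])
  then have "bounded (?h ` {-w..w})" by (intro compact_imp_bounded compact_continuous_image) auto
  then obtain K where K: "K > 0" "\<And>s. s \<in> {-w..w} \<Longrightarrow> norm (?h s) \<le> K"
    unfolding bounded_pos by auto
  have "\<bar>\<eta> s\<bar> \<le> K * bump (2 * w) s" for s
  proof (cases "s \<in> {-w..w}")
    case True
    then show ?thesis using K(2)[OF True] pos[OF True] by (simp add: divide_le_eq)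
  next
    case False
    then have "\<eta> s = 0" by (intro assms(3)) auto
    then show ?thesis using K(1) bump_nonneg[of "2 * w" s] by simp
  qed
  then show ?thesis using K(1) by blast
qed

lemma smear_bound:
  fixes u :: "(real^'m) \<times> (real^'k) \<Rightarrow> real"
  assumes "\<alpha> > 0" "w > 0" and u: "continuous_on UNIV u"
    and \<eta>: "compact_supp \<eta>" "\<And>s. \<bar>s\<bar> > w \<Longrightarrow> \<eta> s = 0"
  shows "\<exists>K>0. \<forall>t\<ge>w. \<bar>smear \<alpha> \<eta> (\<lambda>x. gauge_weight \<alpha> x * (u x)\<^sup>2) t\<bar> \<le> K * exp t * radial_integral \<alpha> (\<lambda>s. bump
      (2 * w) (s - t)) (\<lambda>x. (u x)\<^sup>2)
      \<and> \<bar>smear \<alpha> \<eta> (\<lambda>x. (u x)\<^sup>2) t\<bar> \<le> K * exp t * radial_integral \<alpha> (\<lambda>s. bump (2 * w) (s - t)) (\<lambda>x. (u x)\<^sup>2)"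
proof -
  have "continuous_on UNIV \<eta>" using \<eta>(1) by (simp add: compact_supp_def)
  from bump_dominates[OF assms(2) this \<eta>(2)]
  obtain K where K: "K > 0" "\<And>s. \<bar>\<eta> s\<bar> \<le> K * bump (2 * w) s" by auto
  have co: "continuous_on (- {0}) u" using u continuous_on_subset by blast
  have gen: "\<bar>smear \<alpha> \<eta> (\<lambda>x. g x * (u x)\<^sup>2) t\<bar> \<le> (K * exp w) * exp t * radial_integral \<alpha> (\<lambda>s. bump (2 * w) (s
      - t)) (\<lambda>x. (u x)\<^sup>2)"
    if t: "t \<ge> w" and g: "continuous_on (- {0}) g" "\<And>x. x \<noteq> 0 \<Longrightarrow> log_gauge \<alpha> x \<ge> 0 \<Longrightarrow> 0 \<le> g x \<and>
        g x \<le> 1" for t and g :: "(real^'m) \<times> (real^'k) \<Rightarrow> real"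
  proof -
    have b: "compact_supp (\<lambda>s. bump (2 * w) (s - t))" by (rule compact_supp_bump_shift) (use assms(2) in simp)
    let ?R = "radial_integral \<alpha> (\<lambda>s. bump (2 * w) (s - t)) (\<lambda>x. (K * exp w * exp t) * (u x)\<^sup>2)"
    have *: "\<bar>\<eta> (log_gauge \<alpha> x - t) * exp (log_gauge \<alpha> x) * (g x * (u x)\<^sup>2)\<bar> \<le> bump (2 * w) (log_gauge \<alpha> x -
        t) * ((K * exp w * exp t) * (u x)\<^sup>2)" if "x \<noteq> 0" for x
    proof (cases "\<eta> (log_gauge \<alpha> x - t) = 0")
      case True
      then show ?thesis using K(1) by (auto intro!: mult_nonneg_nonneg bump_nonneg)
    next
      case False
      then have "\<bar>log_gauge \<alpha> x - t\<bar> \<le> w" using \<eta>(2) by (meson not_le)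
      \<comment> \<open>The condition t \<ge> w puts the support into ln \<rho> \<ge> 0, where the
        factor g, in particular \<omega>, is at most 1.\<close>
      then have "log_gauge \<alpha> x \<le> w + t" "log_gauge \<alpha> x \<ge> 0" using t by auto
      then have "\<bar>\<eta> (log_gauge \<alpha> x - t)\<bar> * exp (log_gauge \<alpha> x) * (g x * (u x)\<^sup>2) \<le>
          (K * bump (2 * w) (log_gauge \<alpha> x - t)) * exp (w + t) * (1 * (u x)\<^sup>2)"
        using K g(2)[OF that] bump_nonneg by (intro mult_mono mult_nonneg_nonneg) auto
      then show ?thesis
        using g(2)[OF that \<open>log_gauge \<alpha> x \<ge> 0\<close>] by (simp add: abs_mult exp_add ac_simps)
    qed
    note m = compact_supp_shift[OF \<eta>(1), of t] b
    have "smear \<alpha> \<eta> (\<lambda>x. g x * (u x)\<^sup>2) t \<le> ?R"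
      unfolding smear_def
      by (rule radial_integral_mono[OF assms(1) m]) (use * abs_le_D1 in \<open>auto intro!: continuous_intros g co\<close>)
    moreover have "smear \<alpha> \<eta> (\<lambda>x. (- g x) * (u x)\<^sup>2) t \<le> ?R"
      unfolding smear_def
    proof (rule radial_integral_mono[OF assms(1) m])
      fix x :: "(real^'m) \<times> (real^'k)" assume "x \<noteq> 0"
      from abs_le_D2[OF *[OF this]]
      show "\<eta> (log_gauge \<alpha> x - t) * exp (log_gauge \<alpha> x) * (- g x * (u x)\<^sup>2) \<le> bump (2 * w) (log_gauge \<alpha> x -
          t) * ((K * exp w * exp t) * (u x)\<^sup>2)"
        by simp
    qed (intro continuous_intros g co)+
    moreover have "smear \<alpha> \<eta> (\<lambda>x. (- g x) * (u x)\<^sup>2) t = - smear \<alpha> \<eta> (\<lambda>x. g x * (u x)\<^sup>2) t"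
      using radial_integral_cmult[of \<alpha> _ "-1" "\<lambda>x. g x * (u x)\<^sup>2"] by (simp add: smear_def)
    ultimately show ?thesis by (simp add: abs_le_iff radial_integral_cmult)
  qed
  show ?thesis
  proof (intro exI[of _ "K * exp w"] conjI allI impI)
    show "K * exp w > 0" using K by simp
    fix t assume t: "w \<le> t"
    show "\<bar>smear \<alpha> \<eta> (\<lambda>x. gauge_weight \<alpha> x * (u x)\<^sup>2) t\<bar> \<le> K * exp w * exp t * radial_integral \<alpha> (\<lambda>s. bump (2
        * w) (s - t)) (\<lambda>x. (u x)\<^sup>2)"
    proof (rule gen[OF t continuous_gauge_weight[OF assms(1)]])
      fix x :: "(real^'m) \<times> (real^'k)" assume x: "x \<noteq> 0" "log_gauge \<alpha> x \<ge> 0"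
      have "gauge_weight \<alpha> x \<le> exp (- 2 * log_gauge \<alpha> x)" by (rule gauge_weight_le(2)[OF assms(1) x(1)])
      also have "\<dots> \<le> 1" using x by simp
      finally show "0 \<le> gauge_weight \<alpha> x \<and> gauge_weight \<alpha> x \<le> 1" using gauge_weight_le(1)[OF assms(1) x(1)] by simp
    qed
    show "\<bar>smear \<alpha> \<eta> (\<lambda>x. (u x)\<^sup>2) t\<bar> \<le> K * exp w * exp t * radial_integral \<alpha> (\<lambda>s. bump (2 * w) (s - t)) (\<lambda>x. (u x)\<^sup>2)"
      using gen[OF t, of "\<lambda>x. 1"] by simp
  qed
qed

text \<open>Smallness is assumed for the L^2 mass alone. The dilation identity expresses B through
  smears of \<omega> u^2 with \<zeta> and \<zeta>'; applied to \<zeta>' in place of \<zeta>, it does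
  the same for B' with \<zeta>' and \<zeta>''. Two derivatives of the bump thus replace any bound on
  derivatives of u at infinity.\<close>

lemma smear_rellich:
  fixes u :: "(real^'m) \<times> (real^'k) \<Rightarrow> real" and p :: "(real^'m) \<times> (real^'k) \<Rightarrow> (real^'m) \<times> (real^'k)"
  assumes \<alpha>: "\<alpha> > 0" and Q: "Q \<ge> 3" and \<kappa>: "\<kappa> > 0" and w: "w > 0"
    and u: "continuous_on UNIV u" and p: "continuous_on UNIV p"
    and J: "radial_identities \<alpha> Q \<kappa> l0 u p"
    and small: "\<And>e T. e > 0 \<Longrightarrow> \<exists>t>T. radial_integral \<alpha> (\<lambda>s. bump (2 * w) (s - t)) (\<lambda>x. (u x)\<^sup>2) \<le> e * exp t"
    and t: "t > l0 + w"
  shows "smear \<alpha> (bump w) (\<lambda>x. gauge_weight \<alpha> x * (u x)\<^sup>2) t = 0"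
proof -
  define \<zeta> :: "real \<Rightarrow> real" where "\<zeta> = bump w"
  define \<zeta>1 where "\<zeta>1 = dir_deriv 1 \<zeta>"
  define \<zeta>2 where "\<zeta>2 = dir_deriv 1 \<zeta>1"
  define qA where "qA x = gauge_weight \<alpha> x * (euler_field \<alpha> x \<bullet> p x)\<^sup>2" for x
  define qB where "qB x = gauge_weight \<alpha> x * (u x * (euler_field \<alpha> x \<bullet> p x))" for x
  define qY where "qY x = gauge_weight \<alpha> x * (u x)\<^sup>2" for x
  define qU where "qU x = (u x)\<^sup>2" for x
  define qG where "qG x = X_energy \<alpha> x (p x)" for x
  note folds = qA_def[abs_def, symmetric] qB_def[abs_def, symmetric] qY_def[abs_def, symmetric]
    qU_def[abs_def, symmetric] qG_def[abs_def, symmetric]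
  have C: "C_diff n \<zeta>" "C_diff n \<zeta>1" "C_diff n \<zeta>2" for n
    unfolding \<zeta>_def \<zeta>1_def \<zeta>2_def by (intro C_diff_dir_deriv C_diff_bump)+
  have d: "(\<zeta> has_real_derivative \<zeta>1 s) (at s)" "(\<zeta>1 has_real_derivative \<zeta>2 s) (at s)" for s
    unfolding \<zeta>1_def \<zeta>2_def by (rule smooth_real_derivative; use C in \<open>simp add: \<zeta>1_def\<close>)+
  have z0: "\<bar>s\<bar> > w \<Longrightarrow> \<zeta> s = 0" for s unfolding \<zeta>_def by (rule bump_real_eq_0[OF w]) simp
  have z1: "\<bar>s\<bar> > w \<Longrightarrow> \<zeta>1 s = 0" for s by (rule derivative_eq_0_outside[OF d(1) z0])
  have z2: "\<bar>s\<bar> > w \<Longrightarrow> \<zeta>2 s = 0" for s by (rule derivative_eq_0_outside[OF d(2) z1])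
  have Ccs: "compact_supp \<zeta>" "compact_supp \<zeta>1" "compact_supp \<zeta>2"
    using z0 z1 z2 C by (auto intro!: compact_suppI[of _ w] intro: C_diff_continuous)
  have co: "continuous_on (- {0}) u" "continuous_on (- {0}) p"
    using u p continuous_on_subset by blast+
  have cont: "continuous_on (- {0}) qA" "continuous_on (- {0}) qB" "continuous_on (- {0}) qY"
      "continuous_on (- {0}) qU" "continuous_on (- {0}) qG"
    unfolding qA_def qB_def qY_def qU_def qG_def
    by (intro continuous_intros continuous_gauge_weight[OF \<alpha>] continuous_euler_field continuous_X_energy[OF \<alpha>] co)+
  note ids = smear_identities[OF \<alpha> u p J, unfolded folds]
  have I: "2 * smear \<alpha> \<zeta> qB t = - (Q - 1) * smear \<alpha> \<zeta> qY t - smear \<alpha> \<zeta>1 qY t"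
      "smear \<alpha> \<zeta> qG t = \<kappa>\<^sup>2 * smear \<alpha> \<zeta> qU t - smear \<alpha> \<zeta> qB t - smear \<alpha> \<zeta>1 qB t"
      "(Q - 1) / 2 * smear \<alpha> \<zeta> qG t + smear \<alpha> \<zeta>1 qG t / 2 - smear \<alpha> \<zeta> qA t - smear \<alpha> \<zeta>1 qA t
        - ((Q + 1) * (\<kappa>\<^sup>2 * smear \<alpha> \<zeta> qU t) + \<kappa>\<^sup>2 * smear \<alpha> \<zeta>1 qU t) / 2 = 0"
      "2 * smear \<alpha> \<zeta>1 qB t = - (Q - 1) * smear \<alpha> \<zeta>1 qY t - smear \<alpha> \<zeta>2 qY t"
    if "t > l0 + w" for t
  proof -
    have "\<zeta> s = 0" "\<zeta>1 s = 0" if "s \<le> l0 - t" for s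
      using that \<open>t > l0 + w\<close> w by (auto intro!: z0 z1)
    note z = this
    show "2 * smear \<alpha> \<zeta> qB t = - (Q - 1) * smear \<alpha> \<zeta> qY t - smear \<alpha> \<zeta>1 qY t"
      by (rule ids(1)[OF Ccs(1,2) d(1) z(1)])
    show "smear \<alpha> \<zeta> qG t = \<kappa>\<^sup>2 * smear \<alpha> \<zeta> qU t - smear \<alpha> \<zeta> qB t - smear \<alpha> \<zeta>1 qB t"
      by (rule ids(2)[OF Ccs(1,2) d(1) z(1)])
    show "(Q - 1) / 2 * smear \<alpha> \<zeta> qG t + smear \<alpha> \<zeta>1 qG t / 2 - smear \<alpha> \<zeta> qA t - smear \<alpha> \<zeta>1 qA t
        - ((Q + 1) * (\<kappa>\<^sup>2 * smear \<alpha> \<zeta> qU t) + \<kappa>\<^sup>2 * smear \<alpha> \<zeta>1 qU t) / 2 = 0"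
      by (rule ids(3)[OF Ccs(1,2) d(1) z(1)])
    show "2 * smear \<alpha> \<zeta>1 qB t = - (Q - 1) * smear \<alpha> \<zeta>1 qY t - smear \<alpha> \<zeta>2 qY t"
      by (rule ids(1)[OF Ccs(2,3) d(2) z(2)])
  qed
  let ?R = "\<lambda>t. radial_integral \<alpha> (\<lambda>s. bump (2 * w) (s - t)) qU"
  obtain K0 where K0: "K0 > 0" "\<And>t. t \<ge> w \<Longrightarrow> \<bar>smear \<alpha> \<zeta> qY t\<bar> \<le> K0 * exp t * ?R t" "\<And>t. t \<ge> w \<Longrightarrow>
      \<bar>smear \<alpha> \<zeta> qU t\<bar> \<le> K0 * exp t * ?R t"
    using smear_bound[OF \<alpha> w u Ccs(1) z0, unfolded folds] by auto
  obtain K1 where K1: "K1 > 0" "\<And>t. t \<ge> w \<Longrightarrow> \<bar>smear \<alpha> \<zeta>1 qY t\<bar> \<le> K1 * exp t * ?R t"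
    using smear_bound[OF \<alpha> w u Ccs(2) z1, unfolded folds] by auto
  obtain K2 where K2: "K2 > 0" "\<And>t. t \<ge> w \<Longrightarrow> \<bar>smear \<alpha> \<zeta>2 qY t\<bar> \<le> K2 * exp t * ?R t"
    using smear_bound[OF \<alpha> w u Ccs(3) z2, unfolded folds] by auto
  have \<zeta>_nonneg: "\<zeta> s \<ge> 0" for s by (simp add: \<zeta>_def bump_nonneg)
  note sd = smear_derivative[OF \<alpha> Ccs(1,2) d(1)]
  have sumsq: "smear \<alpha> \<zeta> (\<lambda>x. qA x + (2 * s * qB x + s\<^sup>2 * qY x)) t =
      smear \<alpha> \<zeta> qA t + (2 * s * smear \<alpha> \<zeta> qB t + s\<^sup>2 * smear \<alpha> \<zeta> qY t)" for s t
  proof -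
    note c = compact_supp_shift[OF Ccs(1), of t]
    show ?thesis
      unfolding smear_def
      by (subst radial_integral_add[OF \<alpha> c], (intro continuous_intros cont)+)
         (subst radial_integral_add[OF \<alpha> c], (intro continuous_intros cont)+, simp only: radial_integral_cmult)
  qed
  have "smear \<alpha> \<zeta> qY t = 0"
  proof (rule rellich_ode[where A = "smear \<alpha> \<zeta> qA" and A' = "\<lambda>t. - smear \<alpha> \<zeta>1 qA t"
        and B = "smear \<alpha> \<zeta> qB" and B' = "\<lambda>t. - smear \<alpha> \<zeta>1 qB t"
        and G = "smear \<alpha> \<zeta> qG" and G' = "\<lambda>t. - smear \<alpha> \<zeta>1 qG t"
        and M = "\<lambda>t. \<kappa>\<^sup>2 * smear \<alpha> \<zeta> qU t" and M' = "\<lambda>t. - (\<kappa>\<^sup>2 * smear \<alpha> \<zeta>1 qU t)"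
        and Y = "smear \<alpha> \<zeta> qY" and \<tau> = "(Q - 1) / 2" and C = "exp (2 * w) / \<kappa>\<^sup>2" and ?t0.0 = "l0 + w"])
    fix t :: real assume t: "l0 + w < t"
    show "(smear \<alpha> \<zeta> qA has_real_derivative - smear \<alpha> \<zeta>1 qA t) (at t)"
      "(smear \<alpha> \<zeta> qB has_real_derivative - smear \<alpha> \<zeta>1 qB t) (at t)"
      "(smear \<alpha> \<zeta> qG has_real_derivative - smear \<alpha> \<zeta>1 qG t) (at t)"
      by (intro sd cont)+
    show "((\<lambda>t. \<kappa>\<^sup>2 * smear \<alpha> \<zeta> qU t) has_real_derivative - (\<kappa>\<^sup>2 * smear \<alpha> \<zeta>1 qU t)) (at t)"
      using DERIV_cmult[OF sd[OF cont(4)], of "\<kappa>\<^sup>2" t] by simp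
    show "(smear \<alpha> \<zeta> qY has_real_derivative 2 * smear \<alpha> \<zeta> qB t + 2 * ((Q - 1) / 2) * smear \<alpha> \<zeta> qY t) (at t)"
      by (rule DERIV_cong[OF sd[OF cont(3)]]) (use I(1)[OF t] in \<open>simp add: field_simps\<close>)
    show "smear \<alpha> \<zeta> qG t = \<kappa>\<^sup>2 * smear \<alpha> \<zeta> qU t - smear \<alpha> \<zeta> qB t + - smear \<alpha> \<zeta>1 qB t"
      using I(2)[OF t] by simp
    show "(Q - 1) / 2 * smear \<alpha> \<zeta> qG t - - smear \<alpha> \<zeta>1 qG t / 2 - smear \<alpha> \<zeta> qA t + - smear \<alpha> \<zeta>1 qA t -
         ((2 * ((Q - 1) / 2) + 2) * (\<kappa>\<^sup>2 * smear \<alpha> \<zeta> qU t) - - (\<kappa>\<^sup>2 * smear \<alpha> \<zeta>1 qU t)) / 2 = 0"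
      using I(3)[OF t] by (simp add: field_simps)
    show "0 \<le> \<kappa>\<^sup>2 * smear \<alpha> \<zeta> qU t"
      unfolding smear_def by (intro mult_nonneg_nonneg radial_integral_nonneg) (auto simp: \<zeta>_nonneg qU_def)
    show "0 \<le> smear \<alpha> \<zeta> qY t"
      unfolding smear_def by (intro radial_integral_nonneg mult_nonneg_nonneg) (auto simp: \<zeta>_nonneg qY_def
          gauge_weight_le(1)[OF \<alpha>])
    show "smear \<alpha> \<zeta> qA t \<le> smear \<alpha> \<zeta> qG t"
      unfolding smear_def
    proof (rule radial_integral_mono[OF \<alpha> compact_supp_shift[OF Ccs(1)] compact_supp_shift[OF Ccs(1)] cont(1) cont(5)])
      fix x :: "(real^'m) \<times> (real^'k)" assume "x \<noteq> 0"
      from gauge_weight_euler_field_le_X_energy[OF \<alpha> this, of "p x"]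
      show "\<zeta> (log_gauge \<alpha> x - t) * exp (log_gauge \<alpha> x) * qA x \<le> \<zeta> (log_gauge \<alpha> x - t) * exp (log_gauge \<alpha> x) * qG x"
        by (intro mult_left_mono) (auto simp: qA_def qG_def \<zeta>_nonneg)
    qed
    show "0 \<le> smear \<alpha> \<zeta> qA t + 2 * s * smear \<alpha> \<zeta> qB t + s\<^sup>2 * smear \<alpha> \<zeta> qY t" for s
    proof -
      have "0 \<le> smear \<alpha> \<zeta> (\<lambda>x. qA x + (2 * s * qB x + s\<^sup>2 * qY x)) t"
        unfolding smear_def
      proof (rule radial_integral_nonneg)
        fix x :: "(real^'m) \<times> (real^'k)" assume x: "x \<noteq> 0"
        have "qA x + (2 * s * qB x + s\<^sup>2 * qY x) = gauge_weight \<alpha> x * (euler_field \<alpha> x \<bullet> p x + s * u x)\<^sup>2"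
          by (simp add: qA_def qB_def qY_def power2_eq_square algebra_simps)
        then show "0 \<le> \<zeta> (log_gauge \<alpha> x - t) * exp (log_gauge \<alpha> x) * (qA x + (2 * s * qB x + s\<^sup>2 * qY x))"
          using gauge_weight_le(1)[OF \<alpha> x] by (simp add: \<zeta>_nonneg)
      qed
      then show ?thesis by (simp add: sumsq)
    qed
    \<comment> \<open>On the support ln \<rho> \<ge> t - w, hence \<omega> \<le> exp (2 w - 2 t);
      the division by \<kappa>^2 offsets the factor in M.\<close>
    show "smear \<alpha> \<zeta> qY t \<le> exp (2 * w) / \<kappa>\<^sup>2 * exp (- 2 * t) * (\<kappa>\<^sup>2 * smear \<alpha> \<zeta> qU t)"
    proof -
      have "smear \<alpha> \<zeta> qY t \<le> smear \<alpha> \<zeta> (\<lambda>x. (exp (2 * w) * exp (- 2 * t)) * qU x) t"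
        unfolding smear_def
      proof (rule radial_integral_mono[OF \<alpha> compact_supp_shift[OF Ccs(1)] compact_supp_shift[OF Ccs(1)] cont(3)])
        fix x :: "(real^'m) \<times> (real^'k)" assume x: "x \<noteq> 0"
        show "\<zeta> (log_gauge \<alpha> x - t) * exp (log_gauge \<alpha> x) * qY x \<le> \<zeta> (log_gauge \<alpha> x - t) * exp (log_gauge \<alpha> x)
            * (exp (2 * w) * exp (- 2 * t) * qU x)"
        proof (cases "\<bar>log_gauge \<alpha> x - t\<bar> > w")
          case True
          then show ?thesis by (simp add: z0)
        next
          case False
          have "gauge_weight \<alpha> x \<le> exp (- 2 * log_gauge \<alpha> x)" by (rule gauge_weight_le(2)[OF \<alpha> x])
          also have "\<dots> \<le> exp (2 * w + - 2 * t)" using False by simp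
          finally have "gauge_weight \<alpha> x \<le> exp (2 * w) * exp (- 2 * t)" by (simp only: exp_add)
          then show ?thesis unfolding qY_def qU_def
            by (intro mult_left_mono mult_right_mono) (auto simp: \<zeta>_nonneg)
        qed
      qed (intro continuous_intros cont)
      also have "\<dots> = exp (2 * w) * exp (- 2 * t) * smear \<alpha> \<zeta> qU t"
        unfolding smear_def by (rule radial_integral_cmult)
      finally show ?thesis using \<kappa> by simp
    qed
  next
    show "exp (2 * w) / \<kappa>\<^sup>2 > 0" using \<kappa> by simp
    show "1 \<le> (Q - 1) / 2" using Q by simp
    show "l0 + w < t" by (rule t)
    fix e T :: real assume e: "e > 0"
    \<comment> \<open>The four summands are the coefficients with which \<open>exp t * ?R t\<close>
      bounds M, Y, B and B', in this order.\<close>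
    define KK where "KK = \<kappa>\<^sup>2 * K0 + K0 + ((Q - 1) * K0 + K1) / 2 + ((Q - 1) * K1 + K2) / 2"
    have KK: "KK > 0"
      unfolding KK_def using K0(1) K1(1) K2(1) Q \<kappa> by (intro add_pos_pos divide_pos_pos mult_pos_pos) auto
    obtain t where t: "t > max T (max w (l0 + w))" "?R t \<le> e / KK * exp t"
      using small[of "e / KK" "max T (max w (l0 + w))", unfolded folds] e KK by auto
    define E where "E = exp t * ?R t"
    have tw: "t \<ge> w" "t > l0 + w" using t by auto
    have b: "\<bar>smear \<alpha> \<zeta> qY t\<bar> \<le> K0 * E" "\<bar>smear \<alpha> \<zeta> qU t\<bar> \<le> K0 * E"
        "\<bar>smear \<alpha> \<zeta>1 qY t\<bar> \<le> K1 * E" "\<bar>smear \<alpha> \<zeta>2 qY t\<bar> \<le> K2 * E"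
      using K0(2,3)[OF tw(1)] K1(2)[OF tw(1)] K2(2)[OF tw(1)] by (simp_all add: E_def mult.assoc)
    have m: "(Q - 1) * \<bar>smear \<alpha> \<zeta> qY t\<bar> \<le> (Q - 1) * (K0 * E)" "(Q - 1) * \<bar>smear \<alpha> \<zeta>1 qY t\<bar> \<le> (Q - 1) * (K1 * E)"
        "\<kappa>\<^sup>2 * smear \<alpha> \<zeta> qU t \<le> \<kappa>\<^sup>2 * (K0 * E)"
      using b Q by (auto intro!: mult_left_mono)
    have tri: "2 * \<bar>z\<bar> \<le> (Q - 1) * \<bar>y\<bar> + \<bar>y'\<bar>" if "2 * z = - (Q - 1) * y - y'" for z y y' :: real
    proof -
      have "\<bar>2 * z\<bar> \<le> \<bar>- (Q - 1) * y\<bar> + \<bar>y'\<bar>" unfolding that by (rule abs_triangle_ineq4)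
      then show ?thesis using Q by (simp add: abs_mult)
    qed
    have "2 * \<bar>smear \<alpha> \<zeta> qB t\<bar> \<le> (Q - 1) * (K0 * E) + K1 * E"
      using tri[OF I(1)[OF tw(2)]] m(1) b(3) by linarith
    moreover have "2 * \<bar>smear \<alpha> \<zeta>1 qB t\<bar> \<le> (Q - 1) * (K1 * E) + K2 * E"
      using tri[OF I(4)[OF tw(2)]] m(2) b(4) by linarith
    moreover have "a + b + c + d \<le> A + B + C / 2 + D / 2"
      if "2 * c \<le> C" "2 * d \<le> D" "a \<le> A" "b \<le> B" for a b c d A B C D :: real
      using that by linarith
    ultimately have "\<kappa>\<^sup>2 * smear \<alpha> \<zeta> qU t + \<bar>smear \<alpha> \<zeta> qY t\<bar> + \<bar>smear \<alpha> \<zeta> qB t\<bar> + \<bar>- smear \<alpha> \<zeta>1 qB t\<bar> \<le> 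
        \<kappa>\<^sup>2 * (K0 * E) + K0 * E + ((Q - 1) * (K0 * E) + K1 * E) / 2 + ((Q - 1) * (K1 * E) + K2 * E) / 2"
      using m(3) b(1) unfolding abs_minus_cancel by blast
    also have "\<dots> = KK * E" by (simp add: KK_def field_simps)
    also have "\<dots> \<le> KK * (exp t * (e / KK * exp t))"
      unfolding E_def using t(2) KK by (intro mult_left_mono) auto
    also have "\<dots> = e * exp (2 * t)" using KK by (simp add: exp_double power2_eq_square)
    finally show "\<exists>t>T. \<kappa>\<^sup>2 * smear \<alpha> \<zeta> qU t + \<bar>smear \<alpha> \<zeta> qY t\<bar> + \<bar>smear \<alpha> \<zeta> qB t\<bar> + \<bar>- smear \<alpha> \<zeta>1 qB t\<bar> \<le>
        e * exp (2 * t)"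
      using t(1) by auto
  qed
  then show ?thesis by (simp add: \<zeta>_def qY_def[abs_def])
qed

section \<open>Convolution\<close>

definition test_kernel :: "real \<Rightarrow> ('a::euclidean_space \<Rightarrow> real) \<Rightarrow> bool" where
  "test_kernel d \<phi> \<longleftrightarrow> (\<forall>n. C_diff n \<phi>) \<and> (\<forall>y. norm y > d \<longrightarrow> \<phi> y = 0)"

lemma test_kernelD:
  assumes "test_kernel d \<phi>"
  shows "C_diff n \<phi>" "norm y > d \<Longrightarrow> \<phi> y = 0" "continuous_on S \<phi>" "\<phi> differentiable (at y)"
proof -
  have C: "C_diff n \<phi>" for n using assms by (simp add: test_kernel_def)
  then show "C_diff n \<phi>" .
  show "norm y > d \<Longrightarrow> \<phi> y = 0" using assms by (simp add: test_kernel_def)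
  show "continuous_on S \<phi>" using C_diff_continuous[OF C[of 0]] continuous_on_subset by blast
  show "\<phi> differentiable (at y)" using C[of 1] by simp
qed

lemma test_kernel_compact_supp: "test_kernel d \<phi> \<Longrightarrow> compact_supp \<phi>"
  by (rule compact_suppI[of _ d]) (auto dest: test_kernelD)

lemma dir_deriv_eq_0:
  fixes \<phi> :: "'a::euclidean_space \<Rightarrow> real"
  assumes "open S" "x \<in> S" "\<And>y. y \<in> S \<Longrightarrow> \<phi> y = 0"
  shows "dir_deriv v \<phi> x = 0"
proof -
  have "((\<lambda>x. 0::real) has_derivative (\<lambda>v. 0)) (at x)" by simp
  then have "(\<phi> has_derivative (\<lambda>v. 0)) (at x)"
    by (rule has_derivative_transform_within_open[OF _ assms(1,2)]) (simp add: assms(3))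
  then show ?thesis by (rule dir_deriv_eq)
qed

lemma test_kernel_dir_deriv:
  assumes "test_kernel d \<phi>"
  shows "test_kernel d (dir_deriv v \<phi>)"
  unfolding test_kernel_def
proof (intro conjI allI impI)
  show "C_diff n (dir_deriv v \<phi>)" for n by (rule C_diff_dir_deriv) (rule test_kernelD(1)[OF assms])
  fix y :: 'a assume y: "norm y > d"
  have "open {y::'a. norm y > d}" by (intro open_Collect_less continuous_intros)
  then show "dir_deriv v \<phi> y = 0"
    by (rule dir_deriv_eq_0) (use y test_kernelD(2)[OF assms] in auto)
qed

definition convolution :: "('a::euclidean_space \<Rightarrow> real) \<Rightarrow> ('a \<Rightarrow> real) \<Rightarrow> 'a \<Rightarrow> real" where
  "convolution f \<phi> x = (LINT y|lborel. f y * \<phi> (x - y))"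

lemma convolution_alt:
  assumes "continuous_on UNIV f" "continuous_on UNIV \<phi>"
  shows "convolution f \<phi> x = (LINT y|lborel. f (x - y) * \<phi> y)"
proof -
  have "continuous_on UNIV (\<lambda>y. f (x - y) * \<phi> y)"
    by (intro continuous_intros assms continuous_on_compose2[OF assms(1)]) auto
  from lborel_integral_reflect[OF this, of x] show ?thesis by (simp add: convolution_def)
qed

lemma convolution_integrable:
  assumes "continuous_on UNIV f" "test_kernel d \<phi>"
  shows "integrable lborel (\<lambda>y. f y * \<phi> (x - y))"
proof (rule integrable_compact_support[where r="norm x + d"])
  show "continuous_on UNIV (\<lambda>y. f y * \<phi> (x - y))"
    by (intro continuous_intros assms(1) continuous_on_compose2[OF test_kernelD(3)[OF assms(2), of UNIV]]) auto
  fix y :: 'a assume "norm y > norm x + d"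
  then have "norm (x - y) > d" using norm_triangle_ineq2[of y x] by (simp add: norm_minus_commute)
  then show "f y * \<phi> (x - y) = 0" using test_kernelD(2)[OF assms(2)] by simp
qed

text \<open>All derivatives fall on the kernel, so continuity of f suffices. For y in
  \<open>ball x 1\<close> the integrand lives in a fixed box, where the Leibniz rule
  applies.\<close>

lemma convolution_has_derivative:
  fixes f \<phi> :: "'a::euclidean_space \<Rightarrow> real"
  assumes f: "continuous_on UNIV f" and \<phi>: "test_kernel d \<phi>"
  shows "(convolution f \<phi> has_derivative (\<lambda>v. \<Sum>b\<in>Basis. (v \<bullet> b) * convolution f (dir_deriv b \<phi>) x)) (at x)"
proof -
  define r where "r = norm x + 1 + d"
  let ?C = "cbox (- (r *\<^sub>R One)) (r *\<^sub>R One) :: 'a set"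
  have cbox: "convolution f \<psi> y = integral ?C (\<lambda>z. f z * \<psi> (y - z))" if "test_kernel d \<psi>" "y \<in> ball x 1" for \<psi> y
    unfolding convolution_def
  proof (rule lborel_integral_eq_cbox)
    show "continuous_on UNIV (\<lambda>z. f z * \<psi> (y - z))"
      by (intro continuous_intros f continuous_on_compose2[OF test_kernelD(3)[OF that(1), of UNIV]]) auto
    fix z :: 'a assume "norm z > r"
    moreover have "norm y \<le> norm x + 1"
      using that(2) norm_triangle_ineq2[of y x] by (simp add: dist_norm norm_minus_commute)
    moreover have "norm z - norm y \<le> norm (y - z)"
      using norm_triangle_ineq2[of z y] by (simp add: norm_minus_commute)
    ultimately have "norm (y - z) > d" by (simp add: r_def)
    then show "f z * \<psi> (y - z) = 0" using test_kernelD(2)[OF that(1)] by simp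
  qed
  let ?g = "\<lambda>z. \<Sum>b\<in>Basis. dir_deriv b \<phi> z *\<^sub>R b"
  have g: "continuous_on S ?g" for S
    by (intro continuous_intros test_kernelD(3)[OF test_kernel_dir_deriv[OF \<phi>]])
  \<comment> \<open>\<open>leibniz_rule\<close> takes the derivative as a bounded linear function;
    the inner product with the gradient of the kernel supplies it, continuously in both
    variables.\<close>
  let ?fx = "\<lambda>y z. blinfun_inner_right (f z *\<^sub>R ?g (y - z))"
  have fx_apply: "blinfun_apply (?fx y z) v = f z * (\<Sum>b\<in>Basis. (v \<bullet> b) * dir_deriv b \<phi> (y - z))" for y z v
    by (simp add: inner_sum_left inner_commute[of v] mult.commute[of "dir_deriv _ _ _"])
  have "((\<lambda>y. integral ?C (\<lambda>z. f z * \<phi> (y - z))) has_derivative blinfun_apply (integral ?C (?fx x))) (at x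
      within ball x 1)"
  proof (rule leibniz_rule)
    fix y z :: 'a
    have "((\<lambda>y. \<phi> (y - z)) has_derivative (\<lambda>v. dir_deriv v \<phi> (y - z))) (at y)"
      by (rule has_derivative_compose[OF _ has_derivative_dir_deriv[OF test_kernelD(4)[OF \<phi>]]])
         (auto intro!: derivative_eq_intros)
    then have "((\<lambda>y. f z * \<phi> (y - z)) has_derivative (\<lambda>v. f z * dir_deriv v \<phi> (y - z))) (at y)"
      by (rule has_derivative_mult_right)
    moreover have "(\<lambda>v. f z * dir_deriv v \<phi> (y - z)) = blinfun_apply (?fx y z)"
      unfolding fx_apply by (intro ext) (subst dir_deriv_Basis_sum[OF test_kernelD(4)[OF \<phi>]], rule refl)
    ultimately show "((\<lambda>y. f z * \<phi> (y - z)) has_derivative blinfun_apply (?fx y z)) (at y within ball x 1)"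
      by (simp only: has_derivative_at_withinI)
  next
    fix y :: 'a show "(\<lambda>z. f z * \<phi> (y - z)) integrable_on ?C"
      by (intro integrable_continuous continuous_intros continuous_on_subset[OF f]
          continuous_on_compose2[OF test_kernelD(3)[OF \<phi>, of UNIV]]) auto
  next
    show "continuous_on (ball x 1 \<times> ?C) (\<lambda>(y, z). ?fx y z)"
      unfolding case_prod_unfold
      by (intro bounded_linear.continuous_on[OF bounded_linear_blinfun_inner_right] continuous_on_scaleR
          continuous_on_compose2[OF f] continuous_on_compose2[OF g[of UNIV]] continuous_intros) auto
  qed auto
  then have "((\<lambda>y. integral ?C (\<lambda>z. f z * \<phi> (y - z))) has_derivative blinfun_apply (integral ?C (?fx x))) (at x)"
    by (simp add: at_within_open[of x "ball x 1"])
  then have 1: "(convolution f \<phi> has_derivative blinfun_apply (integral ?C (?fx x))) (at x)"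
    by (rule has_derivative_transform_within_open[of _ _ _ _ "ball x 1"]) (simp_all add: cbox[OF \<phi>])
  have "blinfun_apply (integral ?C (?fx x)) v = (\<Sum>b\<in>Basis. (v \<bullet> b) * convolution f (dir_deriv b \<phi>) x)" for v
  proof -
    have "?fx x integrable_on ?C"
      by (intro integrable_continuous bounded_linear.continuous_on[OF bounded_linear_blinfun_inner_right]
          continuous_on_scaleR
          continuous_on_subset[OF f] continuous_on_compose2[OF g[of UNIV]] continuous_intros) auto
    then have "blinfun_apply (integral ?C (?fx x)) v = integral ?C (\<lambda>z. \<Sum>b\<in>Basis. (v \<bullet> b) * (f z * dir_deriv b
        \<phi> (x - z)))"
      unfolding blinfun_apply_integral[OF \<open>?fx x integrable_on ?C\<close>] fx_apply
      by (simp add: sum_distrib_left ac_simps)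
    also have "\<dots> = (\<Sum>b\<in>Basis. integral ?C (\<lambda>z. (v \<bullet> b) * (f z * dir_deriv b \<phi> (x - z))))"
      by (intro integral_sum finite_Basis integrable_continuous continuous_intros continuous_on_subset[OF f]
          continuous_on_compose2[OF test_kernelD(3)[OF test_kernel_dir_deriv[OF \<phi>], of UNIV]]) auto
    also have "\<dots> = (\<Sum>b\<in>Basis. (v \<bullet> b) * convolution f (dir_deriv b \<phi>) x)"
      by (intro sum.cong refl) (simp add: cbox[OF test_kernel_dir_deriv[OF \<phi>]])
    finally show ?thesis .
  qed
  then show ?thesis using 1 by presburger
qed

lemma convolution_continuous:
  assumes "continuous_on UNIV f" "test_kernel d \<phi>"
  shows "continuous_on S (convolution f \<phi>)"
  using convolution_has_derivative[OF assms]
  by (meson continuous_at_imp_continuous_on has_derivative_continuous)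

section \<open>Gradient and Hessian of a convolution\<close>

definition conv_grad :: "((real^'m) \<times> (real^'k) \<Rightarrow> real) \<Rightarrow> ((real^'m) \<times> (real^'k) \<Rightarrow> real) \<Rightarrow> (real^'m) \<times>
    (real^'k) \<Rightarrow> (real^'m) \<times> (real^'k)" where
  "conv_grad f \<phi> x = (\<Sum>i\<in>UNIV. convolution f (dir_deriv (frame i) \<phi>) x *\<^sub>R frame i)"

definition conv_hess :: "((real^'m) \<times> (real^'k) \<Rightarrow> real) \<Rightarrow> ((real^'m) \<times> (real^'k) \<Rightarrow> real) \<Rightarrow> (real^'m) \<times>
    (real^'k) \<Rightarrow> (real^'m) \<times> (real^'k) \<Rightarrow> (real^'m) \<times> (real^'k)" where
  "conv_hess f \<phi> x v = (\<Sum>i\<in>UNIV. (conv_grad f (dir_deriv (frame i) \<phi>) x \<bullet> v) *\<^sub>R frame i)"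

lemma frame_inner: "frame (i :: 'm::finite + 'k::finite) \<bullet> frame j = (if i = j then 1 else 0)"
proof -
  have "inj (frame :: 'm + 'k \<Rightarrow> (real^'m) \<times> (real^'k))" by (rule bij_betw_imp_inj_on[OF bij_frame])
  then show ?thesis by (simp add: inner_Basis inj_eq)
qed

lemma conv_grad_inner: "conv_grad f \<phi> x \<bullet> frame i = convolution f (dir_deriv (frame i) \<phi>) x"
  by (simp add: conv_grad_def inner_sum_left frame_inner sum.delta if_distrib cong: if_cong)

lemma convolution_has_gradient:
  assumes "continuous_on UNIV f" "test_kernel d \<phi>"
  shows "(convolution f \<phi> has_derivative (\<lambda>v. conv_grad f \<phi> x \<bullet> v)) (at x)"
proof -
  have "(\<Sum>b\<in>Basis. (v \<bullet> b) * convolution f (dir_deriv b \<phi>) x) = conv_grad f \<phi> x \<bullet> v" for v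
    by (simp add: sum_Basis_frame inner_frame[of "conv_grad f \<phi> x" v] conv_grad_inner mult.commute)
  then show ?thesis using convolution_has_derivative[OF assms, of x] by simp
qed

lemma conv_grad_has_derivative:
  assumes "continuous_on UNIV f" "test_kernel d \<phi>"
  shows "(conv_grad f \<phi> has_derivative conv_hess f \<phi> x) (at x)"
  unfolding conv_grad_def[abs_def] conv_hess_def[abs_def]
  by (intro has_derivative_sum has_derivative_scaleR_left convolution_has_gradient[OF assms(1)
      test_kernel_dir_deriv[OF assms(2)], unfolded conv_grad_def])

lemma conv_grad_continuous:
  assumes "continuous_on UNIV f" "test_kernel d \<phi>"
  shows "continuous_on S (conv_grad f \<phi>)"
  unfolding conv_grad_def by (intro continuous_intros convolution_continuous[OF assms(1)
      test_kernel_dir_deriv[OF assms(2)]])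

lemma conv_hess_continuous:
  assumes "continuous_on UNIV f" "test_kernel d \<phi>"
  shows "continuous_on S (\<lambda>x. conv_hess f \<phi> x v)"
  unfolding conv_hess_def by (intro continuous_intros conv_grad_continuous[OF assms(1)
      test_kernel_dir_deriv[OF assms(2)]])

lemma conv_hess_inner: "conv_hess f \<phi> x v \<bullet> frame i = conv_grad f (dir_deriv (frame i) \<phi>) x \<bullet> v"
  by (simp add: conv_hess_def inner_sum_left frame_inner sum.delta if_distrib cong: if_cong)

text \<open>Both derivatives fall on the kernel, so symmetry is inherited from
  \<open>dir_deriv_commute\<close>.\<close>

lemma conv_hess_symmetric:
  fixes \<phi> :: "(real^'a) \<times> (real^'b) \<Rightarrow> real"
  assumes "test_kernel d \<phi>"
  shows "conv_hess f \<phi> x v \<bullet> w = conv_hess f \<phi> x w \<bullet> v"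
proof -
  have c: "dir_deriv a (dir_deriv b \<phi>) = dir_deriv b (dir_deriv a \<phi>)" for a b
    using dir_deriv_commute[OF test_kernelD(1)[OF assms]] by (simp add: fun_eq_iff)
  let ?C = "\<lambda>i j. convolution f (dir_deriv (frame j) (dir_deriv (frame i) \<phi>)) x"
  have e: "conv_hess f \<phi> x v \<bullet> w = (\<Sum>i\<in>UNIV. \<Sum>j\<in>UNIV. ?C i j * (v \<bullet> frame j) * (w \<bullet> frame i))" for v w
  proof -
    have "conv_hess f \<phi> x v \<bullet> w = (\<Sum>i\<in>UNIV. (conv_grad f (dir_deriv (frame i) \<phi>) x \<bullet> v) * (w \<bullet> frame i))"
      by (subst inner_frame) (simp only: conv_hess_inner)
    also have "\<dots> = (\<Sum>i\<in>UNIV. \<Sum>j\<in>UNIV. ?C i j * (v \<bullet> frame j) * (w \<bullet> frame i))"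
    proof (rule sum.cong[OF refl])
      fix i :: "'a + 'b"
      have "conv_grad f (dir_deriv (frame i) \<phi>) x \<bullet> v = (\<Sum>j\<in>UNIV. ?C i j * (v \<bullet> frame j))"
        by (subst inner_frame) (simp only: conv_grad_inner)
      then show "(conv_grad f (dir_deriv (frame i) \<phi>) x \<bullet> v) * (w \<bullet> frame i) = (\<Sum>j\<in>UNIV. ?C i j * (v \<bullet> frame
          j) * (w \<bullet> frame i))"
        by (simp only: sum_distrib_right)
    qed
    finally show ?thesis .
  qed
  have "conv_hess f \<phi> x v \<bullet> w = (\<Sum>j\<in>UNIV. \<Sum>i\<in>UNIV. ?C i j * (v \<bullet> frame j) * (w \<bullet> frame i))"
    unfolding e by (rule sum.swap)
  also have "\<dots> = (\<Sum>j\<in>UNIV. \<Sum>i\<in>UNIV. ?C j i * (w \<bullet> frame i) * (v \<bullet> frame j))"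
  proof (intro sum.cong refl)
    fix i j :: "'a + 'b"
    show "?C i j * (v \<bullet> frame j) * (w \<bullet> frame i) = ?C j i * (w \<bullet> frame i) * (v \<bullet> frame j)"
      unfolding c[of "frame j" "frame i"] by (simp only: mult.assoc mult.commute[of "v \<bullet> frame j"])
  qed
  also have "\<dots> = conv_hess f \<phi> x w \<bullet> v" by (rule e[symmetric])
  finally show ?thesis .
qed

section \<open>The weak equation\<close>

definition X_coeff :: "real \<Rightarrow> 'm + 'k \<Rightarrow> (real^'m) \<times> (real^'k) \<Rightarrow> real" where
  "X_coeff \<alpha> i x = (case i of Inl a \<Rightarrow> 1 | Inr b \<Rightarrow> norm (fst x) powr \<alpha> / 2)"

lemma X_coeff_simps [simp]: "X_coeff \<alpha> (Inl a) x = 1" "X_coeff \<alpha> (Inr b) x = norm (fst x) powr \<alpha> / 2"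
  by (auto simp: X_coeff_def)

lemma X_coeff_X_coeff: "X_coeff \<alpha> i x * X_coeff \<alpha> i x = X_coeff_sq \<alpha> i x"
  by (cases i) (auto simp: powr_add[symmetric])

lemma continuous_X_coeff: "\<alpha> > 0 \<Longrightarrow> continuous_on S (X_coeff \<alpha> i)"
  by (cases i) (auto simp: X_coeff_def intro!: continuous_intros continuous_on_norm_fst_powr)

lemma X_field_X_coeff: "X_field \<alpha> i \<phi> x = X_coeff \<alpha> i x * dir_deriv (frame i) \<phi> x"
  by (cases i) auto

lemma dir_deriv_reflect:
  fixes K :: "'a::euclidean_space \<Rightarrow> real"
  assumes "\<And>z. K differentiable (at z)"
  shows "((\<lambda>y. K (x - y)) has_derivative (\<lambda>v. - dir_deriv v K (x - y))) (at y)"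
proof -
  have d: "(K has_derivative (\<lambda>v. dir_deriv v K (x - y))) (at (x - y))"
    by (rule has_derivative_dir_deriv[OF assms])
  have "((\<lambda>y. x - y) has_derivative (\<lambda>v. - v)) (at y)"
    by (auto intro!: derivative_eq_intros)
  from has_derivative_compose[OF this d] show ?thesis by (simp add: linear_neg[OF has_derivative_linear[OF d]])
qed

text \<open>Transfers the distributional identity to functions \<open>ft\<close>, \<open>gt\<close>
  that agree with f, g on S only. The test function is supported in S, so their values elsewhere do
  not matter.\<close>

lemma weak_X:
  fixes f g ft gt \<phi> :: "(real^'m) \<times> (real^'k) \<Rightarrow> real"
  assumes X: "has_X_deriv \<alpha> \<Omega> i f g" and S: "S \<subseteq> \<Omega>"
    and ft: "\<And>y. y \<in> S \<Longrightarrow> ft y = f y" and gt: "\<And>y. y \<in> S \<Longrightarrow> gt y = g y"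
    and \<phi>: "\<And>n. C_diff n \<phi>" and C: "compact C" "C \<subseteq> S" "\<And>y. y \<notin> C \<Longrightarrow> \<phi> y = 0"
  shows "(LINT y|lborel. ft y * (X_coeff \<alpha> i y * dir_deriv (frame i) \<phi> y)) = - (LINT y|lborel. gt y * \<phi> y)"
proof -
  have cl: "closure {x. \<phi> x \<noteq> 0} \<subseteq> C"
    using C(3) by (intro closure_minimal compact_imp_closed[OF C(1)]) auto
  have "compact (closure {x. \<phi> x \<noteq> 0})"
    using compact_Int_closed[OF C(1) closed_closure, of "{x. \<phi> x \<noteq> 0}"] cl by (simp add: Int_absorb1)
  then have "\<phi> \<in> test_functions \<Omega>"
    unfolding test_functions_def using \<phi> cl C(2) S by auto
  then have eq: "(LINT x:\<Omega>|lborel. f x * X_field \<alpha> i \<phi> x) = - (LINT x:\<Omega>|lborel. g x * \<phi> x)"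
    using X by (simp add: has_X_deriv_def)
  have d0: "dir_deriv (frame i) \<phi> y = 0" if "y \<notin> C" for y
    by (rule dir_deriv_eq_0[of "- C"]) (use that C(3) compact_imp_closed[OF C(1)] in \<open>simp_all add: open_Compl\<close>)
  have "indicator \<Omega> x *\<^sub>R (f x * X_field \<alpha> i \<phi> x) = ft x * (X_coeff \<alpha> i x * dir_deriv (frame i) \<phi> x)" for x
  proof (cases "x \<in> C")
    case True
    then have "x \<in> S" "x \<in> \<Omega>" using C(2) S by auto
    then show ?thesis by (simp add: X_field_X_coeff ft)
  qed (simp add: X_field_X_coeff d0)
  moreover have "indicator \<Omega> x *\<^sub>R (g x * \<phi> x) = gt x * \<phi> x" for x
  proof (cases "x \<in> C")
    case True
    then have "x \<in> S" "x \<in> \<Omega>" using C(2) S by auto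
    then show ?thesis by (simp add: gt)
  qed (simp add: C(3))
  ultimately show ?thesis using eq unfolding set_lebesgue_integral_def by (simp only:)
qed

text \<open>The test function is \<pi>(y) \<xi>(x - y). Reflection of \<xi> produces a minus sign
  that cancels the one of the formal adjoint, and \<pi>, constant along \<open>frame i\<close>,
  passes through the derivative.\<close>

lemma weak_X_test_kernel:
  fixes f g ft gt \<xi> \<pi> :: "(real^'m) \<times> (real^'k) \<Rightarrow> real"
  assumes X: "has_X_deriv \<alpha> \<Omega> i f g" and S: "S \<subseteq> \<Omega>"
    and ft: "\<And>y. y \<in> S \<Longrightarrow> ft y = f y" and gt: "\<And>y. y \<in> S \<Longrightarrow> gt y = g y"
    and \<xi>: "test_kernel d \<xi>" and x: "cball x d \<subseteq> S"
    and \<pi>: "\<And>n. C_diff n \<pi>" "\<And>y. dir_deriv (frame i) \<pi> y = 0"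
  shows "(LINT y|lborel. ft y * (X_coeff \<alpha> i y * (\<pi> y * dir_deriv (frame i) \<xi> (x - y)))) =
      (LINT y|lborel. gt y * (\<pi> y * \<xi> (x - y)))"
proof -
  let ?\<phi> = "\<lambda>y. \<pi> y * \<xi> (x - y)"
  have "bounded_linear (\<lambda>y::(real^'m) \<times> (real^'k). - y)" by (simp add: bounded_linear_minus bounded_linear_ident)
  from C_diff_affine[OF this test_kernelD(1)[OF \<xi>], of _ x]
  have "C_diff n (\<lambda>y. \<xi> (x - y))" for n by simp
  then have C: "C_diff n ?\<phi>" for n by (intro C_diff_mult \<pi>)
  have \<pi>d: "\<pi> differentiable (at y)" for y using \<pi>(1)[of 1] by (simp only: One_nat_def C_diff.simps)
  have d: "dir_deriv (frame i) ?\<phi> y = - (\<pi> y * dir_deriv (frame i) \<xi> (x - y))" for y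
    using dir_deriv_eq[OF has_derivative_mult[OF has_derivative_dir_deriv[OF \<pi>d] dir_deriv_reflect[OF
        test_kernelD(4)[OF \<xi>]]], of "frame i"]
    by (simp add: \<pi>(2))
  have "(LINT y|lborel. ft y * (X_coeff \<alpha> i y * dir_deriv (frame i) ?\<phi> y)) = - (LINT y|lborel. gt y * ?\<phi> y)"
  proof (rule weak_X[OF X S ft gt C, of "cball x d"])
    fix y assume "y \<notin> cball x d"
    then show "\<pi> y * \<xi> (x - y) = 0" using test_kernelD(2)[OF \<xi>, of "x - y"] by (simp add: dist_norm)
  qed (use x in auto)
  then show ?thesis by (simp add: d)
qed

lemma weak_first:
  fixes f g ft gt K :: "(real^'m) \<times> (real^'k) \<Rightarrow> real"
  assumes X: "has_X_deriv \<alpha> \<Omega> i f g" and S: "S \<subseteq> \<Omega>"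
    and ft: "\<And>y. y \<in> S \<Longrightarrow> ft y = f y" and gt: "\<And>y. y \<in> S \<Longrightarrow> gt y = g y"
    and K: "test_kernel d K" and x: "cball x d \<subseteq> S"
  shows "(LINT y|lborel. ft y * (X_coeff \<alpha> i y * dir_deriv (frame i) K (x - y))) = convolution gt K x"
proof -
  have "dir_deriv (frame i) (\<lambda>y. 1) y = 0" for y by (rule dir_deriv_eq) simp
  from weak_X_test_kernel[OF X S ft gt K x C_diff_const this] show ?thesis by (simp add: convolution_def)
qed

text \<open>
  The product of a test function with \<open>|z|\<^sup>\<alpha>\<close> need not be smooth, so the second distributional derivative
  cannot be unfolded by testing the first one with \<open>X\<^sub>i \<phi>\<close>. Polynomials in \<open>z\<close> that approximate the coefficient
  commute with \<open>X\<^sub>i\<close> and keep the test function smooth.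
\<close>

lemma X_coeff_approx:
  fixes x :: "(real^'m) \<times> (real^'k)"
  assumes "\<alpha> > 0"
  shows "\<exists>\<pi>. (\<forall>n. C_diff n \<pi>) \<and> (\<forall>y. dir_deriv (frame i) \<pi> y = 0) \<and>
      (\<forall>y\<in>cball x d. \<bar>X_coeff \<alpha> i y - \<pi> y\<bar> < inverse (real (Suc N)))"
proof (cases i)
  case (Inl a)
  have "dir_deriv (frame i) (\<lambda>y. 1) y = 0" for y by (rule dir_deriv_eq) simp
  then show ?thesis using Inl C_diff_const by (intro exI[of _ "\<lambda>y. 1"]) auto
next
  case (Inr b)
  have "continuous_on (cball (fst x) d) (\<lambda>z. norm z powr \<alpha> / 2)"
    using assms by (intro continuous_on_divide continuous_on_powr' continuous_intros) auto
  then obtain q where q: "real_polynomial_function q" "\<And>z. z \<in> cball (fst x) d \<Longrightarrow>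
      \<bar>norm z powr \<alpha> / 2 - q z\<bar> < inverse (real (Suc N))"
    using Stone_Weierstrass_real_polynomial_function[of "cball (fst x) d" _ "inverse (real (Suc N))"] by auto
  let ?\<pi> = "\<lambda>y::(real^'m) \<times> (real^'k). q (fst y)"
  have qC: "C_diff n q" for n by (rule C_diff_real_polynomial[OF q(1)])
  have "C_diff n ?\<pi>" for n
    using C_diff_affine[OF bounded_linear_fst qC, where c=0 and n=n] by simp
  moreover have "dir_deriv (frame i) ?\<pi> y = 0" for y
    by (simp add: dir_deriv_def Inr)
  moreover have "\<bar>X_coeff \<alpha> i y - ?\<pi> y\<bar> < inverse (real (Suc N))" if "y \<in> cball x d" for y
    using q(2)[of "fst y"] that dist_fst_le[of x y] by (simp add: Inr)
  ultimately show ?thesis by blast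
qed

text \<open>The relation between f and g is tested with the kernel \<open>?\<xi>\<close> and the
  factor \<pi> N. As N grows, \<pi> N becomes the coefficient of X_i, and the right-hand side
  becomes g tested against X_i of the kernel, which \<open>weak_first\<close> converts into
  h.\<close>

lemma weak_second:
  fixes f g h ft gt ht K :: "(real^'m) \<times> (real^'k) \<Rightarrow> real"
  assumes \<alpha>: "\<alpha> > 0" and Xf: "has_X_deriv \<alpha> \<Omega> i f g" and Xg: "has_X_deriv \<alpha> \<Omega> i g h" and S: "S \<subseteq> \<Omega>"
    and ft: "\<And>y. y \<in> S \<Longrightarrow> ft y = f y" and gt: "\<And>y. y \<in> S \<Longrightarrow> gt y = g y" and ht: "\<And>y. y \<in> S \<Longrightarrow> ht y = h y"
    and cont: "continuous_on UNIV ft" "continuous_on UNIV gt"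
    and K: "test_kernel d K" and x: "cball x d \<subseteq> S"
  shows "convolution (\<lambda>y. ft y * X_coeff_sq \<alpha> i y) (dir_deriv (frame i) (dir_deriv (frame i) K)) x = convolution ht K x"
proof -
  let ?\<xi> = "dir_deriv (frame i) K"
  have \<xi>: "test_kernel d ?\<xi>" by (rule test_kernel_dir_deriv[OF K])
  obtain \<pi> where \<pi>: "\<And>N n. C_diff n (\<pi> N)" "\<And>N y. dir_deriv (frame i) (\<pi> N) y = 0"
      "\<And>N y. y \<in> cball x d \<Longrightarrow> \<bar>X_coeff \<alpha> i y - \<pi> N y\<bar> < inverse (real (Suc N))"
    using X_coeff_approx[OF \<alpha>, of i x d] by metis
  \<comment> \<open>The functions \<pi> N are close to the coefficient only on the ball, but the
    ball carries the support of \<psi> (x - y); there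
    \<open>\<bar>X_coeff \<alpha> i y\<bar> + 1\<close> dominates them.\<close>
  have lim: "(\<lambda>N. LINT y|lborel. w y * (\<pi> N y * \<psi> (x - y))) \<longlonglongrightarrow> (LINT y|lborel. w y * (X_coeff \<alpha> i y * \<psi> (x - y)))"
    if w: "continuous_on UNIV w" and \<psi>: "test_kernel d \<psi>" for w \<psi>
  proof (rule integral_dominated_convergence[where w="\<lambda>y. \<bar>(w y * (\<bar>X_coeff \<alpha> i y\<bar> + 1)) * \<psi> (x - y)\<bar>"])
    have c1: "continuous_on UNIV (\<lambda>y. w y * (\<bar>X_coeff \<alpha> i y\<bar> + 1))"
      by (intro continuous_intros w continuous_X_coeff \<alpha>)
    show "integrable lborel (\<lambda>y. \<bar>(w y * (\<bar>X_coeff \<alpha> i y\<bar> + 1)) * \<psi> (x - y)\<bar>)"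
      by (intro integrable_abs convolution_integrable[OF c1 \<psi>])
    have m: "continuous_on UNIV (\<lambda>y. w y * (q y * \<psi> (x - y)))" if "continuous_on UNIV q" for q
      by (intro continuous_intros w that continuous_on_compose2[OF test_kernelD(3)[OF \<psi>, of UNIV]]) auto
    show "(\<lambda>y. w y * (X_coeff \<alpha> i y * \<psi> (x - y))) \<in> borel_measurable lborel"
      using borel_measurable_continuous_onI[OF m[OF continuous_X_coeff[OF \<alpha>]]] by simp
    show "(\<lambda>y. w y * (\<pi> N y * \<psi> (x - y))) \<in> borel_measurable lborel" for N
      using borel_measurable_continuous_onI[OF m[OF C_diff_continuous[OF \<pi>(1)]]] by simp
    show "AE y in lborel. (\<lambda>N. w y * (\<pi> N y * \<psi> (x - y))) \<longlonglongrightarrow> w y * (X_coeff \<alpha> i y * \<psi> (x - y))"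
    proof (rule AE_I2)
      fix y
      show "(\<lambda>N. w y * (\<pi> N y * \<psi> (x - y))) \<longlonglongrightarrow> w y * (X_coeff \<alpha> i y * \<psi> (x - y))"
      proof (cases "y \<in> cball x d")
        case True
        have "(\<lambda>N. X_coeff \<alpha> i y - \<pi> N y) \<longlonglongrightarrow> 0"
          by (rule LIMSEQ_norm_0) (use \<pi>(3)[OF True] in \<open>simp add: inverse_eq_divide\<close>)
        from tendsto_diff[OF tendsto_const[of "X_coeff \<alpha> i y"] this]
        have "(\<lambda>N. \<pi> N y) \<longlonglongrightarrow> X_coeff \<alpha> i y" by simp
        then show ?thesis by (intro tendsto_intros)
      next
        case False
        then show ?thesis using test_kernelD(2)[OF \<psi>, of "x - y"] by (simp add: dist_norm)
      qed
    qed
    show "AE y in lborel. norm (w y * (\<pi> N y * \<psi> (x - y))) \<le> \<bar>(w y * (\<bar>X_coeff \<alpha> i y\<bar> + 1)) * \<psi> (x - y)\<bar>" for N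
    proof (rule AE_I2)
      fix y
      show "norm (w y * (\<pi> N y * \<psi> (x - y))) \<le> \<bar>(w y * (\<bar>X_coeff \<alpha> i y\<bar> + 1)) * \<psi> (x - y)\<bar>"
      proof (cases "y \<in> cball x d")
        case True
        have "inverse (real (Suc N)) \<le> 1" by (simp add: inverse_le_1_iff)
        then have "\<bar>\<pi> N y\<bar> \<le> \<bar>X_coeff \<alpha> i y\<bar> + 1" using \<pi>(3)[OF True, of N] by linarith
        then have "\<bar>w y\<bar> * (\<bar>\<pi> N y\<bar> * \<bar>\<psi> (x - y)\<bar>) \<le> \<bar>w y\<bar> * ((\<bar>X_coeff \<alpha> i y\<bar> + 1) * \<bar>\<psi> (x - y)\<bar>)"
          by (intro mult_left_mono mult_right_mono) auto
        then show ?thesis by (simp add: abs_mult mult.assoc)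
      next
        case False
        then show ?thesis using test_kernelD(2)[OF \<psi>, of "x - y"] by (simp add: dist_norm)
      qed
    qed
  qed
  have ftc: "continuous_on UNIV (\<lambda>y. ft y * X_coeff \<alpha> i y)"
    by (intro continuous_intros cont continuous_X_coeff \<alpha>)
  have "(LINT y|lborel. (ft y * X_coeff \<alpha> i y) * (\<pi> N y * dir_deriv (frame i) ?\<xi> (x - y))) =
      (LINT y|lborel. gt y * (\<pi> N y * ?\<xi> (x - y)))" for N
    using weak_X_test_kernel[OF Xf S ft gt \<xi> x \<pi>(1,2)] by (simp add: mult.assoc)
  with lim[OF ftc test_kernel_dir_deriv[OF \<xi>, of "frame i"]] lim[OF cont(2) \<xi>]
  have "(LINT y|lborel. (ft y * X_coeff \<alpha> i y) * (X_coeff \<alpha> i y * dir_deriv (frame i) ?\<xi> (x - y))) =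
      (LINT y|lborel. gt y * (X_coeff \<alpha> i y * ?\<xi> (x - y)))"
    using LIMSEQ_unique by fastforce
  also have "\<dots> = convolution ht K x"
    by (rule weak_first[OF Xg S gt ht K x])
  finally show ?thesis
    by (simp add: convolution_def mult.assoc X_coeff_X_coeff[symmetric])
qed

text \<open>The coefficient multiplies \<open>ft\<close> inside the convolution. This is not yet the
  operator applied to the convolution; the difference is the commutator treated in
  \<open>vertical_conv_rellich\<close>.\<close>

lemma convolution_equation:
  fixes f ft K :: "(real^'m) \<times> (real^'k) \<Rightarrow> real" and g h gt ht :: "'m + 'k \<Rightarrow> (real^'m) \<times> (real^'k) \<Rightarrow> real"
  assumes \<alpha>: "\<alpha> > 0" and X: "\<And>i. has_X_deriv \<alpha> \<Omega> i f (g i)" "\<And>i. has_X_deriv \<alpha> \<Omega> i (g i) (h i)" and S: "S \<subseteq> \<Omega>"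
    and eq: "\<And>y. y \<in> \<Omega> \<Longrightarrow> (\<Sum>i\<in>UNIV. h i y) = - \<kappa>\<^sup>2 * f y"
    and ft: "\<And>y. y \<in> S \<Longrightarrow> ft y = f y" and gt: "\<And>i y. y \<in> S \<Longrightarrow> gt i y = g i y" and ht: "\<And>i y. y \<in> S \<Longrightarrow> ht i y = h i y"
    and cont: "continuous_on UNIV ft" "\<And>i. continuous_on UNIV (gt i)" "\<And>i. continuous_on UNIV (ht i)"
    and K: "test_kernel d K" and x: "cball x d \<subseteq> S"
  shows "(\<Sum>i\<in>UNIV. convolution (\<lambda>y. ft y * X_coeff_sq \<alpha> i y) (dir_deriv (frame i) (dir_deriv (frame i) K)) x)
      = - \<kappa>\<^sup>2 * convolution ft K x"
proof -
  have "(\<Sum>i\<in>UNIV. convolution (\<lambda>y. ft y * X_coeff_sq \<alpha> i y) (dir_deriv (frame i) (dir_deriv (frame i) K)) x) =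
      (\<Sum>i\<in>UNIV. convolution (ht i) K x)"
    by (intro sum.cong refl weak_second[OF \<alpha> X S ft gt ht cont(1,2) K x])
  also have "\<dots> = (LINT y|lborel. (\<Sum>i\<in>UNIV. ht i y * K (x - y)))"
    unfolding convolution_def by (rule Bochner_Integration.integral_sum[symmetric])
        (rule convolution_integrable[OF cont(3) K])
  also have "\<dots> = (LINT y|lborel. - \<kappa>\<^sup>2 * (ft y * K (x - y)))"
  proof (rule Bochner_Integration.integral_cong[OF refl])
    fix y
    show "(\<Sum>i\<in>UNIV. ht i y * K (x - y)) = - \<kappa>\<^sup>2 * (ft y * K (x - y))"
    proof (cases "y \<in> cball x d")
      case True
      then have y: "y \<in> S" "y \<in> \<Omega>" using x S by auto
      show ?thesis using eq[OF y(2)] by (simp add: sum_distrib_right[symmetric] ht[OF y(1)] ft[OF y(1)])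
    next
      case False
      then show ?thesis using test_kernelD(2)[OF K, of "x - y"] by (simp add: dist_norm)
    qed
  qed
  also have "\<dots> = - \<kappa>\<^sup>2 * convolution ft K x" by (simp add: convolution_def)
  finally show ?thesis .
qed

section \<open>Mollification\<close>

lemma compact_supp_integral_eq_0:
  fixes w :: "'a::euclidean_space \<Rightarrow> real"
  assumes "compact_supp w" "\<And>x. w x \<ge> 0" "(LINT x|lborel. w x) = 0"
  shows "w x = 0"
proof -
  obtain r where c: "continuous_on UNIV w" and r: "\<And>x. norm x > r \<Longrightarrow> w x = 0"
    using assms(1) by (auto simp: compact_supp_def)
  define R where "R = max \<bar>r\<bar> (norm x) + 1"
  have R: "R > 0" "norm x < R" by (auto simp: R_def)
  let ?C = "cbox (- (R *\<^sub>R One)) (R *\<^sub>R One) :: 'a set"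
  have "(LINT x|lborel. w x) = integral ?C w"
    by (rule lborel_integral_eq_cbox[OF c]) (auto intro!: r simp: R_def)
  moreover have "w integrable_on ?C"
    by (rule integrable_continuous, rule continuous_on_subset[OF c]) simp
  ultimately have 0: "(w has_integral 0) ?C" using assms(3) integrable_integral[of w ?C] by simp
  have "0 \<in> box (- (R *\<^sub>R One)) (R *\<^sub>R One :: 'a)" using R by (simp add: mem_box)
  then have ne: "box (- (R *\<^sub>R One)) (R *\<^sub>R One) \<noteq> ({} :: 'a set)" by blast
  have "\<bar>x \<bullet> b\<bar> \<le> R" if "b \<in> Basis" for b
    using Basis_le_norm[OF that, of x] R by linarith
  then have x: "x \<in> ?C" by (auto simp: mem_box abs_le_iff minus_le_iff)
  show ?thesis
    by (rule has_integral_0_cbox_imp_0[OF continuous_on_subset[OF c subset_UNIV] assms(2) 0 ne x])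
qed

lemma integral_bump_pos:
  assumes "d > 0"
  shows "(LINT x|lborel. bump d (x :: 'a::euclidean_space)) > 0"
proof -
  have "bump d (0 :: 'a) > 0" using bump_pos[OF assms, of "0 :: 'a"] assms by simp
  then have "(LINT x|lborel. bump d (x :: 'a)) \<noteq> 0"
    using compact_supp_integral_eq_0[OF compact_supp_bump[OF assms] bump_nonneg, of "0 :: 'a"] by auto
  moreover have "(LINT x|lborel. bump d (x :: 'a)) \<ge> 0"
    by (intro integral_nonneg_AE AE_I2 bump_nonneg)
  ultimately show ?thesis by simp
qed

text \<open>Dividing r by the dimension fits the cube on which \<open>bump\<close> is positive into
  the ball of radius r.\<close>

definition mollifier :: "real \<Rightarrow> 'a::euclidean_space \<Rightarrow> real" where
  "mollifier r x = bump (r / DIM('a)) x / (LINT y|lborel. bump (r / DIM('a)) (y :: 'a))"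

lemma mollifier:
  assumes r: "r > 0"
  shows "test_kernel r (mollifier r :: 'a::euclidean_space \<Rightarrow> real)" "mollifier r (x :: 'a) \<ge> 0"
    "(LINT x|lborel. mollifier r (x :: 'a)) = 1"
proof -
  let ?d = "r / DIM('a)"
  have d: "?d > 0" using r by simp
  note pos = integral_bump_pos[OF d, where 'a='a]
  have "C_diff n (\<lambda>x::'a. bump ?d x * (1 / (LINT y|lborel. bump ?d (y :: 'a))))" for n
    by (rule C_diff_mult[OF C_diff_bump C_diff_const])
  moreover have "bump ?d y = 0" if "norm y > r" for y :: 'a
    by (rule bump_eq_0[OF d]) (use that in simp)
  ultimately show "test_kernel r (mollifier r :: 'a \<Rightarrow> real)"
    by (simp add: test_kernel_def mollifier_def[abs_def])
  show "mollifier r (x :: 'a) \<ge> 0"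
    using bump_nonneg[of ?d x] pos by (simp add: mollifier_def)
  show "(LINT x|lborel. mollifier r (x :: 'a)) = 1"
    using pos by (simp add: mollifier_def)
qed

section \<open>Tensor kernels and averaging in \<sigma>\<close>

definition tensor :: "((real^'m) \<Rightarrow> real) \<Rightarrow> ((real^'k) \<Rightarrow> real) \<Rightarrow> (real^'m) \<times> (real^'k) \<Rightarrow> real" where
  "tensor a \<theta> x = a (fst x) * \<theta> (snd x)"

lemma test_kernel_tensor:
  fixes a :: "(real^'m) \<Rightarrow> real" and \<theta> :: "(real^'k) \<Rightarrow> real"
  assumes "test_kernel r a" "test_kernel s \<theta>"
  shows "test_kernel (r + s) (tensor a \<theta>)"
  unfolding test_kernel_def
proof (intro conjI allI impI)
  fix n
  have "C_diff n (\<lambda>x::(real^'m) \<times> (real^'k). a (0 + fst x) * \<theta> (0 + snd x))"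
    by (intro C_diff_mult C_diff_affine bounded_linear_fst bounded_linear_snd test_kernelD(1)[OF assms(1)]
        test_kernelD(1)[OF assms(2)])
  then show "C_diff n (tensor a \<theta>)" by (simp add: tensor_def[abs_def])
next
  fix y :: "(real^'m) \<times> (real^'k)" assume y: "norm y > r + s"
  have "norm y \<le> norm (fst y) + norm (snd y)" by (metis norm_Pair_le prod.collapse)
  then have "norm (fst y) > r \<or> norm (snd y) > s" using y by linarith
  then show "tensor a \<theta> y = 0" using test_kernelD(2)[OF assms(1)] test_kernelD(2)[OF assms(2)]
      by (auto simp: tensor_def)
qed

text \<open>Derivatives in \<sigma> leave the factor in z untouched, so they cost nothing while that
  factor concentrates.\<close>

lemma dir_deriv_tensor:
  fixes a :: "(real^'m) \<Rightarrow> real" and \<theta> :: "(real^'k) \<Rightarrow> real"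
  assumes "test_kernel s \<theta>"
  shows "dir_deriv (frame (Inr b)) (tensor a \<theta>) = tensor a (dir_deriv (axis b 1) \<theta>)"
proof
  fix x :: "(real^'m) \<times> (real^'k)"
  have "((\<lambda>t. \<theta> (snd x + t *\<^sub>R axis b 1)) has_real_derivative dir_deriv (axis b 1) \<theta> (snd x)) (at 0)"
    by (rule has_real_derivative_line) (use has_derivative_dir_deriv[OF test_kernelD(4)[OF assms]] in simp)
  from DERIV_cmult[OF this, of "a (fst x)"]
  show "dir_deriv (frame (Inr b)) (tensor a \<theta>) x = tensor a (dir_deriv (axis b 1) \<theta>) x"
    by (simp add: dir_deriv_def[of _ "tensor a \<theta>"] tensor_def DERIV_imp_deriv)
qed

text \<open>
  Averaging in \<open>\<sigma>\<close> alone commutes with the operator, since its coefficients depend only on \<open>z\<close>. The kernel can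
  therefore stay fixed in \<open>\<sigma>\<close> while the scale in \<open>z\<close> tends to \<open>0\<close>, and the commutator with
  \<open>|z|\<^bsup>2\<alpha>\<^esup>\<close> vanishes in the limit, as the derivatives it involves only act on the fixed factor.
\<close>

definition vertical_conv :: "((real^'m) \<times> (real^'k) \<Rightarrow> real) \<Rightarrow> ((real^'k) \<Rightarrow> real) \<Rightarrow> (real^'m) \<times> (real^'k) \<Rightarrow> real" where
  "vertical_conv w \<theta> x = (LINT s|lborel. w (fst x, snd x - s) * \<theta> s)"

lemma vertical_conv_continuous:
  assumes w: "continuous_on UNIV w" and "test_kernel d \<theta>"
  shows "continuous_on S (vertical_conv w \<theta>)"
proof -
  have \<theta>: "continuous_on S \<theta>" for S by (rule test_kernelD(3)[OF assms(2)])
  let ?C = "cbox (- (d *\<^sub>R One)) (d *\<^sub>R One) :: (real^'b) set"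
  have "vertical_conv w \<theta> x = integral ?C (\<lambda>s. w (fst x, snd x - s) * \<theta> s)" for x
    unfolding vertical_conv_def
    by (rule lborel_integral_eq_cbox)
       (auto intro!: continuous_intros \<theta> continuous_on_compose2[OF w] simp: test_kernelD(2)[OF assms(2)])
  moreover have "continuous_on UNIV (\<lambda>x. integral ?C (\<lambda>s. w (fst x, snd x - s) * \<theta> s))"
    unfolding case_prod_unfold
    by (rule integral_continuous_on_param)
       (auto simp: case_prod_unfold intro!: continuous_intros continuous_on_compose2[OF \<theta>[of UNIV]]
           continuous_on_compose2[OF w])
  ultimately have "continuous_on UNIV (vertical_conv w \<theta>)" by presburger
  then show ?thesis using continuous_on_subset by blast
qed

text \<open>Fubini: convolving with the tensor kernel amounts to averaging in \<sigma> and then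
  mollifying the outcome in z.\<close>

lemma convolution_tensor:
  assumes w: "continuous_on UNIV w" and a: "test_kernel r a" and \<theta>: "test_kernel d \<theta>"
  shows "convolution w (tensor a \<theta>) x = (LINT z|lborel. a z * vertical_conv w \<theta> (fst x - z, snd x))"
proof -
  note t = test_kernel_tensor[OF a \<theta>]
  let ?f = "\<lambda>y. w (x - y) * tensor a \<theta> y"
  have "integrable lborel ?f"
  proof (rule integrable_compact_support[where r="r + d"])
    show "continuous_on UNIV ?f"
      by (intro continuous_intros test_kernelD(3)[OF t] continuous_on_compose2[OF w]) auto
    show "?f y = 0" if "norm y > r + d" for y using test_kernelD(2)[OF t that] by simp
  qed
  then have "integrable (lborel \<Otimes>\<^sub>M lborel) ?f" by (simp add: lborel_prod)
  from lborel_pair.integral_fst'[OF this]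
  have "(LINT z|lborel. LINT s|lborel. ?f (z, s)) = (LINT y|lborel. ?f y)" by (simp add: lborel_prod)
  moreover have "(LINT s|lborel. ?f (z, s)) = a z * vertical_conv w \<theta> (fst x - z, snd x)" for z
  proof -
    have "?f (z, s) = a z * (w (fst x - z, snd x - s) * \<theta> s)" for s
      by (simp add: tensor_def minus_prod_def)
    then show ?thesis by (simp add: vertical_conv_def)
  qed
  ultimately show ?thesis
    by (simp add: convolution_alt[OF w test_kernelD(3)[OF t]])
qed

lemma mollifier_integrable:
  assumes "r > 0" "continuous_on UNIV v"
  shows "integrable lborel (\<lambda>z::'a::euclidean_space. mollifier r z * v z)"
proof (rule integrable_compact_support[where r=r])
  note k = mollifier(1)[OF assms(1), where 'a='a]
  show "continuous_on UNIV (\<lambda>z::'a. mollifier r z * v z)"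
    by (intro continuous_intros test_kernelD(3)[OF k] assms)
  show "mollifier r z * v z = 0" if "norm z > r" for z :: 'a using test_kernelD(2)[OF k that] by simp
qed

lemma mollifier_average:
  fixes v :: "'a::euclidean_space \<Rightarrow> real"
  assumes r: "r > 0" and v: "continuous_on UNIV v" and B: "\<And>z. norm z \<le> r \<Longrightarrow> \<bar>v z - c\<bar> \<le> B"
  shows "\<bar>(LINT z|lborel. mollifier r z * v z) - c\<bar> \<le> B"
proof -
  note k = mollifier[OF r, where 'a='a]
  note i = mollifier_integrable[OF r, where 'a='a]
  have i1: "integrable lborel (\<lambda>z::'a. mollifier r z)" using i[of "\<lambda>_. 1"] by simp
  have iv: "continuous_on UNIV (\<lambda>z. v z - c)" by (intro continuous_intros v)
  have "(LINT z|lborel. mollifier r z * v z) - c = (LINT z|lborel. mollifier r z * v z) -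
      (LINT z|lborel. mollifier r (z::'a) * c)"
    by (simp add: k(3))
  also have "\<dots> = (LINT z|lborel. mollifier r z * (v z - c))"
    using i[OF v] i[of "\<lambda>_. c"] by (simp add: right_diff_distrib)
  finally have eq: "(LINT z|lborel. mollifier r z * v z) - c = (LINT z|lborel. mollifier r z * (v z - c))" .
  have "\<bar>LINT z|lborel. mollifier r z * (v z - c)\<bar> \<le> (LINT z|lborel. \<bar>mollifier r z * (v z - c)\<bar>)"
    using integral_norm_bound[of lborel "\<lambda>z. mollifier r z * (v z - c)"] by simp
  also have "\<dots> \<le> (LINT z|lborel. mollifier r (z::'a) * B)"
  proof (rule integral_mono)
    show "integrable lborel (\<lambda>z. \<bar>mollifier r z * (v z - c)\<bar>)" by (intro integrable_abs i iv)
    show "integrable lborel (\<lambda>z::'a. mollifier r z * B)" by (rule i) simp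
    fix z :: 'a
    show "\<bar>mollifier r z * (v z - c)\<bar> \<le> mollifier r z * B"
    proof (cases "norm z \<le> r")
      case True
      then show ?thesis using B[OF True] k(2)[of z] by (simp add: abs_mult mult_left_mono)
    next
      case False
      then show ?thesis using test_kernelD(2)[OF k(1), of z] by simp
    qed
  qed
  also have "\<dots> = B" by (simp add: k(3))
  finally show ?thesis by (simp add: eq)
qed

lemma convolution_tensor_limit:
  fixes w :: "(real^'m) \<times> (real^'k) \<Rightarrow> real"
  assumes w: "continuous_on UNIV w" and \<theta>: "test_kernel d \<theta>" and r: "r \<longlonglongrightarrow> 0" "\<And>n. 0 < r n" "\<And>n. r n \<le> 1"
  shows "(\<lambda>n. convolution w (tensor (mollifier (r n)) \<theta>) x) \<longlonglongrightarrow> vertical_conv w \<theta> x"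
    and "\<exists>B. \<forall>n x. norm x \<le> R \<longrightarrow> \<bar>convolution w (tensor (mollifier (r n)) \<theta>) x\<bar> \<le> B"
proof -
  have sc: "continuous_on UNIV (vertical_conv w \<theta>)" by (rule vertical_conv_continuous[OF w \<theta>])
  have v: "continuous_on UNIV (\<lambda>z. vertical_conv w \<theta> (fst x - z, snd x))" for x
    by (intro continuous_on_compose2[OF sc] continuous_intros) auto
  have eq: "convolution w (tensor (mollifier (r n)) \<theta>) x = (LINT z|lborel. mollifier (r n) z * vertical_conv w
      \<theta> (fst x - z, snd x))" for n x
    by (rule convolution_tensor[OF w mollifier(1)[OF r(2)] \<theta>])
  show "(\<lambda>n. convolution w (tensor (mollifier (r n)) \<theta>) x) \<longlonglongrightarrow> vertical_conv w \<theta> x"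
  proof (rule LIMSEQ_I)
    fix e :: real assume e: "e > 0"
    have "isCont (\<lambda>z. vertical_conv w \<theta> (fst x - z, snd x)) 0"
      using v[of x] by (simp add: continuous_on_eq_continuous_at)
    then obtain \<delta> where \<delta>: "\<delta> > 0" "\<And>z. norm z < \<delta> \<Longrightarrow> \<bar>vertical_conv w \<theta> (fst x - z, snd x) -
        vertical_conv w \<theta> x\<bar> < e / 2"
      using e by (auto simp: continuous_at_eps_delta dist_norm elim!: allE[of _ "e / 2"])
    obtain N where N: "\<And>n. n \<ge> N \<Longrightarrow> r n < \<delta>"
      using order_tendstoD(2)[OF r(1) \<delta>(1)] by (auto simp: eventually_sequentially)
    show "\<exists>N. \<forall>n\<ge>N. norm (convolution w (tensor (mollifier (r n)) \<theta>) x - vertical_conv w \<theta> x) < e"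
    proof (intro exI[of _ N] allI impI)
      fix n assume "N \<le> n"
      have "\<bar>convolution w (tensor (mollifier (r n)) \<theta>) x - vertical_conv w \<theta> x\<bar> \<le> e / 2"
        unfolding eq
      proof (rule mollifier_average[OF r(2) v])
        fix z :: "real^'m" assume "norm z \<le> r n"
        then have "norm z < \<delta>" using N[OF \<open>N \<le> n\<close>] by simp
        then show "\<bar>vertical_conv w \<theta> (fst x - z, snd x) - vertical_conv w \<theta> x\<bar> \<le> e / 2" using \<delta>(2) less_imp_le by blast
      qed
      then show "norm (convolution w (tensor (mollifier (r n)) \<theta>) x - vertical_conv w \<theta> x) < e" using e by simp
    qed
  qed
  have "bounded (vertical_conv w \<theta> ` cball 0 (R + 1))"
    by (intro compact_imp_bounded compact_continuous_image continuous_on_subset[OF sc]) auto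
  then obtain B where B: "\<And>y. norm y \<le> R + 1 \<Longrightarrow> \<bar>vertical_conv w \<theta> y\<bar> \<le> B"
    unfolding bounded_iff by (metis image_eqI mem_cball_0 real_norm_def)
  have "\<bar>convolution w (tensor (mollifier (r n)) \<theta>) x\<bar> \<le> B" if "norm x \<le> R" for n x
  proof -
    have "\<bar>(LINT z|lborel. mollifier (r n) z * vertical_conv w \<theta> (fst x - z, snd x)) - 0\<bar> \<le> B"
    proof (rule mollifier_average[OF r(2) v])
      fix z :: "real^'m" assume z: "norm z \<le> r n"
      have "(fst x - z, snd x) = x - (z, 0)" by (simp add: minus_prod_def)
      then have "norm (fst x - z, snd x) \<le> norm x + norm (z, 0 :: real^'k)"
        using norm_triangle_ineq4[of x "(z, 0)"] by simp
      also have "\<dots> \<le> R + 1" using that z r(3)[of n] by (simp add: norm_Pair)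
      finally show "\<bar>vertical_conv w \<theta> (fst x - z, snd x) - 0\<bar> \<le> B" using B by simp
    qed
    then show ?thesis by (simp add: eq)
  qed
  then show "\<exists>B. \<forall>n x. norm x \<le> R \<longrightarrow> \<bar>convolution w (tensor (mollifier (r n)) \<theta>) x\<bar> \<le> B" by blast
qed

section \<open>Passage to the limit in the radial integrals\<close>

lemma radial_integral_limit:
  fixes V :: "nat \<Rightarrow> (real^'m) \<times> (real^'k) \<Rightarrow> 'v::euclidean_space" and \<Phi> :: "((real^'m) \<times> (real^'k)) \<times> 'v \<Rightarrow> real"
  assumes \<alpha>: "\<alpha> > 0" and c: "compact_supp c" "\<And>s. s \<le> l0 \<Longrightarrow> c s = 0"
    and V: "\<And>n. continuous_on UNIV (V n)" and W: "continuous_on UNIV W"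
    and \<Phi>: "continuous_on ((- {0}) \<times> UNIV) \<Phi>"
    and lim: "\<And>x. x \<noteq> 0 \<Longrightarrow> log_gauge \<alpha> x > l0 \<Longrightarrow> (\<lambda>n. V n x) \<longlonglongrightarrow> W x"
    and bd: "\<And>r. \<exists>B. \<forall>n x. x \<noteq> 0 \<longrightarrow> log_gauge \<alpha> x > l0 \<longrightarrow> norm x \<le> r \<longrightarrow> norm (V n x) \<le> B"
  shows "(\<lambda>n. radial_integral \<alpha> c (\<lambda>x. \<Phi> (x, V n x))) \<longlonglongrightarrow> radial_integral \<alpha> c (\<lambda>x. \<Phi> (x, W x))"
proof -
  have "compact_supp (\<lambda>x :: (real^'m) \<times> (real^'k). radial \<alpha> c x * 1)" by (rule compact_supp_radial_mult[OF \<alpha> c(1)]) simp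
  then have radc: "compact_supp (radial \<alpha> c :: (real^'m) \<times> (real^'k) \<Rightarrow> real)" by simp
  then obtain r where r: "\<And>x :: (real^'m) \<times> (real^'k). norm x > r \<Longrightarrow> radial \<alpha> c x = 0" by (auto simp: compact_supp_def)
  obtain N :: "((real^'m) \<times> (real^'k)) set" where N: "open N" "0 \<in> N" "\<And>x. x \<in> N \<Longrightarrow> radial \<alpha> c x = 0"
    using radial_eq_0_near_0[OF \<alpha> c(1)] by (auto simp: eventually_nhds)
  \<comment> \<open>The weight lives on the compact set \<open>?C\<close>, away from the origin.
    \<Phi> is bounded on the product of \<open>?C\<close> with a ball containing all relevant values
    \<open>V n x\<close>, and this bound dominates the integrands.\<close>
  let ?C = "cball 0 r - N"
  obtain B where B: "\<And>n x. x \<noteq> 0 \<Longrightarrow> log_gauge \<alpha> x > l0 \<Longrightarrow> norm x \<le> r \<Longrightarrow> norm (V n x) \<le> B"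
    using bd[of r] by blast
  have "compact ?C" using N(1) by (intro compact_diff) auto
  then have "compact (?C \<times> cball (0 :: 'v) B)" by (intro compact_Times) auto
  then have "bounded (\<Phi> ` (?C \<times> cball (0 :: 'v) B))"
    by (intro compact_imp_bounded compact_continuous_image continuous_on_subset[OF \<Phi>]) (use N(2) in auto)
  then obtain M where M: "\<And>y. y \<in> ?C \<times> cball (0 :: 'v) B \<Longrightarrow> \<bar>\<Phi> y\<bar> \<le> M"
    unfolding bounded_iff by (metis image_eqI real_norm_def)
  have meas: "(\<lambda>x. radial \<alpha> c x * \<Phi> (x, F x)) \<in> borel_measurable lborel" if F: "continuous_on UNIV F" for F
  proof -
    have "continuous_on (- {0}) (\<lambda>x. \<Phi> (x, F x))"
      by (intro continuous_on_compose2[OF \<Phi>] continuous_on_Pair continuous_on_id continuous_on_subset[OF F]) auto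
    from compact_supp_radial_mult[OF \<alpha> c(1) this] show ?thesis
      using borel_measurable_continuous_onI by (auto simp: compact_supp_def)
  qed
  show ?thesis
    unfolding radial_integral_def
  proof (rule integral_dominated_convergence[where w="\<lambda>x. \<bar>radial \<alpha> c x\<bar> * M"])
    show "integrable lborel (\<lambda>x :: (real^'m) \<times> (real^'k). \<bar>radial \<alpha> c x\<bar> * M)"
      using compact_supp_integrable[OF radc] by simp
    show "AE x in lborel. (\<lambda>n. radial \<alpha> c x * \<Phi> (x, V n x)) \<longlonglongrightarrow> radial \<alpha> c x * \<Phi> (x, W x)"
    proof (rule AE_I2)
      fix x :: "(real^'m) \<times> (real^'k)"
      show "(\<lambda>n. radial \<alpha> c x * \<Phi> (x, V n x)) \<longlonglongrightarrow> radial \<alpha> c x * \<Phi> (x, W x)"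
      proof (cases "radial \<alpha> c x = 0")
        case False
        then have x: "x \<noteq> 0" "log_gauge \<alpha> x > l0" using c(2)[of "log_gauge \<alpha> x"]
            by (auto simp: radial_def split: if_splits simp: not_le[symmetric])
        have "(\<lambda>n. (x, V n x)) \<longlonglongrightarrow> (x, W x)" by (intro tendsto_intros lim x)
        moreover have "isCont \<Phi> (x, W x)"
          using \<Phi> x(1) by (subst (asm) continuous_on_eq_continuous_at) (auto intro!: open_Times)
        ultimately have "(\<lambda>n. \<Phi> (x, V n x)) \<longlonglongrightarrow> \<Phi> (x, W x)" by (rule isCont_tendsto_compose[rotated])
        then show ?thesis by (intro tendsto_intros)
      qed simp
    qed
    show "AE x in lborel. norm (radial \<alpha> c x * \<Phi> (x, V n x)) \<le> \<bar>radial \<alpha> c x\<bar> * M" for n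
    proof (rule AE_I2)
      fix x :: "(real^'m) \<times> (real^'k)"
      show "norm (radial \<alpha> c x * \<Phi> (x, V n x)) \<le> \<bar>radial \<alpha> c x\<bar> * M"
      proof (cases "radial \<alpha> c x = 0")
        case False
        then have x: "x \<noteq> 0" "log_gauge \<alpha> x > l0" using c(2)[of "log_gauge \<alpha> x"]
            by (auto simp: radial_def split: if_splits simp: not_le[symmetric])
        have xr: "norm x \<le> r" "x \<notin> N" using False r[of x] N(3)[of x] by (auto simp: not_le[symmetric])
        have "\<bar>\<Phi> (x, V n x)\<bar> \<le> M" by (rule M) (use B[OF x xr(1)] xr in auto)
        then show ?thesis by (simp add: abs_mult mult_left_mono)
      qed simp
    qed
  qed (use meas V W in auto)
qed

text \<open>The mode of convergence that dominated convergence on compact sets requires. It is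
  stable under sums and products, so the limits below reduce to convolutions with tensor
  kernels.\<close>

definition tends_boundedly :: "real \<Rightarrow> real \<Rightarrow> (nat \<Rightarrow> (real^'m) \<times> (real^'k) \<Rightarrow> real) \<Rightarrow> ((real^'m) \<times> (real^'k) \<Rightarrow>
    real) \<Rightarrow> bool" where
  "tends_boundedly \<alpha> l0 s l \<longleftrightarrow> (\<forall>x. x \<noteq> 0 \<longrightarrow> log_gauge \<alpha> x > l0 \<longrightarrow> (\<lambda>n. s n x) \<longlonglongrightarrow> l x) \<and>
     (\<forall>r. \<exists>B. \<forall>n x. x \<noteq> 0 \<longrightarrow> log_gauge \<alpha> x > l0 \<longrightarrow> norm x \<le> r \<longrightarrow> \<bar>s n x\<bar> \<le> B)"

lemma tends_boundedly_limit: "tends_boundedly \<alpha> l0 s l \<Longrightarrow> x \<noteq> 0 \<Longrightarrow> log_gauge \<alpha> x > l0 \<Longrightarrow> (\<lambda>n. s n x) \<longlonglongrightarrow> l x"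
  unfolding tends_boundedly_def by blast

lemma tends_boundedly_cong:
  assumes "tends_boundedly \<alpha> l0 s l" "\<And>n x. x \<noteq> 0 \<Longrightarrow> log_gauge \<alpha> x > l0 \<Longrightarrow> s' n x = s n x" "\<And>x. x \<noteq> 0 \<Longrightarrow>
      log_gauge \<alpha> x > l0 \<Longrightarrow> l' x = l x"
  shows "tends_boundedly \<alpha> l0 s' l'"
proof -
  have e: "(\<lambda>n. s' n x) = (\<lambda>n. s n x)" if "x \<noteq> 0" "log_gauge \<alpha> x > l0" for x using assms(2)[OF that] by auto
  have "\<exists>B. \<forall>n x. x \<noteq> 0 \<longrightarrow> log_gauge \<alpha> x > l0 \<longrightarrow> norm x \<le> r \<longrightarrow> \<bar>s' n x\<bar> \<le> B" for r
  proof -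
    obtain B where "\<forall>n x. x \<noteq> 0 \<longrightarrow> log_gauge \<alpha> x > l0 \<longrightarrow> norm x \<le> r \<longrightarrow> \<bar>s n x\<bar> \<le> B"
      using assms(1) unfolding tends_boundedly_def by blast
    then show ?thesis using assms(2) by (intro exI[of _ B]) auto
  qed
  then show ?thesis using assms(1) unfolding tends_boundedly_def by (simp add: e assms(3))
qed

lemma tends_boundedly_const:
  assumes "continuous_on UNIV l"
  shows "tends_boundedly \<alpha> l0 (\<lambda>n. l) l"
  unfolding tends_boundedly_def
proof (intro conjI allI)
  fix r
  have "bounded (l ` cball 0 r)"
    by (intro compact_imp_bounded compact_continuous_image continuous_on_subset[OF assms]) auto
  then obtain B where "\<forall>x. norm x \<le> r \<longrightarrow> \<bar>l x\<bar> \<le> B"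
    unfolding bounded_iff by (metis image_eqI mem_cball_0 real_norm_def)
  then show "\<exists>B. \<forall>n x. x \<noteq> 0 \<longrightarrow> log_gauge \<alpha> x > l0 \<longrightarrow> norm x \<le> r \<longrightarrow> \<bar>l x\<bar> \<le> B" by blast
qed simp

lemma tends_boundedly_add:
  assumes "tends_boundedly \<alpha> l0 s l" "tends_boundedly \<alpha> l0 s' l'"
  shows "tends_boundedly \<alpha> l0 (\<lambda>n x. s n x + s' n x) (\<lambda>x. l x + l' x)"
proof -
  have "\<exists>B. \<forall>n x. x \<noteq> 0 \<longrightarrow> log_gauge \<alpha> x > l0 \<longrightarrow> norm x \<le> r \<longrightarrow> \<bar>s n x + s' n x\<bar> \<le> B" for r
  proof -
    obtain B where B: "\<forall>n x. x \<noteq> 0 \<longrightarrow> log_gauge \<alpha> x > l0 \<longrightarrow> norm x \<le> r \<longrightarrow> \<bar>s n x\<bar> \<le> B"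
      using assms(1) unfolding tends_boundedly_def by blast
    obtain B' where B': "\<forall>n x. x \<noteq> 0 \<longrightarrow> log_gauge \<alpha> x > l0 \<longrightarrow> norm x \<le> r \<longrightarrow> \<bar>s' n x\<bar> \<le> B'"
      using assms(2) unfolding tends_boundedly_def by blast
    have "\<bar>s n x + s' n x\<bar> \<le> B + B'" if "x \<noteq> 0" "log_gauge \<alpha> x > l0" "norm x \<le> r" for n x
      using B[rule_format, OF that, of n] B'[rule_format, OF that, of n] by linarith
    then show ?thesis by blast
  qed
  then show ?thesis unfolding tends_boundedly_def
    by (intro conjI allI impI tendsto_add tends_boundedly_limit[OF assms(1)] tends_boundedly_limit[OF assms(2)])
qed

lemma tends_boundedly_mult:
  assumes "tends_boundedly \<alpha> l0 s l" "tends_boundedly \<alpha> l0 s' l'"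
  shows "tends_boundedly \<alpha> l0 (\<lambda>n x. s n x * s' n x) (\<lambda>x. l x * l' x)"
proof -
  have "\<exists>B. \<forall>n x. x \<noteq> 0 \<longrightarrow> log_gauge \<alpha> x > l0 \<longrightarrow> norm x \<le> r \<longrightarrow> \<bar>s n x * s' n x\<bar> \<le> B" for r
  proof -
    obtain B where B: "\<forall>n x. x \<noteq> 0 \<longrightarrow> log_gauge \<alpha> x > l0 \<longrightarrow> norm x \<le> r \<longrightarrow> \<bar>s n x\<bar> \<le> B"
      using assms(1) unfolding tends_boundedly_def by blast
    obtain B' where B': "\<forall>n x. x \<noteq> 0 \<longrightarrow> log_gauge \<alpha> x > l0 \<longrightarrow> norm x \<le> r \<longrightarrow> \<bar>s' n x\<bar> \<le> B'"
      using assms(2) unfolding tends_boundedly_def by blast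
    have "\<bar>s n x * s' n x\<bar> \<le> B * B'" if "x \<noteq> 0" "log_gauge \<alpha> x > l0" "norm x \<le> r" for n x
      using B[rule_format, OF that, of n] B'[rule_format, OF that, of n] unfolding abs_mult
      by (intro mult_mono) auto
    then show ?thesis by blast
  qed
  then show ?thesis unfolding tends_boundedly_def
    by (intro conjI allI impI tendsto_mult tends_boundedly_limit[OF assms(1)] tends_boundedly_limit[OF assms(2)])
qed

lemma tends_boundedly_sum:
  assumes "\<And>i. i \<in> I \<Longrightarrow> tends_boundedly \<alpha> l0 (s i) (l i)"
  shows "tends_boundedly \<alpha> l0 (\<lambda>n x. \<Sum>i\<in>I. s i n x) (\<lambda>x. \<Sum>i\<in>I. l i x)"
  using assms by (induction I rule: infinite_finite_induct) (auto intro: tends_boundedly_const tends_boundedly_add)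

lemma tends_boundedly_convolution_tensor:
  assumes "continuous_on UNIV w" "test_kernel d \<theta>" "r \<longlonglongrightarrow> 0" "\<And>n. 0 < r n" "\<And>n. r n \<le> 1"
  shows "tends_boundedly \<alpha> l0 (\<lambda>n. convolution w (tensor (mollifier (r n)) \<theta>)) (vertical_conv w \<theta>)"
  unfolding tends_boundedly_def
proof (intro conjI allI impI)
  show "(\<lambda>n. convolution w (tensor (mollifier (r n)) \<theta>) x) \<longlonglongrightarrow> vertical_conv w \<theta> x" for x
    by (rule convolution_tensor_limit(1)[OF assms])
  show "\<exists>B. \<forall>n x. x \<noteq> 0 \<longrightarrow> log_gauge \<alpha> x > l0 \<longrightarrow> norm x \<le> R \<longrightarrow> \<bar>convolution w (tensor (mollifier (r n)) \<theta>) x\<bar> \<le> B" for R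
    using convolution_tensor_limit(2)[OF assms, of R] by blast
qed

text \<open>The C^2 functions \<open>U n\<close> have z scale \<open>r n\<close> tending to 0 and a
  fixed kernel in \<sigma>. They, their gradients and the operator applied to them converge on
  \<rho> > exp l0, so the identities, exact for each n, yield \<open>radial_identities\<close> for
  the limit.\<close>

lemma vertical_conv_rellich:
  fixes f ft :: "(real^'m) \<times> (real^'k) \<Rightarrow> real" and g h gt ht :: "'m + 'k \<Rightarrow> (real^'m) \<times> (real^'k) \<Rightarrow> real"
    and \<eta> :: "real^'k \<Rightarrow> real"
  assumes \<alpha>: "\<alpha> > 0" and Q: "Q = real CARD('m) + (\<alpha> + 1) * real CARD('k)"
    and X: "\<And>i. has_X_deriv \<alpha> \<Omega> i f (g i)" "\<And>i. has_X_deriv \<alpha> \<Omega> i (g i) (h i)" and S: "S \<subseteq> \<Omega>"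
    and eq: "\<And>y. y \<in> \<Omega> \<Longrightarrow> (\<Sum>i\<in>UNIV. h i y) = - \<kappa>\<^sup>2 * f y"
    and ft: "\<And>y. y \<in> S \<Longrightarrow> ft y = f y" and gt: "\<And>i y. y \<in> S \<Longrightarrow> gt i y = g i y" and ht: "\<And>i y. y \<in> S \<Longrightarrow> ht i y = h i y"
    and cont: "continuous_on UNIV ft" "\<And>i. continuous_on UNIV (gt i)" "\<And>i. continuous_on UNIV (ht i)"
    and \<eta>: "test_kernel e \<eta>" and r0: "r0 > 0" "r0 \<le> 1"
    and region: "\<And>x. x \<noteq> 0 \<Longrightarrow> log_gauge \<alpha> x > l0 \<Longrightarrow> cball x (r0 + e) \<subseteq> S"
    and Q3: "Q \<ge> 3" and \<kappa>: "\<kappa> > 0" and w: "w > 0"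
    and small: "\<And>\<epsilon> T. \<epsilon> > 0 \<Longrightarrow> \<exists>t>T. radial_integral \<alpha> (\<lambda>s. bump (2 * w) (s - t)) (\<lambda>x. (vertical_conv ft \<eta>
        x)\<^sup>2) \<le> \<epsilon> * exp t"
    and t: "t > l0 + w"
  shows "smear \<alpha> (bump w) (\<lambda>x. gauge_weight \<alpha> x * (vertical_conv ft \<eta> x)\<^sup>2) t = 0"
proof -
  define r where "r n = r0 * inverse (real (Suc n))" for n
  have r: "r \<longlonglongrightarrow> 0" "0 < r n" "r n \<le> 1" "r n \<le> r0" for n
  proof -
    have "(\<lambda>n. r0 * inverse (real (Suc n))) \<longlonglongrightarrow> r0 * 0"
      by (intro tendsto_mult tendsto_const LIMSEQ_inverse_real_of_nat)
    then show "r \<longlonglongrightarrow> 0" by (simp add: r_def[abs_def])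
    show "0 < r n" using r0 by (simp add: r_def)
    have "r0 * inverse (real (Suc n)) \<le> r0 * 1" using r0 by (intro mult_left_mono) (auto simp: inverse_le_1_iff)
    then show "r n \<le> r0" by (simp add: r_def)
    then show "r n \<le> 1" using r0 by simp
  qed
  define K :: "nat \<Rightarrow> (real^'m) \<times> (real^'k) \<Rightarrow> real" where "K n = tensor (mollifier (r n)) \<eta>" for n
  have K: "test_kernel (r n + e) (K n)" for n
    unfolding K_def by (rule test_kernel_tensor[OF mollifier(1)[OF r(2)] \<eta>])
  have reg: "cball x (r n + e) \<subseteq> S" if "x \<noteq> 0" "log_gauge \<alpha> x > l0" for x n
    using region[OF that] r(4)[of n] subset_cball[of "r n + e" "r0 + e" x] by force
  define u0 where "u0 = vertical_conv ft \<eta>"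
  \<comment> \<open>The limit of the gradients: in z the distributional derivative is averaged, in
    \<sigma> the derivative is carried by \<eta>, so that no \<sigma> derivative of f
    occurs.\<close>
  define P :: "'m + 'k \<Rightarrow> (real^'m) \<times> (real^'k) \<Rightarrow> real" where "P i = (case i of Inl a \<Rightarrow> vertical_conv (gt (Inl
      a)) \<eta> | Inr b \<Rightarrow> vertical_conv ft (dir_deriv (axis b 1) \<eta>))" for i
  define p0 where "p0 x = (\<Sum>i\<in>UNIV. P i x *\<^sub>R frame i)" for x
  define U where "U n = convolution ft (K n)" for n
  define p where "p n = conv_grad ft (K n)" for n
  define D where "D n = conv_hess ft (K n)" for n
  define b where "b n x = grushin_trace \<alpha> (D n) x" for n x
  have cont_u0: "continuous_on T u0" for T
    unfolding u0_def by (rule vertical_conv_continuous[OF cont(1) \<eta>])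
  have cont_P: "continuous_on T (P i)" for T i
    by (cases i) (auto simp: P_def intro!: vertical_conv_continuous[OF cont(1) test_kernel_dir_deriv[OF \<eta>]]
        vertical_conv_continuous[OF cont(2) \<eta>])
  have cont_p0: "continuous_on T p0" for T
    unfolding p0_def by (intro continuous_intros cont_P)
  have LU: "tends_boundedly \<alpha> l0 U u0"
    unfolding U_def K_def u0_def by (rule tends_boundedly_convolution_tensor[OF cont(1) \<eta> r(1-3)])
  \<comment> \<open>In the z directions the coefficient of X_i is 1. There \<open>weak_first\<close>
    trades the derivative of the concentrating kernel for a convolution with \<open>gt\<close>,
    which has a limit.\<close>
  have Lp: "tends_boundedly \<alpha> l0 (\<lambda>n x. p n x \<bullet> frame i) (P i)" for i
  proof (cases i)
    case (Inl a)
    have "tends_boundedly \<alpha> l0 (\<lambda>n. convolution (gt i) (K n)) (vertical_conv (gt i) \<eta>)"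
      unfolding K_def by (rule tends_boundedly_convolution_tensor[OF cont(2) \<eta> r(1-3)])
    then show ?thesis
    proof (rule tends_boundedly_cong)
      fix n and x :: "(real^'m) \<times> (real^'k)" assume x: "x \<noteq> 0" "log_gauge \<alpha> x > l0"
      show "p n x \<bullet> frame i = convolution (gt i) (K n) x"
        using weak_first[OF X(1) S ft gt K reg[OF x], of i n] unfolding p_def conv_grad_inner
            by (simp add: Inl convolution_def)
    qed (simp add: P_def Inl)
  next
    case (Inr j)
    have "tends_boundedly \<alpha> l0 (\<lambda>n. convolution ft (tensor (mollifier (r n)) (dir_deriv (axis j 1) \<eta>)))
        (vertical_conv ft (dir_deriv (axis j 1) \<eta>))"
      by (rule tends_boundedly_convolution_tensor[OF cont(1) test_kernel_dir_deriv[OF \<eta>] r(1-3)])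
    then show ?thesis
      by (rule tends_boundedly_cong) (simp_all add: p_def conv_grad_inner Inr K_def dir_deriv_tensor[OF \<eta>]
          P_def del: frame_simps)
  qed
  let ?DD = "\<lambda>i n. dir_deriv (frame i) (dir_deriv (frame i) (K n))"
  \<comment> \<open>The commutator with the coefficient. It is zero in the z directions, where the
    coefficient is 1; in the \<sigma> directions both terms have the same limit, since averaging in
    \<sigma> does not move z.\<close>
  have Le: "tends_boundedly \<alpha> l0 (\<lambda>n x. X_coeff_sq \<alpha> i x * convolution ft (?DD i n) x +
      (-1) * convolution (\<lambda>y. ft y * X_coeff_sq \<alpha> i y) (?DD i n) x) (\<lambda>x. 0)" for i
  proof (cases i)
    case (Inl a)
    have "tends_boundedly \<alpha> l0 (\<lambda>n x. 0) (\<lambda>x. 0)" by (rule tends_boundedly_const) simp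
    then show ?thesis by (rule tends_boundedly_cong) (simp_all add: Inl)
  next
    case (Inr j)
    let ?\<theta> = "dir_deriv (axis j 1) (dir_deriv (axis j 1) \<eta>)"
    have \<theta>: "test_kernel e ?\<theta>" by (intro test_kernel_dir_deriv \<eta>)
    have DD: "?DD i n = tensor (mollifier (r n)) ?\<theta>" for n
      by (simp add: K_def Inr dir_deriv_tensor[OF \<eta>] dir_deriv_tensor[OF test_kernel_dir_deriv[OF \<eta>]] del: frame_simps)
    have X_coeff: "continuous_on UNIV (\<lambda>y. ft y * X_coeff_sq \<alpha> i y)"
        by (intro continuous_intros cont continuous_X_coeff_sq[OF \<alpha>])
    have "tends_boundedly \<alpha> l0 (\<lambda>n x. X_coeff_sq \<alpha> i x * convolution ft (tensor (mollifier (r n)) ?\<theta>) x +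
        (-1) * convolution (\<lambda>y. ft y * X_coeff_sq \<alpha> i y) (tensor (mollifier (r n)) ?\<theta>) x)
        (\<lambda>x. X_coeff_sq \<alpha> i x * vertical_conv ft ?\<theta> x + (-1) * vertical_conv (\<lambda>y. ft y * X_coeff_sq \<alpha> i y) ?\<theta> x)"
      by (intro tends_boundedly_add tends_boundedly_mult tends_boundedly_const continuous_X_coeff_sq[OF \<alpha>]
          continuous_on_const tends_boundedly_convolution_tensor[OF cont(1) \<theta> r(1-3)]
          tends_boundedly_convolution_tensor[OF X_coeff \<theta> r(1-3)])
    moreover have "vertical_conv (\<lambda>y. ft y * X_coeff_sq \<alpha> i y) ?\<theta> x = X_coeff_sq \<alpha> i x * vertical_conv ft ?\<theta> x" for x
    proof -
      have "vertical_conv (\<lambda>y. ft y * X_coeff_sq \<alpha> i y) ?\<theta> x = (LINT s|lborel. X_coeff_sq \<alpha> i x * (ft (fst x,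
          snd x - s) * ?\<theta> s))"
        by (simp add: vertical_conv_def Inr ac_simps)
      then show ?thesis by (simp add: vertical_conv_def)
    qed
    ultimately show ?thesis by (simp add: DD)
  qed
  \<comment> \<open>The operator applied to \<open>U n\<close> equals -\<kappa>^2 \<open>U n\<close>
    plus the commutators, so the equation is recovered in the limit.\<close>
  have Lb: "tends_boundedly \<alpha> l0 b (\<lambda>x. - \<kappa>\<^sup>2 * u0 x)"
  proof -
    have "tends_boundedly \<alpha> l0 (\<lambda>n x. - \<kappa>\<^sup>2 * U n x + (\<Sum>i\<in>UNIV. X_coeff_sq \<alpha> i x * convolution ft (?DD i n) x
        + (-1) * convolution (\<lambda>y. ft y * X_coeff_sq \<alpha> i y) (?DD i n) x))
       (\<lambda>x. - \<kappa>\<^sup>2 * u0 x + (\<Sum>i\<in>(UNIV :: ('m + 'k) set). 0))"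
      by (intro tends_boundedly_add tends_boundedly_mult tends_boundedly_sum Le LU tends_boundedly_const
          continuous_on_const)
    then show ?thesis
    proof (rule tends_boundedly_cong)
      fix n and x :: "(real^'m) \<times> (real^'k)" assume x: "x \<noteq> 0" "log_gauge \<alpha> x > l0"
      have "b n x = (\<Sum>i\<in>UNIV. X_coeff_sq \<alpha> i x * convolution ft (?DD i n) x)"
        by (simp add: b_def grushin_trace_def D_def conv_hess_inner conv_grad_inner)
      moreover have "(\<Sum>i\<in>UNIV. convolution (\<lambda>y. ft y * X_coeff_sq \<alpha> i y) (?DD i n) x) = - \<kappa>\<^sup>2 * U n x"
        unfolding U_def by (rule convolution_equation[OF \<alpha> X S eq ft gt ht cont K reg[OF x]])
      ultimately show "b n x = - \<kappa>\<^sup>2 * U n x + (\<Sum>i\<in>UNIV. X_coeff_sq \<alpha> i x * convolution ft (?DD i n) x +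
          (-1) * convolution (\<lambda>y. ft y * X_coeff_sq \<alpha> i y) (?DD i n) x)"
        by (simp add: sum_subtractf)
    qed simp
  qed
  \<comment> \<open>Every integrand in the identities is a continuous function of x and of this
    triple, so that \<open>radial_integral_limit\<close> covers all of them with a suitable
    \<Phi>.\<close>
  define V where "V n x = (U n x, p n x, b n x)" for n x
  define W where "W x = (u0 x, p0 x, - \<kappa>\<^sup>2 * u0 x)" for x
  have Kp: "\<And>n x. (U n has_derivative (\<lambda>v. p n x \<bullet> v)) (at x)" "\<And>n x. (p n has_derivative D n x) (at x)"
      "\<And>n i. continuous_on UNIV (\<lambda>x. D n x (frame i))" "\<And>n x v w. D n x v \<bullet> w = D n x w \<bullet> v"
    unfolding U_def p_def D_def
    by (rule convolution_has_gradient[OF cont(1) K] conv_grad_has_derivative[OF cont(1) K]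
        conv_hess_continuous[OF cont(1) K] conv_hess_symmetric[OF K])+
  have cont_V: "continuous_on UNIV (V n)" for n
    unfolding V_def b_def grushin_trace_def
    by (intro continuous_intros continuous_X_coeff_sq[OF \<alpha>] Kp(3)) (auto simp: U_def p_def intro!:
        convolution_continuous[OF cont(1) K] conv_grad_continuous[OF cont(1) K])
  have cont_W: "continuous_on UNIV W"
    unfolding W_def by (intro continuous_intros cont_u0 cont_p0)
  have p_rep: "p n x = (\<Sum>i\<in>UNIV. (p n x \<bullet> frame i) *\<^sub>R frame i)" for n x by (rule frame_representation)
  have lim: "(\<lambda>n. V n x) \<longlonglongrightarrow> W x" if "x \<noteq> 0" "log_gauge \<alpha> x > l0" for x
  proof -
    have l: "(\<lambda>n. U n x) \<longlonglongrightarrow> u0 x" "(\<lambda>n. b n x) \<longlonglongrightarrow> - \<kappa>\<^sup>2 * u0 x" "(\<lambda>n. p n x \<bullet> frame i) \<longlonglongrightarrow> P i x" for i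
      by (rule tends_boundedly_limit[OF LU that] tends_boundedly_limit[OF Lb that] tends_boundedly_limit[OF Lp that])+
    have "(\<lambda>n. \<Sum>i\<in>UNIV. (p n x \<bullet> frame i) *\<^sub>R frame i) \<longlonglongrightarrow> (\<Sum>i\<in>UNIV. P i x *\<^sub>R frame i)"
      by (intro tendsto_intros l(3))
    then have "(\<lambda>n. p n x) \<longlonglongrightarrow> p0 x" by (simp only: p0_def p_rep[symmetric])
    then show ?thesis unfolding V_def W_def by (intro tendsto_Pair l)
  qed
  have bd: "\<exists>B. \<forall>n x. x \<noteq> 0 \<longrightarrow> log_gauge \<alpha> x > l0 \<longrightarrow> norm x \<le> R \<longrightarrow> norm (V n x) \<le> B" for R
  proof -
    obtain B1 where B1: "\<forall>n x. x \<noteq> 0 \<longrightarrow> log_gauge \<alpha> x > l0 \<longrightarrow> norm x \<le> R \<longrightarrow> \<bar>U n x\<bar> \<le> B1"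
      using LU unfolding tends_boundedly_def by blast
    obtain B2 where B2: "\<forall>n x. x \<noteq> 0 \<longrightarrow> log_gauge \<alpha> x > l0 \<longrightarrow> norm x \<le> R \<longrightarrow> \<bar>b n x\<bar> \<le> B2"
      using Lb unfolding tends_boundedly_def by blast
    have "\<forall>i. \<exists>B. \<forall>n x. x \<noteq> 0 \<longrightarrow> log_gauge \<alpha> x > l0 \<longrightarrow> norm x \<le> R \<longrightarrow> \<bar>p n x \<bullet> frame i\<bar> \<le> B"
      using Lp unfolding tends_boundedly_def by blast
    then obtain B3 where B3: "\<And>i n x. x \<noteq> 0 \<Longrightarrow> log_gauge \<alpha> x > l0 \<Longrightarrow> norm x \<le> R \<Longrightarrow> \<bar>p n x \<bullet> frame i\<bar> \<le> B3 i" by metis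
    have "norm (V n x) \<le> B1 + ((\<Sum>i\<in>UNIV. B3 i) + B2)" if x: "x \<noteq> 0" "log_gauge \<alpha> x > l0" "norm x \<le> R" for n x
    proof -
      have "norm (p n x) \<le> (\<Sum>i\<in>UNIV. \<bar>p n x \<bullet> frame i\<bar>)"
        using norm_le_l1[of "p n x"] by (simp add: sum_Basis_frame)
      also have "\<dots> \<le> (\<Sum>i\<in>UNIV. B3 i)" by (intro sum_mono B3 x)
      finally have "norm (p n x) \<le> (\<Sum>i\<in>UNIV. B3 i)" .
      moreover have "norm (V n x) \<le> norm (U n x) + (norm (p n x) + norm (b n x))"
        unfolding V_def using norm_Pair_le[of "U n x" "(p n x, b n x)"] norm_Pair_le[of "p n x" "b n x"] by linarith
      moreover have "norm (U n x) \<le> B1" "norm (b n x) \<le> B2" using B1[rule_format, OF x] B2[rule_format, OF x]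
          by simp_all
      ultimately show ?thesis by linarith
    qed
    then show ?thesis by blast
  qed
  have ids: "radial_identities \<alpha> Q \<kappa> l0 u0 p0"
    unfolding radial_identities_def
  proof (intro allI impI)
    fix c c' :: "real \<Rightarrow> real"
    assume c: "compact_supp c" "compact_supp c'" and "\<forall>s. (c has_real_derivative c' s) (at s)" and "\<forall>s\<le>l0. c s = 0"
    then have d: "\<And>s. (c has_real_derivative c' s) (at s)" and z: "\<And>s. s \<le> l0 \<Longrightarrow> c s = 0" by auto
    \<comment> \<open>At s = l0 the weight is known to vanish only to the left, hence the one-sided
      derivative.\<close>
    have z': "c' s = 0" if "s \<le> l0" for s
    proof -
      have l: "(c has_vector_derivative c' s) (at s within {s - 1..s})"
        using d[of s] by (simp add: has_real_derivative_iff_has_vector_derivative has_vector_derivative_at_within)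
      have "((\<lambda>s. 0) has_vector_derivative 0) (at s within {s - 1..s})" by simp
      then have "(c has_vector_derivative 0) (at s within {s - 1..s})"
        by (rule has_vector_derivative_transform[rotated 2]) (use z that in auto)
      with l show ?thesis
        by (intro vector_derivative_unique_within_closed_interval[of "s - 1" s s c]) auto
    qed
    have L: "(\<lambda>n. radial_integral \<alpha> c (\<lambda>x. \<Phi> (x, V n x))) \<longlonglongrightarrow> radial_integral \<alpha> c (\<lambda>x. \<Phi> (x, W x))"
      "(\<lambda>n. radial_integral \<alpha> c' (\<lambda>x. \<Phi> (x, V n x))) \<longlonglongrightarrow> radial_integral \<alpha> c' (\<lambda>x. \<Phi> (x, W x))"
      if "continuous_on ((- {0}) \<times> UNIV) \<Phi>" for \<Phi>
      by (rule radial_integral_limit[OF \<alpha> c(1) z cont_V cont_W that lim bd] radial_integral_limit[OF \<alpha> c(2) z'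
          cont_V cont_W that lim bd]; simp)+
    have co: "continuous_on ((- {0}) \<times> UNIV) (\<lambda>y. gauge_weight \<alpha> (fst y))" "continuous_on ((- {0}) \<times> UNIV)
        (\<lambda>y. euler_field \<alpha> (fst y))"
        "continuous_on ((- {0}) \<times> UNIV) (\<lambda>y. X_coeff_sq \<alpha> i (fst y))" for i
      by (auto intro!: continuous_on_compose2[OF continuous_gauge_weight[OF \<alpha>]] continuous_on_compose2[OF
          continuous_euler_field[of UNIV]]
          continuous_on_compose2[OF continuous_X_coeff_sq[OF \<alpha>, of UNIV]] continuous_intros)
    let ?u = "\<lambda>y :: ((real^'m) \<times> (real^'k)) \<times> real \<times> ((real^'m) \<times> (real^'k)) \<times> real. fst (snd y)"
    let ?p = "\<lambda>y :: ((real^'m) \<times> (real^'k)) \<times> real \<times> ((real^'m) \<times> (real^'k)) \<times> real. fst (snd (snd y))"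
    let ?b = "\<lambda>y :: ((real^'m) \<times> (real^'k)) \<times> real \<times> ((real^'m) \<times> (real^'k)) \<times> real. snd (snd (snd y))"
    let ?Z = "\<lambda>y. euler_field \<alpha> (fst y) \<bullet> ?p y"
    have L1: "(\<lambda>n. radial_integral \<alpha> c (\<lambda>x. gauge_weight \<alpha> x * (U n x * (euler_field \<alpha> x \<bullet> p n x)))) \<longlonglongrightarrow>
        radial_integral \<alpha> c (\<lambda>x. gauge_weight \<alpha> x * (u0 x * (euler_field \<alpha> x \<bullet> p0 x)))"
        "(\<lambda>n. radial_integral \<alpha> c' (\<lambda>x. gauge_weight \<alpha> x * (U n x * (euler_field \<alpha> x \<bullet> p n x)))) \<longlonglongrightarrow>
            radial_integral \<alpha> c' (\<lambda>x. gauge_weight \<alpha> x * (u0 x * (euler_field \<alpha> x \<bullet> p0 x)))"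
      using L[of "\<lambda>y. gauge_weight \<alpha> (fst y) * (?u y * ?Z y)"] by (simp_all add: V_def W_def continuous_intros co)
    have L2: "(\<lambda>n. radial_integral \<alpha> c (\<lambda>x. gauge_weight \<alpha> x * (U n x)\<^sup>2)) \<longlonglongrightarrow> radial_integral \<alpha> c (\<lambda>x.
        gauge_weight \<alpha> x * (u0 x)\<^sup>2)"
        "(\<lambda>n. radial_integral \<alpha> c' (\<lambda>x. gauge_weight \<alpha> x * (U n x)\<^sup>2)) \<longlonglongrightarrow> radial_integral \<alpha> c' (\<lambda>x.
            gauge_weight \<alpha> x * (u0 x)\<^sup>2)"
      using L[of "\<lambda>y. gauge_weight \<alpha> (fst y) * (?u y)\<^sup>2"] by (simp_all add: V_def W_def continuous_intros co)
    have L3: "(\<lambda>n. radial_integral \<alpha> c (\<lambda>x. U n x * (euler_field \<alpha> x \<bullet> p n x))) \<longlonglongrightarrow> radial_integral \<alpha> c (\<lambda>x. u0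
        x * (euler_field \<alpha> x \<bullet> p0 x))"
      using L[of "\<lambda>y. ?u y * ?Z y"] by (simp_all add: V_def W_def continuous_intros co)
    have L4: "(\<lambda>n. radial_integral \<alpha> c (\<lambda>x. (U n x)\<^sup>2)) \<longlonglongrightarrow> radial_integral \<alpha> c (\<lambda>x. (u0 x)\<^sup>2)"
        "(\<lambda>n. radial_integral \<alpha> c' (\<lambda>x. (U n x)\<^sup>2)) \<longlonglongrightarrow> radial_integral \<alpha> c' (\<lambda>x. (u0 x)\<^sup>2)"
      using L[of "\<lambda>y. (?u y)\<^sup>2"] by (simp_all add: V_def W_def continuous_intros co)
    have L5: "(\<lambda>n. radial_integral \<alpha> c (\<lambda>x. X_energy \<alpha> x (p n x))) \<longlonglongrightarrow> radial_integral \<alpha> c (\<lambda>x. X_energy \<alpha> x (p0 x))"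
        "(\<lambda>n. radial_integral \<alpha> c' (\<lambda>x. X_energy \<alpha> x (p n x))) \<longlonglongrightarrow> radial_integral \<alpha> c' (\<lambda>x. X_energy \<alpha> x (p0 x))"
      using L[of "\<lambda>y. X_energy \<alpha> (fst y) (?p y)"] by (simp_all add: V_def W_def X_energy_def continuous_intros co)
    have L6: "(\<lambda>n. radial_integral \<alpha> c' (\<lambda>x. gauge_weight \<alpha> x * (euler_field \<alpha> x \<bullet> p n x)\<^sup>2)) \<longlonglongrightarrow>
        radial_integral \<alpha> c' (\<lambda>x. gauge_weight \<alpha> x * (euler_field \<alpha> x \<bullet> p0 x)\<^sup>2)"
      using L[of "\<lambda>y. gauge_weight \<alpha> (fst y) * (?Z y)\<^sup>2"] by (simp_all add: V_def W_def continuous_intros co)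
    have L7: "(\<lambda>n. radial_integral \<alpha> c (\<lambda>x. U n x * b n x)) \<longlonglongrightarrow> - \<kappa>\<^sup>2 * radial_integral \<alpha> c (\<lambda>x. (u0 x)\<^sup>2)"
    proof -
      have "radial_integral \<alpha> c (\<lambda>x. u0 x * (- \<kappa>\<^sup>2 * u0 x)) = - \<kappa>\<^sup>2 * radial_integral \<alpha> c (\<lambda>x. (u0 x)\<^sup>2)"
        unfolding radial_integral_cmult[symmetric] by (rule radial_integral_cong) (simp add: power2_eq_square)
      then show ?thesis
        using L(1)[of "\<lambda>y. ?u y * ?b y"] by (simp add: V_def W_def continuous_intros co)
    qed
    have L8: "(\<lambda>n. radial_integral \<alpha> c (\<lambda>x. (euler_field \<alpha> x \<bullet> p n x) * b n x)) \<longlonglongrightarrow> - \<kappa>\<^sup>2 * radial_integral \<alpha> c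
        (\<lambda>x. u0 x * (euler_field \<alpha> x \<bullet> p0 x))"
    proof -
      have "radial_integral \<alpha> c (\<lambda>x. (euler_field \<alpha> x \<bullet> p0 x) * (- \<kappa>\<^sup>2 * u0 x)) = - \<kappa>\<^sup>2 * radial_integral \<alpha> c
          (\<lambda>x. u0 x * (euler_field \<alpha> x \<bullet> p0 x))"
        unfolding radial_integral_cmult[symmetric] by (rule radial_integral_cong) simp
      then show ?thesis
        using L(1)[of "\<lambda>y. ?Z y * ?b y"] by (simp add: V_def W_def continuous_intros co)
    qed
    note Kids = weighted_dilation_identity[OF \<alpha> Q c d Kp] dilation_identity[OF \<alpha> Q c d Kp] energy_identity[OF
        \<alpha> Q c d Kp] pohozaev_identity[OF \<alpha> Q c d Kp]
    have two: "radial_integral \<alpha> c (\<lambda>x. gauge_weight \<alpha> x * (2 * (U n x * (euler_field \<alpha> x \<bullet> p n x)))) =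
        2 * radial_integral \<alpha> c (\<lambda>x. gauge_weight \<alpha> x * (U n x * (euler_field \<alpha> x \<bullet> p n x)))"
      for n unfolding radial_integral_cmult[symmetric] by (rule radial_integral_cong) simp
    have i1: "2 * radial_integral \<alpha> c (\<lambda>x. gauge_weight \<alpha> x * (u0 x * (euler_field \<alpha> x \<bullet> p0 x))) =
        - (Q - 2) * radial_integral \<alpha> c (\<lambda>x. gauge_weight \<alpha> x * (u0 x)\<^sup>2) - radial_integral \<alpha> c' (\<lambda>x.
            gauge_weight \<alpha> x * (u0 x)\<^sup>2)"
    proof (rule LIMSEQ_unique)
      show "(\<lambda>n. 2 * radial_integral \<alpha> c (\<lambda>x. gauge_weight \<alpha> x * (U n x * (euler_field \<alpha> x \<bullet> p n x)))) \<longlonglongrightarrow> 2 *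
          radial_integral \<alpha> c (\<lambda>x. gauge_weight \<alpha> x * (u0 x * (euler_field \<alpha> x \<bullet> p0 x)))"
        by (intro tendsto_intros L1)
      show "(\<lambda>n. 2 * radial_integral \<alpha> c (\<lambda>x. gauge_weight \<alpha> x * (U n x * (euler_field \<alpha> x \<bullet> p n x)))) \<longlonglongrightarrow>
          - (Q - 2) * radial_integral \<alpha> c (\<lambda>x. gauge_weight \<alpha> x * (u0 x)\<^sup>2) - radial_integral \<alpha> c' (\<lambda>x.
              gauge_weight \<alpha> x * (u0 x)\<^sup>2)"
        unfolding two[symmetric] Kids(1) by (intro tendsto_intros L2)
    qed
    have i2: "2 * radial_integral \<alpha> c (\<lambda>x. u0 x * (euler_field \<alpha> x \<bullet> p0 x)) =
        - Q * radial_integral \<alpha> c (\<lambda>x. (u0 x)\<^sup>2) - radial_integral \<alpha> c' (\<lambda>x. (u0 x)\<^sup>2)"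
    proof (rule LIMSEQ_unique)
      show "(\<lambda>n. 2 * radial_integral \<alpha> c (\<lambda>x. U n x * (euler_field \<alpha> x \<bullet> p n x))) \<longlonglongrightarrow> 2 * radial_integral \<alpha> c
          (\<lambda>x. u0 x * (euler_field \<alpha> x \<bullet> p0 x))"
        by (intro tendsto_intros L3)
      show "(\<lambda>n. 2 * radial_integral \<alpha> c (\<lambda>x. U n x * (euler_field \<alpha> x \<bullet> p n x))) \<longlonglongrightarrow>
          - Q * radial_integral \<alpha> c (\<lambda>x. (u0 x)\<^sup>2) - radial_integral \<alpha> c' (\<lambda>x. (u0 x)\<^sup>2)"
        unfolding radial_integral_cmult[of \<alpha> c 2, symmetric] Kids(2) by (intro tendsto_intros L4)
    qed
    have i3: "- \<kappa>\<^sup>2 * radial_integral \<alpha> c (\<lambda>x. (u0 x)\<^sup>2) =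
        - radial_integral \<alpha> c (\<lambda>x. X_energy \<alpha> x (p0 x)) - radial_integral \<alpha> c' (\<lambda>x. gauge_weight \<alpha> x * (u0 x *
            (euler_field \<alpha> x \<bullet> p0 x)))"
    proof (rule LIMSEQ_unique[OF L7])
      show "(\<lambda>n. radial_integral \<alpha> c (\<lambda>x. U n x * b n x)) \<longlonglongrightarrow>
          - radial_integral \<alpha> c (\<lambda>x. X_energy \<alpha> x (p0 x)) - radial_integral \<alpha> c' (\<lambda>x. gauge_weight \<alpha> x * (u0 x
              * (euler_field \<alpha> x \<bullet> p0 x)))"
        unfolding b_def Kids(3) by (intro tendsto_intros L5 L1)
    qed
    have i4: "- \<kappa>\<^sup>2 * radial_integral \<alpha> c (\<lambda>x. u0 x * (euler_field \<alpha> x \<bullet> p0 x)) =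
        (Q - 2) / 2 * radial_integral \<alpha> c (\<lambda>x. X_energy \<alpha> x (p0 x)) + 1 / 2 * radial_integral \<alpha> c' (\<lambda>x.
            X_energy \<alpha> x (p0 x))
        - radial_integral \<alpha> c' (\<lambda>x. gauge_weight \<alpha> x * (euler_field \<alpha> x \<bullet> p0 x)\<^sup>2)"
    proof (rule LIMSEQ_unique[OF L8])
      show "(\<lambda>n. radial_integral \<alpha> c (\<lambda>x. (euler_field \<alpha> x \<bullet> p n x) * b n x)) \<longlonglongrightarrow>
        (Q - 2) / 2 * radial_integral \<alpha> c (\<lambda>x. X_energy \<alpha> x (p0 x)) + 1 / 2 * radial_integral \<alpha> c' (\<lambda>x.
            X_energy \<alpha> x (p0 x))
        - radial_integral \<alpha> c' (\<lambda>x. gauge_weight \<alpha> x * (euler_field \<alpha> x \<bullet> p0 x)\<^sup>2)"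
        unfolding b_def Kids(4) by (intro tendsto_intros L5 L6)
    qed
    show "2 * radial_integral \<alpha> c (\<lambda>x. gauge_weight \<alpha> x * (u0 x * (euler_field \<alpha> x \<bullet> p0 x))) =
        - (Q - 2) * radial_integral \<alpha> c (\<lambda>x. gauge_weight \<alpha> x * (u0 x)\<^sup>2) - radial_integral \<alpha> c' (\<lambda>x.
            gauge_weight \<alpha> x * (u0 x)\<^sup>2) \<and>
      2 * radial_integral \<alpha> c (\<lambda>x. u0 x * (euler_field \<alpha> x \<bullet> p0 x)) =
        - Q * radial_integral \<alpha> c (\<lambda>x. (u0 x)\<^sup>2) - radial_integral \<alpha> c' (\<lambda>x. (u0 x)\<^sup>2) \<and>
      - \<kappa>\<^sup>2 * radial_integral \<alpha> c (\<lambda>x. (u0 x)\<^sup>2) =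
        - radial_integral \<alpha> c (\<lambda>x. X_energy \<alpha> x (p0 x)) - radial_integral \<alpha> c' (\<lambda>x. gauge_weight \<alpha> x * (u0 x *
            (euler_field \<alpha> x \<bullet> p0 x))) \<and>
      - \<kappa>\<^sup>2 * radial_integral \<alpha> c (\<lambda>x. u0 x * (euler_field \<alpha> x \<bullet> p0 x)) =
        (Q - 2) / 2 * radial_integral \<alpha> c (\<lambda>x. X_energy \<alpha> x (p0 x)) + 1 / 2 * radial_integral \<alpha> c' (\<lambda>x.
            X_energy \<alpha> x (p0 x))
        - radial_integral \<alpha> c' (\<lambda>x. gauge_weight \<alpha> x * (euler_field \<alpha> x \<bullet> p0 x)\<^sup>2)"
      by (intro conjI i1 i2 i3 i4)
  qed
  show ?thesis
    unfolding u0_def[symmetric]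
  proof (rule smear_rellich[OF \<alpha> Q3 \<kappa> w cont_u0 cont_p0 ids _ t])
    show "\<exists>t>T. radial_integral \<alpha> (\<lambda>s. bump (2 * w) (s - t)) (\<lambda>x. (u0 x)\<^sup>2) \<le> \<epsilon> * exp t" if "\<epsilon> > 0" for \<epsilon> T
      unfolding u0_def by (rule small[OF that])
  qed
qed

section \<open>The Rellich bound\<close>

lemma continuous_pseudo_gauge:
  assumes "\<alpha> > 0" shows "continuous_on S (pseudo_gauge \<alpha>)"
  unfolding pseudo_gauge_gauge_pow using assms
  by (intro continuous_on_powr' continuous_gauge_pow continuous_intros) (auto simp: gauge_pow_nonneg)

lemma compact_pseudo_gauge_le:
  assumes "\<alpha> > 0"
  shows "compact {x :: (real^'m) \<times> (real^'k). pseudo_gauge \<alpha> x \<le> R}"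
proof -
  obtain r where r: "\<And>x :: (real^'m) \<times> (real^'k). norm x > r \<Longrightarrow> x \<noteq> 0 \<and> log_gauge \<alpha> x > ln (max R 1)"
    using log_gauge_ge_norm[OF assms, of "ln (max R 1)"] by blast
  have "norm x \<le> r" if "pseudo_gauge \<alpha> x \<le> R" for x :: "(real^'m) \<times> (real^'k)"
  proof (rule ccontr)
    assume "\<not> norm x \<le> r"
    then have x: "x \<noteq> 0" "log_gauge \<alpha> x > ln (max R 1)" using r[of x] by auto
    have "max R 1 = exp (ln (max R 1))" by simp
    also have "\<dots> < pseudo_gauge \<alpha> x" unfolding pseudo_gauge_log_gauge[OF assms x(1)] using x(2)
        by (simp only: exp_less_cancel_iff)
    finally show False using that by simp
  qed
  then have "bounded {x :: (real^'m) \<times> (real^'k). pseudo_gauge \<alpha> x \<le> R}"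
    by (auto simp: bounded_iff)
  moreover have "closed {x :: (real^'m) \<times> (real^'k). pseudo_gauge \<alpha> x \<le> R}"
    by (intro closed_Collect_le continuous_pseudo_gauge assms continuous_intros)
  ultimately show ?thesis by (simp add: compact_eq_bounded_closed)
qed

text \<open>\<rho>^(\<alpha> + 1) is the Euclidean norm of (|z|^(\<alpha> + 1), 2 (\<alpha> + 1)
  \<sigma>). A shift of \<sigma> by at most e changes it by at most \<open>d\<close>, which the
  logarithm hardly notices when \<rho> is large. Averaging in \<sigma> thus mixes only nearby gauge
  levels.\<close>

lemma log_gauge_shift:
  assumes \<alpha>: "\<alpha> > 0" and "\<delta> > 0" "e > 0"
  shows "\<exists>T. \<forall>(x :: (real^'m) \<times> (real^'k)) s. x \<noteq> 0 \<longrightarrow> log_gauge \<alpha> x \<ge> T \<longrightarrow> norm s \<le> e \<longrightarrow>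
     (fst x, snd x - s) \<noteq> 0 \<and> \<bar>log_gauge \<alpha> (fst x, snd x - s) - log_gauge \<alpha> x\<bar> \<le> \<delta>"
proof -
  define d where "d = 2 * (\<alpha> + 1) * e"
  have d: "d > 0" using assms by (simp add: d_def)
  \<comment> \<open>Chosen so that N = \<rho>^(\<alpha> + 1) satisfies N \<ge> 2 d, which keeps the
    shifted value above N / 2, and 2 d / N \<le> \<delta>.\<close>
  define T where "T = ln (max (2 * d) (2 * d / \<delta>) + 1) / (\<alpha> + 1)"
  have N_norm: "sqrt (gauge_pow \<alpha> x) = norm (norm (fst x) powr (\<alpha> + 1), (2 * (\<alpha> + 1)) *\<^sub>R snd x)"
      for x :: "(real^'m) \<times> (real^'k)"
  proof -
    have "norm (fst x) powr (2 * (\<alpha> + 1)) = (norm (fst x) powr (\<alpha> + 1))\<^sup>2"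
      by (simp add: power2_eq_square powr_add[symmetric] algebra_simps)
    then show ?thesis using \<alpha>
      by (simp add: gauge_pow_def norm_Pair power_mult_distrib) (simp add: power2_eq_square algebra_simps)
  qed
  show ?thesis
  proof (intro exI[of _ T] allI impI)
    fix x :: "(real^'m) \<times> (real^'k)" and s :: "real^'k"
    assume x: "x \<noteq> 0" "T \<le> log_gauge \<alpha> x" and s: "norm s \<le> e"
    let ?y = "(fst x, snd x - s)"
    let ?N = "sqrt (gauge_pow \<alpha> x)" and ?N' = "sqrt (gauge_pow \<alpha> ?y)"
    have lnN: "ln (sqrt (gauge_pow \<alpha> z)) = (\<alpha> + 1) * log_gauge \<alpha> z" if "z \<noteq> 0" for z :: "(real^'m) \<times> (real^'k)"
      using gauge_pow_pos[OF \<alpha> that] \<alpha> by (simp add: ln_sqrt log_gauge_def field_simps)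
    have "\<bar>?N' - ?N\<bar> \<le> norm ((norm (fst ?y) powr (\<alpha> + 1), (2 * (\<alpha> + 1)) *\<^sub>R snd ?y) - (norm (fst x) powr (\<alpha> +
        1), (2 * (\<alpha> + 1)) *\<^sub>R snd x))"
      unfolding N_norm by (rule norm_triangle_ineq3)
    also have "\<dots> = 2 * (\<alpha> + 1) * norm s"
      using \<alpha> by (simp add: norm_Pair scaleR_diff_right[symmetric])
    also have "\<dots> \<le> d" unfolding d_def using s \<alpha> by (intro mult_left_mono) auto
    finally have dif: "\<bar>?N' - ?N\<bar> \<le> d" .
    have "ln (max (2 * d) (2 * d / \<delta>) + 1) \<le> (\<alpha> + 1) * log_gauge \<alpha> x"
      using x(2) \<alpha> by (simp add: T_def divide_le_eq mult.commute)
    then have "exp (ln (max (2 * d) (2 * d / \<delta>) + 1)) \<le> exp (ln ?N)"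
      unfolding lnN[OF x(1)] by (subst exp_le_cancel_iff)
    moreover have "max (2 * d) (2 * d / \<delta>) + 1 > 0" using d by (auto simp: less_max_iff_disj intro: add_pos_pos)
    moreover have Np: "?N > 0" using gauge_pow_pos[OF \<alpha> x(1)] by simp
    ultimately have "max (2 * d) (2 * d / \<delta>) + 1 \<le> ?N" by simp
    then have N: "2 * d \<le> ?N" "2 * d / \<delta> \<le> ?N" by auto
    have N': "?N' \<ge> ?N / 2" using dif N(1) by linarith
    then have "?N' > 0" using Np by linarith
    then have y: "?y \<noteq> 0" by auto
    have Nd: "2 * d / ?N \<le> \<delta>" using N(2) Np \<open>\<delta> > 0\<close> by (simp add: field_simps)
    have ln_le: "ln a \<le> ln b + d / b" if "a > 0" "b > 0" "a \<le> b + d" for a b :: real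
    proof -
      have "b * (1 + d / b) = b + d" using that by (simp add: field_simps)
      then have "ln a \<le> ln (b * (1 + d / b))" using that by (simp add: ln_mono)
      also have "\<dots> = ln b + ln (1 + d / b)" using that d by (intro ln_mult_pos) (auto intro: add_pos_pos)
      also have "ln (1 + d / b) \<le> d / b" using that d by (intro ln_add_one_self_le_self) auto
      finally show ?thesis by simp
    qed
    have "ln ?N' \<le> ln ?N + d / ?N" by (rule ln_le) (use \<open>?N' > 0\<close> Np dif in auto)
    moreover have "d / ?N \<le> 2 * d / ?N" using Np d by (intro divide_right_mono) auto
    moreover have "ln ?N \<le> ln ?N' + d / ?N'" by (rule ln_le) (use \<open>?N' > 0\<close> Np dif in auto)
    moreover have "d / ?N' \<le> d / (?N / 2)" using N' Np d \<open>?N' > 0\<close> by (intro divide_left_mono mult_pos_pos) auto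
    moreover have "d / (?N / 2) = 2 * d / ?N" by simp
    moreover have "\<bar>a - b\<bar> \<le> \<delta>" if "a \<le> b + p" "p \<le> q" "b \<le> a + p'" "p' \<le> q'" "q' = q" "q \<le> \<delta>" for a b p p' q q' :: real
      using that by linarith
    ultimately have "\<bar>ln ?N' - ln ?N\<bar> \<le> \<delta>" using Nd by blast
    then have *: "(\<alpha> + 1) * \<bar>log_gauge \<alpha> ?y - log_gauge \<alpha> x\<bar> \<le> \<delta>"
      unfolding lnN[OF x(1)] lnN[OF y] right_diff_distrib[symmetric] using \<alpha> by (simp add: abs_mult)
    have "1 * \<bar>log_gauge \<alpha> ?y - log_gauge \<alpha> x\<bar> \<le> (\<alpha> + 1) * \<bar>log_gauge \<alpha> ?y - log_gauge \<alpha> x\<bar>"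
      using \<alpha> by (intro mult_right_mono) auto
    with * y show "?y \<noteq> 0 \<and> \<bar>log_gauge \<alpha> ?y - log_gauge \<alpha> x\<bar> \<le> \<delta>" by simp
  qed
qed

text \<open>The variance of v under the probability density \<open>mollifier e\<close> is
  nonnegative.\<close>

lemma mollifier_Jensen:
  fixes v :: "'a::euclidean_space \<Rightarrow> real"
  assumes e: "e > 0" and v: "continuous_on UNIV v"
  shows "(LINT s|lborel. mollifier e s * v s)\<^sup>2 \<le> (LINT s|lborel. mollifier e s * (v s)\<^sup>2)"
proof -
  let ?c = "LINT s|lborel. mollifier e s * v s"
  note i = mollifier_integrable[OF e, where 'a='a]
  have "0 \<le> (LINT s|lborel. mollifier e s * (v s - ?c)\<^sup>2)"
    by (intro integral_nonneg_AE AE_I2 mult_nonneg_nonneg mollifier(2)[OF e]) auto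
  also have "\<dots> = (LINT s|lborel. mollifier e s * (v s)\<^sup>2 - 2 * ?c * (mollifier e s * v s) + mollifier e s * ?c\<^sup>2)"
    by (intro Bochner_Integration.integral_cong refl) (simp add: power2_eq_square algebra_simps)
  also have "\<dots> = (LINT s|lborel. mollifier e s * (v s)\<^sup>2) - 2 * ?c * ?c + ?c\<^sup>2"
  proof -
    have 1: "integrable lborel (\<lambda>s. mollifier e s * (v s)\<^sup>2)" by (intro i continuous_intros v)
    have 2: "integrable lborel (\<lambda>s. 2 * ?c * (mollifier e s * v s))" by (intro integrable_mult_right i v)
    have 3: "integrable lborel (\<lambda>s. mollifier e (s :: 'a) * ?c\<^sup>2)" by (intro i continuous_intros)
    have 4: "(LINT s|lborel. mollifier e (s :: 'a) * ?c\<^sup>2) = ?c\<^sup>2" by (simp add: mollifier(3)[OF e])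
    show ?thesis
      by (simp only: Bochner_Integration.integral_add[OF Bochner_Integration.integrable_diff[OF 1 2] 3]
          Bochner_Integration.integral_diff[OF 1 2] integral_mult_right_zero 4)
  qed
  finally show ?thesis by (simp add: power2_eq_square)
qed

lemma annulus_integrable:
  fixes v :: "(real^'m) \<times> (real^'k) \<Rightarrow> real"
  assumes "\<alpha> > 0" "continuous_on UNIV v"
  shows "integrable lborel (\<lambda>x. indicator {x. R < pseudo_gauge \<alpha> x \<and> pseudo_gauge \<alpha> x < R'} x *\<^sub>R v x)"
proof -
  let ?A = "{x :: (real^'m) \<times> (real^'k). R < pseudo_gauge \<alpha> x \<and> pseudo_gauge \<alpha> x < R'}"
  have "set_integrable lborel {x :: (real^'m) \<times> (real^'k). pseudo_gauge \<alpha> x \<le> R'} v"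
    unfolding set_integrable_def
    by (intro borel_integrable_compact compact_pseudo_gauge_le assms(1) continuous_on_subset[OF assms(2)]) auto
  then have "set_integrable lborel ?A v"
  proof (rule set_integrable_subset)
    have "open ?A" by (intro open_Collect_conj open_Collect_less continuous_pseudo_gauge assms continuous_intros)
    then show "?A \<in> sets lborel" by simp
  qed auto
  then show ?thesis by (simp add: set_integrable_def)
qed

lemma bump_bounded: "w > 0 \<Longrightarrow> \<exists>B>0. \<forall>s::real. bump w s \<le> B"
proof -
  assume w: "w > 0"
  have "bounded (bump w ` {-w..w::real})"
    by (intro compact_imp_bounded compact_continuous_image continuous_on_subset[OF C_diff_continuous[OF
        C_diff_bump]]) auto
  then obtain B where B: "B > 0" "\<And>s. s \<in> {-w..w} \<Longrightarrow> norm (bump w s) \<le> B"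
    unfolding bounded_pos by auto
  have "bump w s \<le> B" for s :: real
  proof (cases "s \<in> {-w..w}")
    case True then show ?thesis using B(2)[OF True] by simp
  next
    case False then show ?thesis using bump_real_eq_0[OF w, of s] B(1) by auto
  qed
  then show ?thesis using B(1) by blast
qed

lemma lborel_integrable_translate:
  fixes w :: "'a::euclidean_space \<Rightarrow> real"
  assumes "integrable lborel w"
  shows "integrable lborel (\<lambda>x. w (x + c))"
proof -
  have "integrable (distr lborel borel ((+) c)) w" using assms by (simp only: lborel_distr_plus)
  from integrable_distr[OF _ this] show ?thesis by (simp add: add.commute)
qed

text \<open>In the variable ln \<rho> the annulus is the interval of length ln 2 centred at ln R +
  ln 2 / 2. Jensen and Fubini replace the square of the average by averaged squares, and each
  vertical translate of the window stays in the annulus.\<close>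

lemma window_bound:
  fixes ft :: "(real^'m) \<times> (real^'k) \<Rightarrow> real"
  assumes \<alpha>: "\<alpha> > 0" and e: "e > 0" and w: "w > 0" "16 * w \<le> ln 2" and ft: "continuous_on UNIV ft"
  obtains B T where "B > 0" "\<And>R. R > 0 \<Longrightarrow> ln R \<ge> T \<Longrightarrow>
     radial_integral \<alpha> (\<lambda>s. bump (2 * w) (s - (ln R + ln 2 / 2))) (\<lambda>x. (vertical_conv ft (mollifier e) x)\<^sup>2)
       \<le> B * (LINT x:{x. R < pseudo_gauge \<alpha> x \<and> pseudo_gauge \<alpha> x < 2 * R}|lborel. (ft x)\<^sup>2)"
proof -
  let ?\<eta> = "mollifier e :: real^'k \<Rightarrow> real"
  note \<eta> = mollifier[OF e, where 'a="real^'k"]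
  have l2: "ln (2::real) > 0" by simp
  have w2: "2 * w > 0" using w by simp
  obtain B where B: "B > 0" "\<And>s::real. bump (2 * w) s \<le> B" using bump_bounded[OF w2] by blast
  obtain T where T: "\<And>(x :: (real^'m) \<times> (real^'k)) s. x \<noteq> 0 \<Longrightarrow> log_gauge \<alpha> x \<ge> T \<Longrightarrow> norm s \<le> e \<Longrightarrow>
     (fst x, snd x - s) \<noteq> 0 \<and> \<bar>log_gauge \<alpha> (fst x, snd x - s) - log_gauge \<alpha> x\<bar> \<le> ln 2 / 8"
    using log_gauge_shift[OF \<alpha> _ e, of "ln 2 / 8"] l2 by force
  have "radial_integral \<alpha> (\<lambda>s. bump (2 * w) (s - (ln R + ln 2 / 2))) (\<lambda>x. (vertical_conv ft ?\<eta> x)\<^sup>2)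
       \<le> B * (LINT x:{x. R < pseudo_gauge \<alpha> x \<and> pseudo_gauge \<alpha> x < 2 * R}|lborel. (ft x)\<^sup>2)"
    if R: "R > 0" "ln R \<ge> T" for R
  proof -
    define t where "t = ln R + ln 2 / 2"
    let ?A = "{x :: (real^'m) \<times> (real^'k). R < pseudo_gauge \<alpha> x \<and> pseudo_gauge \<alpha> x < 2 * R}"
    let ?J = "LINT x:?A|lborel. (ft x)\<^sup>2"
    let ?W = "radial \<alpha> (\<lambda>s. bump (2 * w) (s - t)) :: (real^'m) \<times> (real^'k) \<Rightarrow> real"
    let ?F = "\<lambda>x s. ?W x * (?\<eta> s * (ft (fst x, snd x - s))\<^sup>2)"
    have b: "compact_supp (\<lambda>s. bump (2 * w) (s - t))" by (rule compact_supp_bump_shift[OF w2])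
    have W1: "compact_supp (\<lambda>x. ?W x * 1)" by (rule compact_supp_radial_mult[OF \<alpha> b]) simp
    then have W: "compact_supp ?W" by simp
    then obtain r where Wc: "continuous_on UNIV ?W" and r: "\<And>x. norm x > r \<Longrightarrow> ?W x = 0" by (auto simp: compact_supp_def)
    have W_nonneg: "?W x \<ge> 0" for x by (simp add: radial_def bump_nonneg)
    have W_le: "?W x \<le> B" for x using B by (simp add: radial_def)
    have W_supp: "R < pseudo_gauge \<alpha> (fst x, snd x - s) \<and> pseudo_gauge \<alpha> (fst x, snd x - s) < 2 * R"
      if "?W x \<noteq> 0" "norm s \<le> e" for x s
    proof -
      have x: "x \<noteq> 0" "bump (2 * w) (log_gauge \<alpha> x - t) \<noteq> 0" using that(1) by (auto simp: radial_def split: if_splits)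
      have "\<bar>log_gauge \<alpha> x - t\<bar> < 2 * w" using bump_real_eq_0[OF w2, of "log_gauge \<alpha> x - t"] x(2) by (meson not_le)
      \<comment> \<open>Window and shift each account for at most ln 2 / 8, together less than the
        half length ln 2 / 2 of the annulus.\<close>
      then have 1: "\<bar>log_gauge \<alpha> x - t\<bar> < ln 2 / 8" using w(2) by linarith
      then have "log_gauge \<alpha> x \<ge> T" using R(2) l2 unfolding t_def abs_less_iff by linarith
      from T[OF x(1) this that(2)] have y: "(fst x, snd x - s) \<noteq> 0" "\<bar>log_gauge \<alpha> (fst x, snd x - s) -
          log_gauge \<alpha> x\<bar> \<le> ln 2 / 8" by auto
      have "ln R < log_gauge \<alpha> (fst x, snd x - s)" "log_gauge \<alpha> (fst x, snd x - s) < ln R + ln 2"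
        using 1 y(2) l2 unfolding t_def abs_less_iff abs_le_iff by linarith+
      then have "exp (ln R) < exp (log_gauge \<alpha> (fst x, snd x - s))" "exp (log_gauge \<alpha> (fst x, snd x -
          s)) < exp (ln R + ln 2)"
        by (simp_all only: exp_less_cancel_iff)
      then show ?thesis using R(1) by (simp add: pseudo_gauge_log_gauge[OF \<alpha> y(1)] exp_add mult.commute)
    qed
    have ft2: "continuous_on UNIV (\<lambda>x. (ft x)\<^sup>2)" by (intro continuous_intros ft)
    have v: "continuous_on UNIV (\<lambda>s. ft (fst x, snd x - s))" for x
      by (intro continuous_on_compose2[OF ft] continuous_intros) auto
    have sq: "(vertical_conv ft ?\<eta> x)\<^sup>2 \<le> (LINT s|lborel. ?\<eta> s * (ft (fst x, snd x - s))\<^sup>2)" for x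
      using mollifier_Jensen[OF e v[of x]] by (simp add: vertical_conv_def mult.commute)
    have sc2: "(LINT s|lborel. ?\<eta> s * (ft (fst x, snd x - s))\<^sup>2) = vertical_conv (\<lambda>x. (ft x)\<^sup>2) ?\<eta> x" for x
      by (simp add: vertical_conv_def mult.commute)
    have "radial_integral \<alpha> (\<lambda>s. bump (2 * w) (s - t)) (\<lambda>x. (vertical_conv ft ?\<eta> x)\<^sup>2) \<le>
        radial_integral \<alpha> (\<lambda>s. bump (2 * w) (s - t)) (vertical_conv (\<lambda>x. (ft x)\<^sup>2) ?\<eta>)"
    proof (rule radial_integral_mono[OF \<alpha> b b])
      show "continuous_on (- {0}) (\<lambda>x. (vertical_conv ft ?\<eta> x)\<^sup>2)" "continuous_on (- {0}) (vertical_conv (\<lambda>x.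
          (ft x)\<^sup>2) ?\<eta>)"
        by (intro continuous_intros vertical_conv_continuous[OF ft \<eta>(1)] vertical_conv_continuous[OF ft2 \<eta>(1)])+
      fix x :: "(real^'m) \<times> (real^'k)"
      show "bump (2 * w) (log_gauge \<alpha> x - t) * (vertical_conv ft ?\<eta> x)\<^sup>2 \<le> bump (2 * w) (log_gauge \<alpha> x -
          t) * vertical_conv (\<lambda>x. (ft x)\<^sup>2) ?\<eta> x"
        using sq[of x] unfolding sc2 by (intro mult_left_mono bump_nonneg)
    qed
    also have "\<dots> = (LINT x|lborel. LINT s|lborel. ?F x s)"
      unfolding radial_integral_def sc2[symmetric] by simp
    also have "\<dots> = (LINT s|lborel. LINT x|lborel. ?F x s)"
    proof (rule lborel_pair.Fubini_integral[symmetric])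
      have "integrable lborel (case_prod ?F)"
      proof (rule integrable_compact_support)
        have Wf: "continuous_on UNIV (\<lambda>z :: ((real^'m) \<times> (real^'k)) \<times> (real^'k). ?W (fst z))"
          by (intro continuous_on_compose2[OF Wc] continuous_intros) auto
        show "continuous_on UNIV (case_prod ?F)"
          unfolding case_prod_unfold
          by (intro continuous_intros Wf continuous_on_compose2[OF test_kernelD(3)[OF \<eta>(1), of UNIV]]
              continuous_on_compose2[OF ft]) auto
        fix z :: "((real^'m) \<times> (real^'k)) \<times> (real^'k)" assume z: "norm z > r + e"
        have "norm z \<le> norm (fst z) + norm (snd z)" by (metis norm_Pair_le prod.collapse)
        then have "norm (fst z) > r \<or> norm (snd z) > e" using z by linarith
        then show "case_prod ?F z = 0" using r[of "fst z"] test_kernelD(2)[OF \<eta>(1), of "snd z"]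
            by (auto simp: case_prod_unfold)
      qed
      then show "integrable (lborel \<Otimes>\<^sub>M lborel) (case_prod ?F)" by (simp add: lborel_prod)
    qed
    also have "\<dots> \<le> (LINT s|lborel. ?\<eta> s * (B * ?J))"
    proof (rule integral_mono_AE')
      show "integrable lborel (\<lambda>s. ?\<eta> s * (B * ?J))"
        by (intro integrable_mult_left compact_supp_integrable test_kernel_compact_supp[OF \<eta>(1)])
      have J0: "?J \<ge> 0" unfolding set_lebesgue_integral_def
          by (intro integral_nonneg_AE AE_I2) (auto simp: indicator_def)
      show "AE s in lborel. 0 \<le> ?\<eta> s * (B * ?J)"
        using J0 B(1) \<eta>(2) by (intro AE_I2 mult_nonneg_nonneg) auto
      show "AE s in lborel. (LINT x|lborel. ?F x s) \<le> ?\<eta> s * (B * ?J)"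
      proof (rule AE_I2)
        fix s :: "real^'k"
        have "(LINT x|lborel. ?F x s) = ?\<eta> s * (LINT x|lborel. ?W x * (ft (fst x, snd x - s))\<^sup>2)"
          by (subst integral_mult_right_zero[symmetric]) (simp add: ac_simps)
        also have "\<dots> \<le> ?\<eta> s * (B * ?J)"
        proof (cases "norm s \<le> e")
          case True
          let ?g = "\<lambda>y. B * (indicator ?A y *\<^sub>R (ft y)\<^sup>2)"
          have gi: "integrable lborel ?g" by (intro integrable_mult_right annulus_integrable[OF \<alpha> ft2])
          have "(LINT x|lborel. ?W x * (ft (fst x, snd x - s))\<^sup>2) \<le> (LINT x|lborel. ?g (x + (0, - s)))"
          proof (rule integral_mono)
            show "integrable lborel (\<lambda>x. ?W x * (ft (fst x, snd x - s))\<^sup>2)"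
              by (intro compact_supp_integrable compact_supp_radial_mult[OF \<alpha> b] continuous_intros
                  continuous_on_compose2[OF ft]) auto
            show "integrable lborel (\<lambda>x. ?g (x + (0, - s)))"
            proof -
              from lborel_integrable_translate[OF gi] show ?thesis .
            qed
            fix x :: "(real^'m) \<times> (real^'k)"
            have e1: "x + (0, - s) = (fst x, snd x - s)" by (simp add: prod_eq_iff)
            show "?W x * (ft (fst x, snd x - s))\<^sup>2 \<le> ?g (x + (0, - s))"
            proof (cases "?W x = 0")
              case False
              then have "(fst x, snd x - s) \<in> ?A" using W_supp[OF False True] by simp
              then show ?thesis unfolding e1 using W_le[of x] by (simp add: mult_right_mono)
            qed (use B(1) in \<open>auto simp: indicator_def\<close>)
          qed
          also have "\<dots> = (LINT x|lborel. ?g x)"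
          proof -
            have "?g \<in> borel_measurable borel" using gi by (auto dest: borel_measurable_integrable)
            from lborel_integral_affine[OF this, of 1 "(0, - s)"]
            have "(LINT x|lborel. ?g x) = (LINT x|lborel. ?g (x + (0, - s)))" by (simp add: add.commute)
            then show ?thesis by (rule sym)
          qed
          also have "\<dots> = B * ?J" by (simp add: set_lebesgue_integral_def)
          finally show ?thesis using \<eta>(2) by (intro mult_left_mono)
        next
          case False
          then show ?thesis using test_kernelD(2)[OF \<eta>(1), of s] by simp
        qed
        finally show "(LINT x|lborel. ?F x s) \<le> ?\<eta> s * (B * ?J)" .
      qed
    qed
    also have "\<dots> = B * ?J" by (simp add: \<eta>(3))
    finally show ?thesis by (simp add: t_def)
  qed
  then show ?thesis by (rule that[OF B(1)])
qed

theorem theorem1p1: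
  fixes \<alpha> \<kappa> R\<^sub>0 :: real
    and f :: "(real^'m) \<times> (real^'k) \<Rightarrow> real"
    and \<Omega>\<^sub>0 :: "((real^'m) \<times> (real^'k)) set"
  assumes "\<alpha> > 0"
    and "real CARD('m) + (\<alpha> + 1) * real CARD('k) \<ge> 3"
    and "R\<^sub>0 > 0"
    and "\<kappa> > 0"
    and "\<Omega>\<^sub>0 = {x. pseudo_gauge \<alpha> x > R\<^sub>0}"
    and "f \<in> Gamma2 \<alpha> \<Omega>\<^sub>0"
    and "has_grushin \<alpha> \<Omega>\<^sub>0 f (\<lambda>x. - \<kappa>\<^sup>2 * f x)"
    and "\<exists>x\<in>\<Omega>\<^sub>0. f x \<noteq> 0"
  shows "\<exists>R\<^sub>1>R\<^sub>0. \<exists>M>0. \<forall>R>R\<^sub>1.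
           (LINT x:{x. R < pseudo_gauge \<alpha> x \<and> pseudo_gauge \<alpha> x < 2 * R}|lborel. \<bar>f x\<bar>\<^sup>2) \<ge> M * R"
proof (rule ccontr)
  let ?J = "\<lambda>R. LINT x:{x. R < pseudo_gauge \<alpha> x \<and> pseudo_gauge \<alpha> x < 2 * R}|lborel. \<bar>f x\<bar>\<^sup>2"
  assume contra: "\<not> (\<exists>R\<^sub>1>R\<^sub>0. \<exists>M>0. \<forall>R>R\<^sub>1. ?J R \<ge> M * R)"
  have liminf: "\<exists>R>R\<^sub>1. ?J R < M * R" if "R\<^sub>1 > R\<^sub>0" "M > 0" for R\<^sub>1 M
    using contra that by (meson not_le)
  note \<alpha> = assms(1) and \<Omega>_def = assms(5)
  define Q where "Q = real CARD('m) + (\<alpha> + 1) * real CARD('k)"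
  have f_cont: "continuous_on \<Omega>\<^sub>0 f" using assms(6) by (simp add: Gamma2_def Gamma1_def)
  have \<Omega>_open: "open \<Omega>\<^sub>0"
    unfolding \<Omega>_def by (intro open_Collect_less continuous_pseudo_gauge \<alpha> continuous_intros)
  obtain g h where X: "\<And>i. has_X_deriv \<alpha> \<Omega>\<^sub>0 i f (g i)" "\<And>i. has_X_deriv \<alpha> \<Omega>\<^sub>0 i (g i) (h i)"
      and eq: "\<And>x. x \<in> \<Omega>\<^sub>0 \<Longrightarrow> (\<Sum>i\<in>UNIV. h i x) = - \<kappa>\<^sup>2 * f x"
    using assms(7) unfolding has_grushin_def by blast
  have gh_cont: "continuous_on \<Omega>\<^sub>0 (g i)" "continuous_on \<Omega>\<^sub>0 (h i)" for i
    using X[of i] by (auto simp: has_X_deriv_def)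
  \<comment> \<open>\<omega> vanishes on z = 0, so the final contradiction needs a point off that
    set; f is nonzero on an open set, which contains one.\<close>
  obtain x1 where x1: "x1 \<in> \<Omega>\<^sub>0" "f x1 \<noteq> 0" "fst x1 \<noteq> 0"
  proof -
    obtain x0 where x0: "x0 \<in> \<Omega>\<^sub>0" "f x0 \<noteq> 0" using assms(8) by blast
    have "open {x \<in> \<Omega>\<^sub>0. f x \<in> - {0}}"
      using continuous_open_preimage[OF f_cont \<Omega>_open, of "- {0}"]
      by (simp add: vimage_def Int_def open_Compl)
    moreover have "x0 \<in> {x \<in> \<Omega>\<^sub>0. f x \<in> - {0}}" using x0 by simp
    ultimately obtain e where e: "e > 0" "ball x0 e \<subseteq> {x \<in> \<Omega>\<^sub>0. f x \<in> - {0}}"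
      using open_contains_ball by blast
    show ?thesis
    proof (cases "fst x0 = 0")
      case True
      let ?y = "x0 + ((e / 2) *\<^sub>R axis undefined 1, 0)"
      have "?y \<in> ball x0 e" using e(1) by (simp add: dist_norm norm_Pair)
      then have "?y \<in> \<Omega>\<^sub>0" "f ?y \<noteq> 0" using e(2) by auto
      moreover have "fst ?y \<noteq> 0" using e(1) True by (simp add: axis_eq_0_iff)
      ultimately show ?thesis using that by blast
    qed (use x0 that in blast)
  qed
  have x1_0: "x1 \<noteq> 0" using x1(3) by auto
  define \<rho>1 where "\<rho>1 = pseudo_gauge \<alpha> x1"
  have \<rho>1: "\<rho>1 > R\<^sub>0" using x1(1) by (simp add: \<Omega>_def \<rho>1_def)
  \<comment> \<open>Two radii strictly between \<open>R\<^sub>0\<close> and \<rho>(x1): the equation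
    is used on \<rho> \<ge> Rb, the identities on \<rho> > Rc, and the gap leaves room for the
    kernels.\<close>
  define Rb where "Rb = (2 * R\<^sub>0 + \<rho>1) / 3"
  define Rc where "Rc = (R\<^sub>0 + 2 * \<rho>1) / 3"
  have Rs: "R\<^sub>0 < Rb" "Rb < Rc" "Rc < \<rho>1" "Rc > 0" using \<rho>1 assms(3) by (auto simp: Rb_def Rc_def)
  define S where "S = {x :: (real^'m) \<times> (real^'k). pseudo_gauge \<alpha> x \<ge> Rb}"
  have S: "S \<subseteq> \<Omega>\<^sub>0" using Rs by (auto simp: S_def \<Omega>_def)
  have S_closed: "closedin (top_of_set UNIV) S"
    by (simp add: S_def closed_Collect_le continuous_pseudo_gauge[OF \<alpha>])
  \<comment> \<open>f and its derivatives are only continuous on the open set and may be unbounded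
    near its boundary. Continuous extensions from the closed set S make convolutions over the whole
    space available.\<close>
  have ext: "\<exists>v'. continuous_on UNIV v' \<and> (\<forall>y\<in>S. v' y = v y)" if "continuous_on \<Omega>\<^sub>0 v"
      for v :: "(real^'m) \<times> (real^'k) \<Rightarrow> real"
    by (rule Tietze_unbounded[OF continuous_on_subset[OF that S] S_closed]) blast
  obtain ft where ft: "continuous_on UNIV ft" "\<And>y. y \<in> S \<Longrightarrow> ft y = f y" using ext[OF f_cont] by blast
  have "\<forall>i. \<exists>v'. continuous_on UNIV v' \<and> (\<forall>y\<in>S. v' y = g i y)" using ext[OF gh_cont(1)] by blast
  then obtain gt where gt: "\<And>i. continuous_on UNIV (gt i)" "\<And>i y. y \<in> S \<Longrightarrow> gt i y = g i y" by metis
  have "\<forall>i. \<exists>v'. continuous_on UNIV v' \<and> (\<forall>y\<in>S. v' y = h i y)" using ext[OF gh_cont(2)] by blast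
  then obtain ht where ht: "\<And>i. continuous_on UNIV (ht i)" "\<And>i y. y \<in> S \<Longrightarrow> ht i y = h i y" by metis
  have "\<exists>\<delta>>0. \<forall>y\<in>{x :: (real^'m) \<times> (real^'k). pseudo_gauge \<alpha> x \<le> Rb}. \<forall>x\<in>{x. pseudo_gauge \<alpha> x \<ge> Rc}. \<delta> \<le> dist y x"
    by (rule separate_compact_closed[OF compact_pseudo_gauge_le[OF \<alpha>]])
       (use Rs in \<open>auto intro!: closed_Collect_le continuous_pseudo_gauge[OF \<alpha>]\<close>)
  then obtain \<delta> where \<delta>: "\<delta> > 0" "\<And>x y :: (real^'m) \<times> (real^'k). pseudo_gauge \<alpha> y \<le> Rb \<Longrightarrow>
      pseudo_gauge \<alpha> x \<ge> Rc \<Longrightarrow> \<delta> \<le> dist y x"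
    by auto
  have x1S: "x1 \<in> S" using Rs by (simp add: S_def \<rho>1_def)
  have v1: "continuous_on UNIV (\<lambda>s. ft (fst x1, snd x1 - s))"
    by (intro continuous_on_compose2[OF ft(1)] continuous_intros) auto
  have "isCont (\<lambda>s. ft (fst x1, snd x1 - s)) 0"
    using v1 by (simp add: continuous_on_eq_continuous_at)
  then obtain e1 where e1: "e1 > 0" "\<And>s. norm s < e1 \<Longrightarrow> \<bar>ft (fst x1, snd x1 - s) - ft x1\<bar> < \<bar>f x1\<bar> / 2"
    using x1(2) by (auto simp: continuous_at_eps_delta dist_norm elim!: allE[of _ "\<bar>f x1\<bar> / 2"])
  \<comment> \<open>The bound by \<delta> / 4, also imposed on \<open>r0\<close>, keeps all kernel
    supports inside S; the bound by e1 / 2 keeps the average at x1 close to f(x1), hence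
    nonzero.\<close>
  define e where "e = min (\<delta> / 4) (e1 / 2)"
  define r0 where "r0 = min (\<delta> / 4) 1"
  have e: "e > 0" "e < e1" and r0: "r0 > 0" "r0 \<le> 1" and re: "r0 + e \<le> \<delta> / 2"
    using \<delta>(1) e1(1) by (auto simp: e_def r0_def)
  define l0 where "l0 = ln Rc"
  have region: "cball x (r0 + e) \<subseteq> S" if x: "x \<noteq> 0" "log_gauge \<alpha> x > l0" for x :: "(real^'m) \<times> (real^'k)"
  proof
    fix y assume y: "y \<in> cball x (r0 + e)"
    have "Rc = exp l0" using Rs by (simp add: l0_def)
    also have "\<dots> < pseudo_gauge \<alpha> x" unfolding pseudo_gauge_log_gauge[OF \<alpha> x(1)] using x(2)
        by (simp only: exp_less_cancel_iff)
    finally have "pseudo_gauge \<alpha> x \<ge> Rc" by simp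
    moreover have "dist y x < \<delta>" using y re \<delta>(1) by (simp add: dist_commute)
    ultimately have "\<not> pseudo_gauge \<alpha> y \<le> Rb" using \<delta>(2)[of y x] by auto
    then show "y \<in> S" by (simp add: S_def)
  qed
  note \<eta> = mollifier[OF e(1), where 'a="real^'k"]
  let ?u = "vertical_conv ft (mollifier e)"
  have u_cont: "continuous_on UNIV ?u" by (rule vertical_conv_continuous[OF ft(1) \<eta>(1)])
  have u1: "?u x1 \<noteq> 0"
  proof -
    have "\<bar>(LINT s|lborel. mollifier e s * ft (fst x1, snd x1 - s)) - ft x1\<bar> \<le> \<bar>f x1\<bar> / 2"
      by (rule mollifier_average[OF e(1) v1]) (use e1(2) e(2) in \<open>meson le_less_trans less_imp_le\<close>)
    then have "\<bar>?u x1 - f x1\<bar> \<le> \<bar>f x1\<bar> / 2" by (simp add: vertical_conv_def mult.commute ft(2)[OF x1S])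
    then show ?thesis using x1(2) by auto
  qed
  define t1 where "t1 = log_gauge \<alpha> x1"
  have t1: "t1 > l0"
  proof -
    have "exp l0 < exp t1" using Rs by (simp add: l0_def t1_def \<rho>1_def pseudo_gauge_log_gauge[OF \<alpha> x1_0])
    then show ?thesis by simp
  qed
  \<comment> \<open>The first bound places t1 beyond \<open>l0 + w\<close>, the second is the width
    condition of \<open>window_bound\<close>.\<close>
  define w where "w = min ((t1 - l0) / 2) (ln 2 / 16)"
  have w: "w > 0" "16 * w \<le> ln 2" "t1 > l0 + w" using t1 by (auto simp: w_def min_def field_simps)
  have small: "\<exists>t>T. radial_integral \<alpha> (\<lambda>s. bump (2 * w) (s - t)) (\<lambda>x. (?u x)\<^sup>2) \<le> \<epsilon> * exp t" if \<epsilon>: "\<epsilon> > 0" for \<epsilon> T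
  proof -
    obtain B T' where B: "B > 0" and T': "\<And>R. R > 0 \<Longrightarrow> ln R \<ge> T' \<Longrightarrow>
       radial_integral \<alpha> (\<lambda>s. bump (2 * w) (s - (ln R + ln 2 / 2))) (\<lambda>x. (?u x)\<^sup>2)
       \<le> B * (LINT x:{x. R < pseudo_gauge \<alpha> x \<and> pseudo_gauge \<alpha> x < 2 * R}|lborel. (ft x)\<^sup>2)"
      by (rule window_bound[OF \<alpha> e(1) w(1,2) ft(1)]) (rule that)
    \<comment> \<open>R above Rb makes \<open>ft\<close> equal to f on the annulus; the exponentials
      force ln R beyond T and T'.\<close>
    let ?R1 = "max (max Rb (exp T)) (exp T')"
    have "?R1 > R\<^sub>0" using Rs by auto
    from liminf[OF this, of "\<epsilon> / B"] obtain R where R: "R > ?R1" "?J R < \<epsilon> / B * R" using \<epsilon> B by auto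
    have R0: "R > 0" using R(1) Rs assms(3) by simp
    have "exp T < exp (ln R)" "exp T' < exp (ln R)" using R(1) R0 by simp_all
    then have lnR: "T < ln R" "T' < ln R" by (simp_all only: exp_less_cancel_iff)
    define t where "t = ln R + ln 2 / 2"
    have t: "t > T" "R \<le> exp t"
    proof -
      have l2: "ln (2::real) > 0" by simp
      show "t > T" using lnR(1) l2 unfolding t_def by linarith
      have "ln R \<le> t" using l2 unfolding t_def by linarith
      then have "exp (ln R) \<le> exp t" by simp
      then show "R \<le> exp t" using R0 by simp
    qed
    have "(LINT x:{x. R < pseudo_gauge \<alpha> x \<and> pseudo_gauge \<alpha> x < 2 * R}|lborel. (ft x)\<^sup>2) = ?J R"
      unfolding set_lebesgue_integral_def
    proof (rule Bochner_Integration.integral_cong[OF refl])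
      fix x :: "(real^'m) \<times> (real^'k)"
      show "indicator {x. R < pseudo_gauge \<alpha> x \<and> pseudo_gauge \<alpha> x < 2 * R} x *\<^sub>R (ft x)\<^sup>2 =
          indicator {x. R < pseudo_gauge \<alpha> x \<and> pseudo_gauge \<alpha> x < 2 * R} x *\<^sub>R \<bar>f x\<bar>\<^sup>2"
      proof (cases "R < pseudo_gauge \<alpha> x")
        case True
        then have "x \<in> S" using R(1) by (simp add: S_def)
        then show ?thesis by (simp add: ft(2))
      qed simp
    qed
    then have "radial_integral \<alpha> (\<lambda>s. bump (2 * w) (s - t)) (\<lambda>x. (?u x)\<^sup>2) \<le> B * ?J R"
      using T'[OF R0] lnR(2) by (simp add: t_def)
    also have "\<dots> \<le> B * (\<epsilon> / B * R)" using R(2) B by (intro mult_left_mono) auto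
    also have "\<dots> = \<epsilon> * R" using B by simp
    also have "\<dots> \<le> \<epsilon> * exp t" using t(2) \<epsilon> by (intro mult_left_mono) auto
    finally show ?thesis using t(1) by blast
  qed
  have Q3: "Q \<ge> 3" using assms(2) by (simp add: Q_def)
  have zero: "smear \<alpha> (bump w) (\<lambda>x. gauge_weight \<alpha> x * (?u x)\<^sup>2) t1 = 0"
    by (rule vertical_conv_rellich[OF \<alpha> Q_def X S eq ft(2) gt(2) ht(2) ft(1) gt(1) ht(1) \<eta>(1) r0 region Q3
        assms(4) w(1) small w(3)])
  let ?q = "\<lambda>x. gauge_weight \<alpha> x * (?u x)\<^sup>2"
  let ?F = "\<lambda>x. radial \<alpha> (\<lambda>s. bump w (s - t1) * exp s) x * ?q x"
  \<comment> \<open>A continuous nonnegative integrand with zero integral vanishes at x1, yet each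
    of its factors is positive there.\<close>
  have "compact_supp ?F"
    by (intro compact_supp_radial_mult[OF \<alpha> compact_supp_shift[OF compact_supp_bump[OF w(1)]]]
        continuous_intros continuous_gauge_weight[OF \<alpha>]
        continuous_on_subset[OF u_cont]) auto
  moreover have "?F x \<ge> 0" for x
    using gauge_weight_le(1)[OF \<alpha>, of x] by (simp add: radial_def bump_nonneg)
  moreover have "(LINT x|lborel. ?F x) = 0" using zero by (simp add: smear_def radial_integral_def)
  ultimately have "?F x1 = 0" by (rule compact_supp_integral_eq_0)
  moreover have "bump w (0 :: real) > 0" using bump_real_pos[OF w(1), of 0] w(1) by simp
  moreover have "gauge_weight \<alpha> x1 > 0" using gauge_pow_pos[OF \<alpha> x1_0] x1(3) by (simp add: gauge_weight_def)
  ultimately show False using x1_0 u1 by (simp add: radial_def t1_def)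
qed

end
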